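(* Let $(\Omega,\mathcal{A},P)$ be a probability space with a filtration $\mathcal{G}=(\mathcal{G}_n)_{n\ge0}$ and let $(X_n)_{n\ge1}$ be a $\mathcal{G}$-c.i.d. sequence of real random variables. For $n\ge1$ and $t\in\mathbb{R}$ let $$B_{n,t}=\frac{1}{\sqrt n}\sum_{k=1}^n\bigl(I_{\{X_k\le t\}}-E[I_{\{X_k\le t\}}\mid\mathcal{G}_{k-1}]\bigr),$$ and regard $B_n=\{B_{n,t}:t\in\mathbb{R}\}$ as a process with paths in $\mathcal{X}$. Suppose that for all $\varepsilon,\eta>0$ there is a finite partition $I_1,\dots,I_m$ of $\mathbb{R}$ by right-open intervals such that $$\limsup_nP\Bigl(\max_k\sup_{s,t\in I_k}|B_{n,s}-B_{n,t}|>\varepsilon\Bigr)<\eta .$$ Then $B_n\to\mathbb{G}^F$ in distribution (in $\mathcal{X}$ under uniform distance) and $\mathbb{G}^F$ is tight.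
   Context: $(X_n)_{n\ge1}$ is $\mathcal{G}$-c.i.d. if it is adapted to $\mathcal{G}$ and, for all $k>n\ge0$ and all bounded Borel $f:\mathbb{R}\to\mathbb{R}$, $E[f(X_k)\mid\mathcal{G}_n]=E[f(X_{n+1})\mid\mathcal{G}_n]$ a.s. Its directing measure is the (a.s. unique, always existing) random probability measure $\alpha$ on $\mathbb{R}$ such that, for each bounded continuous $f:\mathbb{R}\to\mathbb{R}$, $E[f(X_{n+1})\mid\mathcal{G}_n]\to\int f\,d\alpha$ a.s. $\mathcal{X}$ is the set of real cadlag functions $x$ on $\mathbb{R}$ with $\lim_{|t|\to\infty}x(t)=0$, equipped with uniform distance. Versions of the conditional probabilities are chosen (regular conditional distributions) so that, up to modification on $P$-null sets, the paths of $B_n$ lie in $\mathcal{X}$. Weak convergence is in the Hoffmann-Jørgensen sense. A random element $Z$ of $\mathcal{X}$ (a map from a probability space into $\mathcal{X}$) is measurable if $\{Z\in B\}$ is measurable for all Borel $B\subset\mathcal{X}$; it is tight if it is indistinguishable from a measurable random element with a tight probability distribution. If $Z$ is measurable and $Z_n$ are arbitrary random elements of $\mathcal{X}$, $Z_n\to Z$ in distribution means $E^*[f(Z_n)]\to E[f(Z)]$ for all bounded continuous $f:\mathcal{X}\to\mathbb{R}$, with $E^*$ the outer expectation. If $Z$ is not measurable but indistinguishable from a measurable random element $Z'$, then $Z_n\to Z$ in distribution means $Z_n\to Z'$ in distribution. $\mathbb{G}^F$ denotes a process, on some probability space, of the form $\mathbb{G}^F_t=\mathbb{G}^0_{F(t)}$,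 $t\in\mathbb{R}$, where $\mathbb{G}^0$ is a standard Brownian bridge on $[0,1]$ and $F$ is a random distribution function, independent of $\mathbb{G}^0$, such that $(F(t_1),\dots,F(t_r))$ has the same distribution as $(\alpha(-\infty,t_1],\dots,\alpha(-\infty,t_r])$ for all $t_1,\dots,t_r\in\mathbb{R}$. *)

theory Defs
  imports "HOL-Probability.Probability" "HOL-Library.Disjoint_Sets"
begin

section \<open>Cadlag functions vanishing at infinity, with the uniform distance\<close>

definition cadlag :: "(real \<Rightarrow> real) \<Rightarrow> bool" where
  "cadlag x \<longleftrightarrow> (\<forall>t. continuous (at_right t) x \<and> (\<exists>l. (x \<longlongrightarrow> l) (at_left t)))"

typedef cadlag0 = "{x :: real \<Rightarrow> real. cadlag x \<and> (x \<longlongrightarrow> 0) at_top \<and> (x \<longlongrightarrow> 0) at_bot}"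
  morphisms path Abs_cadlag0
  by (rule exI[of _ "\<lambda>_. 0"]) (auto simp: cadlag_def)

lemma eventually_bounded_of_tendsto:
  fixes x :: "real \<Rightarrow> real"
  assumes "(x \<longlongrightarrow> l) F"
  shows "\<forall>\<^sub>F s in F. \<bar>x s\<bar> \<le> \<bar>l\<bar> + 1"
proof -
  have "\<forall>\<^sub>F s in F. dist (x s) l < 1"
    using assms by (rule tendstoD) simp
  then show ?thesis
    by eventually_elim (auto simp: dist_real_def)
qed

lemma bounded_range_path: "bounded (range (path x))"
proof -
  have cad: "cadlag (path x)" and top: "(path x \<longlongrightarrow> 0) at_top" and bot: "(path x \<longlongrightarrow> 0) at_bot"
    using path[of x] by auto
  obtain b where b: "\<And>s. s \<ge> b \<Longrightarrow> \<bar>path x s\<bar> \<le> 1"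
    using eventually_bounded_of_tendsto[OF top] by (auto simp: eventually_at_top_linorder)
  obtain a where a: "\<And>s. s \<le> a \<Longrightarrow> \<bar>path x s\<bar> \<le> 1"
    using eventually_bounded_of_tendsto[OF bot] by (auto simp: eventually_at_bot_linorder)
  have "\<exists>U c. open U \<and> t \<in> U \<and> (\<forall>s\<in>U. \<bar>path x s\<bar> \<le> c)" for t
  proof -
    obtain l where l: "(path x \<longlongrightarrow> l) (at_left t)"
      using cad by (auto simp: cadlag_def)
    have r: "(path x \<longlongrightarrow> path x t) (at_right t)"
      using cad by (auto simp: cadlag_def continuous_within)
    define c where "c = \<bar>path x t\<bar> + \<bar>l\<bar> + 1"
    have "\<forall>\<^sub>F s in at_left t. \<bar>path x s\<bar> \<le> c" "\<forall>\<^sub>F s in at_right t. \<bar>path x s\<bar> \<le> c"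
      using eventually_bounded_of_tendsto[OF l] eventually_bounded_of_tendsto[OF r]
      by (auto elim!: eventually_mono simp: c_def)
    then have "\<forall>\<^sub>F s in at t. \<bar>path x s\<bar> \<le> c"
      by (simp add: eventually_at_split)
    then obtain U where "open U" "t \<in> U" "\<And>s. s \<in> U \<Longrightarrow> s \<noteq> t \<Longrightarrow> \<bar>path x s\<bar> \<le> c"
      by (auto simp: eventually_at_topological)
    moreover have "\<bar>path x t\<bar> \<le> c"
      by (simp add: c_def)
    ultimately show ?thesis
      by metis
  qed
  then have "\<forall>t. \<exists>U c. open U \<and> t \<in> U \<and> (\<forall>s\<in>U. \<bar>path x s\<bar> \<le> c)"
    by blast
  then obtain U c where Uc: "\<forall>t. open (U t) \<and> t \<in> U t \<and> (\<forall>s\<in>U t. \<bar>path x s\<bar> \<le> c t)"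
    unfolding choice_iff by (elim exE)
  then have U: "\<And>t. open (U t)" "\<And>t. t \<in> U t" "\<And>t s. s \<in> U t \<Longrightarrow> \<bar>path x s\<bar> \<le> c t"
    by auto
  obtain D where D: "D \<subseteq> {a..b}" "finite D" "{a..b} \<subseteq> (\<Union>t\<in>D. U t)"
  proof (rule compactE_image)
    show "compact {a..b}" by simp
    show "{a..b} \<subseteq> (\<Union>t\<in>{a..b}. U t)" using U(2) by auto
  qed (use U(1) in auto)
  have "\<bar>path x s\<bar> \<le> (\<Sum>t\<in>D. \<bar>c t\<bar>) + 1" for s
  proof (cases "s \<in> {a..b}")
    case True
    then obtain t where t: "t \<in> D" "s \<in> U t"
      using D by blast
    then have "\<bar>path x s\<bar> \<le> \<bar>c t\<bar>"
      using U(3) by fastforce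
    also have "\<dots> \<le> (\<Sum>t\<in>D. \<bar>c t\<bar>)"
      using D t by (intro member_le_sum) auto
    finally show ?thesis by simp
  next
    case False
    then have "\<bar>path x s\<bar> \<le> 1"
      using a[of s] b[of s] by auto
    moreover have "0 \<le> (\<Sum>t\<in>D. \<bar>c t\<bar>)"
      by (intro sum_nonneg) simp
    ultimately show ?thesis by linarith
  qed
  then show ?thesis
    by (auto simp: bounded_iff)
qed

instantiation cadlag0 :: metric_space
begin

definition dist_cadlag0 :: "cadlag0 \<Rightarrow> cadlag0 \<Rightarrow> real" where
  "dist_cadlag0 x y = (SUP t. \<bar>path x t - path y t\<bar>)"

definition uniformity_cadlag0 :: "(cadlag0 \<times> cadlag0) filter" where
  "uniformity_cadlag0 = (INF e\<in>{0 <..}. principal {(x, y). dist x y < e})"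

definition open_cadlag0 :: "cadlag0 set \<Rightarrow> bool" where
  "open_cadlag0 S = (\<forall>x\<in>S. \<forall>\<^sub>F (x', y) in uniformity. x' = x \<longrightarrow> y \<in> S)"

lemma abs_path_diff_le_dist: "\<bar>path x t - path y t\<bar> \<le> dist x y"
proof -
  have "bounded (range (\<lambda>t. dist (path x t) (path y t)))"
    by (intro bounded_dist_comp bounded_range_path)
  then show ?thesis
    unfolding dist_cadlag0_def
    by (intro cSUP_upper bounded_imp_bdd_above) (auto simp: dist_real_def)
qed

lemma dist_cadlag0_le: "(\<And>t. \<bar>path x t - path y t\<bar> \<le> c) \<Longrightarrow> dist x y \<le> c"
  unfolding dist_cadlag0_def by (intro cSUP_least) auto

instance
proof
  fix x y z :: cadlag0
  show "dist x y = 0 \<longleftrightarrow> x = y"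
  proof
    assume "dist x y = 0"
    then have "path x t = path y t" for t
      using abs_path_diff_le_dist[of x t y] by simp
    then show "x = y"
      by (simp add: path_inject[symmetric] fun_eq_iff)
  qed (simp add: dist_cadlag0_def)
  show "dist x y \<le> dist x z + dist y z"
  proof (rule dist_cadlag0_le)
    fix t
    show "\<bar>path x t - path y t\<bar> \<le> dist x z + dist y z"
      using abs_path_diff_le_dist[of x t z] abs_path_diff_le_dist[of y t z] by linarith
  qed
qed (rule open_cadlag0_def uniformity_cadlag0_def)+

end

section \<open>Conditionally identically distributed sequences\<close>

definition filtered_prob_space :: "'a measure \<Rightarrow> (nat \<Rightarrow> 'a measure) \<Rightarrow> bool" where
  "filtered_prob_space M G \<longleftrightarrow>
     prob_space M \<and> (\<forall>n. subalgebra M (G n)) \<and> filtration (space M) G"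

text \<open>Sequences \<open>(X\<^sub>n)\<close> with \<open>n \<ge> 1\<close> are functions on \<^typ>\<open>nat\<close> whose value at \<open>0\<close> is ignored.\<close>

definition cid :: "'a measure \<Rightarrow> (nat \<Rightarrow> 'a measure) \<Rightarrow> (nat \<Rightarrow> 'a \<Rightarrow> real) \<Rightarrow> bool" where
  "cid M G X \<longleftrightarrow>
     (\<forall>n\<ge>1. X n \<in> borel_measurable (G n)) \<and>
     (\<forall>k n. n < k \<longrightarrow> (\<forall>f :: real \<Rightarrow> real. f \<in> borel_measurable borel \<longrightarrow> bounded (range f) \<longrightarrow>
        (AE \<omega> in M. real_cond_exp M (G n) (\<lambda>\<omega>. f (X k \<omega>)) \<omega>
                  = real_cond_exp M (G n) (\<lambda>\<omega>. f (X (Suc n) \<omega>)) \<omega>)))"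

definition directing_measure ::
  "'a measure \<Rightarrow> (nat \<Rightarrow> 'a measure) \<Rightarrow> (nat \<Rightarrow> 'a \<Rightarrow> real) \<Rightarrow> ('a \<Rightarrow> real measure) \<Rightarrow> bool" where
  "directing_measure M G X \<alpha> \<longleftrightarrow>
     \<alpha> \<in> M \<rightarrow>\<^sub>M prob_algebra borel \<and>
     (\<forall>f :: real \<Rightarrow> real. continuous_on UNIV f \<longrightarrow> bounded (range f) \<longrightarrow>
        (AE \<omega> in M. (\<lambda>n. real_cond_exp M (G n) (\<lambda>\<omega>. f (X (Suc n) \<omega>)) \<omega>)
                      \<longlonglongrightarrow> (\<integral>x. f x \<partial>(\<alpha> \<omega>))))"

definition regular_cond_distr ::
  "'a measure \<Rightarrow> 'a measure \<Rightarrow> ('a \<Rightarrow> real) \<Rightarrow> ('a \<Rightarrow> real measure) \<Rightarrow> bool" where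
  "regular_cond_distr M F Y \<kappa> \<longleftrightarrow>
     \<kappa> \<in> F \<rightarrow>\<^sub>M prob_algebra borel \<and>
     (\<forall>A \<in> sets borel. AE \<omega> in M.
        measure (\<kappa> \<omega>) A = real_cond_exp M F (\<lambda>\<omega>. indicator A (Y \<omega>)) \<omega>)"

text \<open>
  The process of interest at a fixed \<open>\<omega>\<close>: \<open>x k\<close> is the value of \<open>X\<^sub>k\<close>, and \<open>\<mu> k\<close> is the value of a
  regular conditional distribution of \<open>X\<^sub>k\<close>. Its paths lie in the function space for every such
  choice, without exceptional null sets.
\<close>

lemma compensated_empirical_path:
  fixes x :: "nat \<Rightarrow> real" and \<mu> :: "nat \<Rightarrow> real measure"
  assumes "\<And>k. 1 \<le> k \<Longrightarrow> \<mu> k \<in> space (prob_algebra borel)"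
  shows "(\<lambda>t. 1 / sqrt (real n) * (\<Sum>k = 1..n. indicator {..t} (x k) - measure (\<mu> k) {..t}))
           \<in> {x. cadlag x \<and> (x \<longlongrightarrow> 0) at_top \<and> (x \<longlongrightarrow> 0) at_bot}"
proof -
  have diff: "continuous (at_right t) (\<lambda>t. cdf M t - cdf N t)"
      "((\<lambda>t. cdf M t - cdf N t) \<longlongrightarrow> measure M {..<t} - measure N {..<t}) (at_left t)"
      "((\<lambda>t. cdf M t - cdf N t) \<longlongrightarrow> 0) at_top"
      "((\<lambda>t. cdf M t - cdf N t) \<longlongrightarrow> 0) at_bot"
    if "real_distribution M" "real_distribution N" for M N t
  proof -
    interpret M: real_distribution M by fact
    interpret N: real_distribution N by fact
    show "continuous (at_right t) (\<lambda>t. cdf M t - cdf N t)"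
      by (intro continuous_intros M.cdf_is_right_cont N.cdf_is_right_cont)
    show "((\<lambda>t. cdf M t - cdf N t) \<longlongrightarrow> measure M {..<t} - measure N {..<t}) (at_left t)"
      by (intro tendsto_diff M.cdf_at_left N.cdf_at_left)
    show "((\<lambda>t. cdf M t - cdf N t) \<longlongrightarrow> 0) at_top"
      using tendsto_diff[OF M.cdf_lim_at_top_prob N.cdf_lim_at_top_prob] by simp
    show "((\<lambda>t. cdf M t - cdf N t) \<longlongrightarrow> 0) at_bot"
      using tendsto_diff[OF M.cdf_lim_at_bot N.cdf_lim_at_bot] by simp
  qed
  define \<delta> where "\<delta> k = return borel (x k)" for k
  have \<delta>: "real_distribution (\<delta> k)" for k
    unfolding \<delta>_def real_distribution_def real_distribution_axioms_def
    by (auto intro: prob_space_return)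
  have \<mu>: "real_distribution (\<mu> k)" if "k \<in> {1..n}" for k
    using assms[of k] that unfolding real_distribution_def real_distribution_axioms_def
    by (auto simp: space_prob_algebra)
  have eq: "(\<lambda>t. 1 / sqrt (real n) * (\<Sum>k = 1..n. indicator {..t} (x k) - measure (\<mu> k) {..t}))
     = (\<lambda>t. 1 / sqrt (real n) * (\<Sum>k = 1..n. cdf (\<delta> k) t - cdf (\<mu> k) t))"
    by (simp add: cdf_def \<delta>_def measure_return)
  show ?thesis
    unfolding eq cadlag_def
  proof (intro CollectI conjI allI exI)
    fix t
    show "continuous (at_right t) (\<lambda>t. 1 / sqrt (real n) * (\<Sum>k = 1..n. cdf (\<delta> k) t - cdf (\<mu> k) t))"
      by (intro continuous_mult continuous_const continuous_sum diff(1) \<delta> \<mu>)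
    show "((\<lambda>t. 1 / sqrt (real n) * (\<Sum>k = 1..n. cdf (\<delta> k) t - cdf (\<mu> k) t)) \<longlongrightarrow>
      1 / sqrt (real n) * (\<Sum>k = 1..n. measure (\<delta> k) {..<t} - measure (\<mu> k) {..<t})) (at_left t)"
      by (intro tendsto_mult tendsto_const tendsto_sum diff(2) \<delta> \<mu>)
  next
    show "((\<lambda>t. 1 / sqrt (real n) * (\<Sum>k = 1..n. cdf (\<delta> k) t - cdf (\<mu> k) t)) \<longlongrightarrow> 0) at_top"
      by (intro tendsto_mult_right_zero tendsto_null_sum diff(3) \<delta> \<mu>)
    show "((\<lambda>t. 1 / sqrt (real n) * (\<Sum>k = 1..n. cdf (\<delta> k) t - cdf (\<mu> k) t)) \<longlongrightarrow> 0) at_bot"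
      by (intro tendsto_mult_right_zero tendsto_null_sum diff(4) \<delta> \<mu>)
  qed
qed

section \<open>Partitions into right-open intervals\<close>

text \<open>The extended endpoints cover \<open>[a, b)\<close>, \<open>(-\<infinity>, b)\<close>, \<open>[a, \<infinity>)\<close> and the whole line.\<close>

definition right_open_interval :: "real set \<Rightarrow> bool" where
  "right_open_interval I \<longleftrightarrow> (\<exists>a b :: ereal. I = {x. a \<le> ereal x \<and> ereal x < b})"

definition right_open_partition :: "real set set \<Rightarrow> bool" where
  "right_open_partition \<P> \<longleftrightarrow>
     finite \<P> \<and> partition_on UNIV \<P> \<and> (\<forall>I\<in>\<P>. right_open_interval I)"

section \<open>Weak convergence in the sense of Hoffmann-Joergensen, and tightness\<close>

text \<open>
  Outer expectation of a bounded, possibly non-measurable function. For bounded \<open>g\<close> the infimum is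
  over a nonempty set which is bounded below, and allowing extended real valued majorants with an
  expectation would not change it.
\<close>

definition outer_expectation :: "'a measure \<Rightarrow> ('a \<Rightarrow> real) \<Rightarrow> real" where
  "outer_expectation M g =
     Inf {(\<integral>\<omega>. U \<omega> \<partial>M) | U. integrable M U \<and> (\<forall>\<omega>\<in>space M. g \<omega> \<le> U \<omega>)}"

definition measurable_version :: "'b measure \<Rightarrow> ('b \<Rightarrow> cadlag0) \<Rightarrow> ('b \<Rightarrow> cadlag0) \<Rightarrow> bool" where
  "measurable_version N Z Z' \<longleftrightarrow> Z' \<in> borel_measurable N \<and> (AE \<omega> in N. Z \<omega> = Z' \<omega>)"

text \<open>
  The expectation of \<open>f \<circ> Z'\<close> is the same for all measurable versions \<open>Z'\<close> of \<open>Z\<close>, and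
  \<open>Z\<close> is one of them if it is measurable itself.
\<close>

definition converges_in_distribution ::
  "'a measure \<Rightarrow> (nat \<Rightarrow> 'a \<Rightarrow> cadlag0) \<Rightarrow> 'b measure \<Rightarrow> ('b \<Rightarrow> cadlag0) \<Rightarrow> bool" where
  "converges_in_distribution M Y N Z \<longleftrightarrow>
     (\<exists>Z'. measurable_version N Z Z' \<and>
        (\<forall>f :: cadlag0 \<Rightarrow> real. continuous_on UNIV f \<longrightarrow> bounded (range f) \<longrightarrow>
           (\<lambda>n. outer_expectation M (\<lambda>\<omega>. f (Y n \<omega>))) \<longlonglongrightarrow> (\<integral>\<omega>. f (Z' \<omega>) \<partial>N)))"

definition tight_random_element :: "'b measure \<Rightarrow> ('b \<Rightarrow> cadlag0) \<Rightarrow> bool" where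
  "tight_random_element N Z \<longleftrightarrow>
     (\<exists>Z'. measurable_version N Z Z' \<and>
        (\<forall>\<epsilon>>0. \<exists>K. compact K \<and> measure (distr N borel Z') K > 1 - \<epsilon>))"

section \<open>Brownian bridge with a random time change\<close>

definition normal_law :: "real \<Rightarrow> real \<Rightarrow> real measure" where
  "normal_law m \<sigma> =
     (if \<sigma> = 0 then return borel m else density lborel (\<lambda>x. ennreal (normal_density m \<sigma> x)))"

definition gaussian_process :: "'b measure \<Rightarrow> real set \<Rightarrow> (real \<Rightarrow> 'b \<Rightarrow> real) \<Rightarrow> bool" where
  "gaussian_process N T W \<longleftrightarrow>
     (\<forall>u\<in>T. W u \<in> borel_measurable N) \<and>
     (\<forall>J c. finite J \<longrightarrow> J \<subseteq> T \<longrightarrow>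
        (\<exists>m \<sigma>. 0 \<le> \<sigma> \<and> distr N borel (\<lambda>\<omega>. \<Sum>u\<in>J. c u * W u \<omega>) = normal_law m \<sigma>))"

definition brownian_bridge :: "'b measure \<Rightarrow> (real \<Rightarrow> 'b \<Rightarrow> real) \<Rightarrow> bool" where
  "brownian_bridge N W \<longleftrightarrow>
     gaussian_process N {0..1} W \<and>
     (\<forall>u\<in>{0..1}. (\<integral>\<omega>. W u \<omega> \<partial>N) = 0) \<and>
     (\<forall>u\<in>{0..1}. \<forall>v\<in>{0..1}. (\<integral>\<omega>. W u \<omega> * W v \<omega> \<partial>N) = min u v - u * v) \<and>
     (AE \<omega> in N. continuous_on {0..1} (\<lambda>u. W u \<omega>))"

definition distribution_function :: "(real \<Rightarrow> real) \<Rightarrow> bool" where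
  "distribution_function F \<longleftrightarrow>
     mono F \<and> (\<forall>t. continuous (at_right t) F) \<and> (F \<longlongrightarrow> 0) at_bot \<and> (F \<longlongrightarrow> 1) at_top"

text \<open>
  \<open>Z\<close> is a realisation, on the probability space \<open>N\<close>, of the process \<open>t \<mapsto> W (F t)\<close>. The identity is
  required almost surely, simultaneously in \<open>t\<close>, because a Brownian bridge is continuous and vanishes
  at \<open>0\<close> and \<open>1\<close> only almost surely.
\<close>

definition time_changed_bridge ::
  "'a measure \<Rightarrow> ('a \<Rightarrow> real measure) \<Rightarrow> 'b measure \<Rightarrow> ('b \<Rightarrow> cadlag0) \<Rightarrow> bool" where
  "time_changed_bridge M \<alpha> N Z \<longleftrightarrow> prob_space N \<and>
     (\<exists>W F. brownian_bridge N W \<and>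
        (\<forall>\<omega>\<in>space N. distribution_function (F \<omega>)) \<and>
        prob_space.indep_var N
          (\<Pi>\<^sub>M u\<in>{0..1}. borel) (\<lambda>\<omega>. \<lambda>u\<in>{0..1}. W u \<omega>) (\<Pi>\<^sub>M t\<in>UNIV. borel) F \<and>
        (\<forall>(r :: nat) t. distr N (\<Pi>\<^sub>M i\<in>{1..r}. borel) (\<lambda>\<omega>. \<lambda>i\<in>{1..r}. F \<omega> (t i))
                     = distr M (\<Pi>\<^sub>M i\<in>{1..r}. borel) (\<lambda>\<omega>. \<lambda>i\<in>{1..r}. measure (\<alpha> \<omega>) {..t i})) \<and>
        (AE \<omega> in N. \<forall>t. path (Z \<omega>) t = W (F \<omega> t) \<omega>))"

end

theory Submission
  imports Defs "HOL-Real_Asymp.Real_Asymp"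
begin

text \<open>
  The finite-dimensional distributions of \<open>B\<^sub>n\<close> are handled by characteristic functions. By
  conditional identity in distribution, \<open>E[I(X\<^sub>n\<^sub>+\<^sub>1 \<le> t) | G\<^sub>n]\<close> tends to \<open>\<alpha>(-\<infinity>, t]\<close> in \<open>L\<^sup>1\<close>, so that
  the conditional variances of the bounded martingale differences
  \<open>d\<^sub>k = \<Sum>\<^sub>i c\<^sub>i (I(X\<^sub>k \<le> t\<^sub>i) - E[I(X\<^sub>k \<le> t\<^sub>i) | G\<^sub>k\<^sub>-\<^sub>1])\<close> tend in \<open>L\<^sup>1\<close> to a random variable \<open>w\<close>, the
  variance given \<open>\<alpha>\<close> of \<open>\<Sum>\<^sub>i c\<^sub>i W(\<alpha>(-\<infinity>, t\<^sub>i])\<close> for a Brownian bridge \<open>W\<close> independent of \<open>\<alpha>\<close>. Replacing \<open>w\<close> by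
  the conditional variance at a fixed late time \<open>m\<close>, which is known when all later differences are
  drawn, a telescoping argument gives the limit \<open>E exp(-w/2)\<close>.

  The hypothesis on the oscillations says that \<open>B\<^sub>n\<close> is uniformly close, with high probability and
  for large \<open>n\<close>, to a step function determined by finitely many of its values. This passes to the
  limit process, which is therefore almost surely a uniform limit of finite-dimensional random
  elements; this gives measurability, tightness, and the convergence of the outer expectations.
\<close>

section \<open>Step functions in the space of cadlag functions\<close>

text \<open>The space is not separable in the uniform distance, so measurable coordinates do not
  make a random element Borel measurable; neither \<open>B n\<close> nor \<open>GF\<close> can be
  treated as one. Everything is therefore done with coordinates, and Borel measurability enters only
  through projections onto step functions over a fixed finite grid, which depend continuously on
  finitely many coordinates. The limit variance \<open>w\<close> depends on the whole future and
  cannot enter an exponential martingale, whereas \<open>v m\<close> for fixed \<open>m\<close> can;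
  the price is the mean of \<open>\<bar>v m - v k\<bar>\<close>, small for late \<open>m\<close>.
  The directing measure is tested by continuous functions only and may have an atom at
  \<open>t\<close>; that the passage to the indicator of \<open>{..t}\<close> is uniform in
  \<open>k\<close> rests on all \<open>X k\<close> having the same law. For the limit process,
  \<open>W (F t)\<close> is an evaluation at a random time; it is reached by rounding
  \<open>F t\<close> to a grid and using the continuity of bridge paths.\<close>

lemma uniform_limit_exchange:
  fixes f :: "nat \<Rightarrow> 'a \<Rightarrow> real"
  assumes u: "uniform_limit UNIV f g sequentially" and l: "\<And>n. (f n \<longlongrightarrow> l n) F" and F: "F \<noteq> bot"
  obtains L where "l \<longlonglongrightarrow> L" "(g \<longlongrightarrow> L) F"
proof -
  have close: "\<exists>n0. \<forall>n\<ge>n0. \<forall>x. \<bar>f n x - g x\<bar> < e" if "e > 0" for e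
    using u that unfolding uniform_limit_iff eventually_sequentially dist_real_def by fastforce
  have "Cauchy l"
    unfolding Cauchy_iff
  proof (intro allI impI)
    fix e :: real assume "e > 0"
    then obtain n0 where n0: "\<And>n x. n \<ge> n0 \<Longrightarrow> \<bar>f n x - g x\<bar> < e / 3"
      using close[of "e / 3"] by auto
    show "\<exists>K. \<forall>m\<ge>K. \<forall>n\<ge>K. norm (l m - l n) < e"
    proof (intro exI[of _ n0] allI impI)
      fix m n assume mn: "m \<ge> n0" "n \<ge> n0"
      have "\<bar>l m - l n\<bar> \<le> 2 * e / 3"
      proof (rule tendsto_upperbound[OF _ _ F])
        show "((\<lambda>x. \<bar>f m x - f n x\<bar>) \<longlongrightarrow> \<bar>l m - l n\<bar>) F"
          by (intro tendsto_intros l)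
        have "\<bar>f m x - f n x\<bar> \<le> 2 * e / 3" for x
          using n0[OF mn(1), of x] n0[OF mn(2), of x] by linarith
        then show "\<forall>\<^sub>F x in F. \<bar>f m x - f n x\<bar> \<le> 2 * e / 3" by simp
      qed
      then show "norm (l m - l n) < e" using \<open>e > 0\<close> by simp
    qed
  qed
  then obtain L where L: "l \<longlonglongrightarrow> L"
    using real_Cauchy_convergent convergent_def by blast
  have "(g \<longlongrightarrow> L) F"
  proof (rule tendstoI)
    fix e :: real assume "e > 0"
    then obtain n0 where n0: "\<And>n x. n \<ge> n0 \<Longrightarrow> \<bar>f n x - g x\<bar> < e / 3"
      using close[of "e / 3"] by auto
    obtain n1 where n1: "\<And>n. n \<ge> n1 \<Longrightarrow> \<bar>l n - L\<bar> < e / 3"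
      using LIMSEQ_D[OF L, of "e / 3"] \<open>e > 0\<close> by auto
    define n where "n = max n0 n1"
    have "\<forall>\<^sub>F x in F. dist (f n x) (l n) < e / 3"
      using l \<open>e > 0\<close> by (intro tendstoD) auto
    then show "\<forall>\<^sub>F x in F. dist (g x) L < e"
    proof eventually_elim
      case (elim x)
      moreover have "\<bar>f n x - g x\<bar> < e / 3" "\<bar>l n - L\<bar> < e / 3"
        using n0[of n x] n1[of n] by (auto simp: n_def)
      ultimately show ?case
        unfolding dist_real_def by linarith
    qed
  qed
  with L that show thesis by blast
qed

text \<open>Interchanging the uniform limit with the one-sided limits and with the limits at
  infinity preserves all defining properties. Completeness later turns closed, totally bounded sets
  into compact ones.\<close>

instance cadlag0 :: complete_space
proof
  fix X :: "nat \<Rightarrow> cadlag0" assume X: "Cauchy X"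
  have "uniformly_Cauchy_on UNIV (\<lambda>n. path (X n))"
    unfolding uniformly_Cauchy_on_def
  proof (intro allI impI)
    fix e :: real assume "e > 0"
    then obtain N where "\<forall>m\<ge>N. \<forall>n\<ge>N. dist (X m) (X n) < e"
      using metric_CauchyD[OF X] by blast
    then show "\<exists>N. \<forall>x\<in>UNIV. \<forall>m\<ge>N. \<forall>n\<ge>N. dist (path (X m) x) (path (X n) x) < e"
      using abs_path_diff_le_dist le_less_trans unfolding dist_real_def by blast
  qed
  then obtain g where g: "uniform_limit UNIV (\<lambda>n. path (X n)) g sequentially"
    using Cauchy_uniformly_convergent unfolding uniformly_convergent_on_def by blast
  have mem: "cadlag (path (X n))" "(path (X n) \<longlongrightarrow> 0) at_top" "(path (X n) \<longlongrightarrow> 0) at_bot" for n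
    using path[of "X n"] by auto
  have "\<exists>l. (g \<longlongrightarrow> l) (at_left t)" for t
  proof -
    have "\<forall>n. \<exists>l. (path (X n) \<longlongrightarrow> l) (at_left t)"
      using mem(1) by (simp add: cadlag_def)
    then obtain l where "\<And>n. (path (X n) \<longlongrightarrow> l n) (at_left t)"
      by metis
    from uniform_limit_exchange[OF g this] show ?thesis by auto
  qed
  moreover have "continuous (at_right t) g" for t
  proof -
    have "(path (X n) \<longlongrightarrow> path (X n) t) (at_right t)" for n
      using mem(1) by (simp add: cadlag_def continuous_within)
    from uniform_limit_exchange[OF g this]
    obtain L where L: "(\<lambda>n. path (X n) t) \<longlonglongrightarrow> L" "(g \<longlongrightarrow> L) (at_right t)" by auto
    have "L = g t"
      using L(1) tendsto_uniform_limitI[OF g, of t] LIMSEQ_unique by auto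
    with L show ?thesis by (simp add: continuous_within)
  qed
  moreover have "(g \<longlongrightarrow> 0) F" if "\<And>n. (path (X n) \<longlongrightarrow> 0) F" "F \<noteq> bot" for F
    by (rule uniform_limit_exchange[OF g that]) (simp add: LIMSEQ_const_iff)
  then have "(g \<longlongrightarrow> 0) at_top" "(g \<longlongrightarrow> 0) at_bot"
    using mem by auto
  ultimately have pg: "path (Abs_cadlag0 g) = g"
    by (intro Abs_cadlag0_inverse) (auto simp: cadlag_def)
  have "X \<longlonglongrightarrow> Abs_cadlag0 g"
  proof (rule metric_LIMSEQ_I)
    fix e :: real assume "e > 0"
    then have "\<forall>\<^sub>F n in sequentially. \<forall>x\<in>UNIV. dist (path (X n) x) (g x) < e / 2"
      using g unfolding uniform_limit_iff by (auto dest!: spec[of _ "e / 2"])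
    then obtain N where N: "\<And>n x. n \<ge> N \<Longrightarrow> \<bar>path (X n) x - g x\<bar> < e / 2"
      by (auto simp: eventually_sequentially dist_real_def)
    have "dist (X n) (Abs_cadlag0 g) \<le> e / 2" if "n \<ge> N" for n
      using N[OF that] by (intro dist_cadlag0_le) (simp add: pg less_imp_le)
    then show "\<exists>N. \<forall>n\<ge>N. dist (X n) (Abs_cadlag0 g) < e"
      using \<open>e > 0\<close> by (intro exI[of _ N]) fastforce
  qed
  then show "convergent X" by (auto simp: convergent_def)
qed

section \<open>Step functions and their dependence on the heights\<close>

lemma cadlag_indicator: "cadlag (indicator {a..<b::real})"
  unfolding cadlag_def
proof (intro allI conjI)
  fix t
  have "\<forall>\<^sub>F x in at_right t. indicator {a..<b} x = (indicator {a..<b} t :: real)"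
  proof (cases "t < a \<or> b \<le> t")
    case True
    then show ?thesis
    proof
      assume "t < a"
      with eventually_at_right_real[OF this] show ?thesis
        by (auto elim!: eventually_mono)
    next
      assume "b \<le> t"
      with eventually_at_right_less[of t] show ?thesis
        by (auto elim!: eventually_mono)
    qed
  next
    case False
    then have "t < b" by simp
    from eventually_at_right_real[OF this] False show ?thesis
      by (auto elim!: eventually_mono)
  qed
  then have "((indicator {a..<b} :: real \<Rightarrow> real) \<longlongrightarrow> indicator {a..<b} t) (at_right t)"
    by (rule tendsto_eventually)
  then show "continuous (at_right t) (indicator {a..<b} :: real \<Rightarrow> real)"
    by (simp add: continuous_within)
  have "\<forall>\<^sub>F x in at_left t. indicator {a..<b} x = (of_bool (a < t \<and> t \<le> b) :: real)"
  proof (cases "t \<le> a \<or> b < t")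
    case True
    then show ?thesis
    proof
      assume "t \<le> a"
      with eventually_at_left_real[of "t - 1" t] show ?thesis
        by (auto elim!: eventually_mono)
    next
      assume "b < t"
      with eventually_at_left_real[OF this] show ?thesis
        by (auto elim!: eventually_mono)
    qed
  next
    case False
    then have "a < t" by simp
    from eventually_at_left_real[OF this] False show ?thesis
      by (auto elim!: eventually_mono)
  qed
  then show "\<exists>l::real. (indicator {a..<b} \<longlongrightarrow> l) (at_left t)"
    by (blast intro: tendsto_eventually)
qed

text \<open>The heights form a function on all of \<open>nat\<close>, so that continuity and
  compactness in \<open>v\<close> can be expressed in the product topology of
  \<open>nat \<Rightarrow> real\<close>.\<close>

definition step :: "nat \<Rightarrow> (nat \<Rightarrow> real) \<Rightarrow> (nat \<Rightarrow> real) \<Rightarrow> (nat \<Rightarrow> real) \<Rightarrow> cadlag0" where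
  "step r a b v = Abs_cadlag0 (\<lambda>t. \<Sum>i<r. v i * indicator {a i..<b i} t)"

lemma path_step: "path (step r a b v) t = (\<Sum>i<r. v i * indicator {a i..<b i} t)"
proof -
  have "(indicator {c..<d} \<longlongrightarrow> (0::real)) at_top" "(indicator {c..<d} \<longlongrightarrow> (0::real)) at_bot" for c d :: real
    using eventually_mono[OF eventually_ge_at_top[of d], of "\<lambda>x. indicator {c..<d} x = (0::real)"]
      eventually_mono[OF eventually_le_at_bot[of "c - 1"], of "\<lambda>x. indicator {c..<d} x = (0::real)"]
    by (auto intro!: tendsto_eventually)
  moreover have "cadlag (\<lambda>t. \<Sum>i<r. v i * indicator {a i..<b i} t)"
    unfolding cadlag_def
  proof (intro allI conjI)
    fix t
    have "\<forall>i. \<exists>l. ((indicator {a i..<b i} :: real \<Rightarrow> real) \<longlongrightarrow> l) (at_left t)"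
      using cadlag_indicator by (simp add: cadlag_def)
    then obtain l where l: "\<And>i. ((indicator {a i..<b i} :: real \<Rightarrow> real) \<longlongrightarrow> l i) (at_left t)" by metis
    show "\<exists>l. ((\<lambda>t. \<Sum>i<r. v i * indicator {a i..<b i} t) \<longlongrightarrow> l) (at_left t)"
      by (rule exI[of _ "\<Sum>i<r. v i * l i"]) (intro tendsto_sum tendsto_mult_left l)
    show "continuous (at_right t) (\<lambda>t. \<Sum>i<r. v i * indicator {a i..<b i} t)"
      using cadlag_indicator by (intro continuous_intros) (auto simp: cadlag_def)
  qed
  ultimately show ?thesis
    unfolding step_def
    by (subst Abs_cadlag0_inverse)
       (intro CollectI conjI tendsto_null_sum tendsto_mult_right_zero, assumption+, rule refl)
qed

lemma step_cong: "(\<And>i. i < r \<Longrightarrow> v i = w i) \<Longrightarrow> step r a b v = step r a b w"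
  unfolding step_def by (intro arg_cong[where f=Abs_cadlag0] ext sum.cong) auto

text \<open>Taking the sum instead of the maximum keeps the bound valid for overlapping intervals,
  so disjointness never has to be carried along.\<close>

lemma dist_step_le: "dist (step r a b v) (step r a b w) \<le> (\<Sum>i<r. \<bar>v i - w i\<bar>)"
proof (rule dist_cadlag0_le)
  fix t
  have "\<bar>path (step r a b v) t - path (step r a b w) t\<bar> = \<bar>\<Sum>i<r. (v i - w i) * indicator {a i..<b i} t\<bar>"
    by (simp add: path_step sum_subtractf left_diff_distrib)
  also have "\<dots> \<le> (\<Sum>i<r. \<bar>v i - w i\<bar>)"
    by (rule order_trans[OF sum_abs], rule sum_mono) (simp add: abs_mult split: split_indicator)
  finally show "\<bar>path (step r a b v) t - path (step r a b w) t\<bar> \<le> (\<Sum>i<r. \<bar>v i - w i\<bar>)" .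
qed

lemma continuous_step:
  assumes "\<And>i. i < r \<Longrightarrow> continuous_on S (\<lambda>x. v x i)"
  shows "continuous_on S (\<lambda>x. step r a b (v x))"
  unfolding continuous_on_def
proof
  fix x assume "x \<in> S"
  show "((\<lambda>x. step r a b (v x)) \<longlongrightarrow> step r a b (v x)) (at x within S)"
  proof (rule iffD2[OF tendsto_dist_iff], rule tendsto_0_le[where K=1])
    show "((\<lambda>y. \<Sum>i<r. \<bar>v y i - v x i\<bar>) \<longlongrightarrow> 0) (at x within S)"
      using assms \<open>x \<in> S\<close>
      by (intro tendsto_null_sum tendsto_rabs_zero LIM_zero) (auto simp: continuous_on_def)
    show "\<forall>\<^sub>F y in at x within S. norm (dist (step r a b (v y)) (step r a b (v x)))
        \<le> norm (\<Sum>i<r. \<bar>v y i - v x i\<bar>) * 1"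
      by (auto simp: dist_step_le)
  qed
qed

lemma continuous_path: "continuous_on S (\<lambda>x. path x t)"
  unfolding continuous_on_def
proof
  fix x assume "x \<in> S"
  show "((\<lambda>x. path x t) \<longlongrightarrow> path x t) (at x within S)"
  proof (rule iffD2[OF tendsto_dist_iff], rule tendsto_0_le[where K=1])
    show "((\<lambda>y. dist y x) \<longlongrightarrow> 0) (at x within S)"
      using tendsto_dist_iff[of "\<lambda>y. y" x "at x within S"] by simp
    show "\<forall>\<^sub>F y in at x within S. norm (dist (path y t) (path x t)) \<le> norm (dist y x) * 1"
      by (auto simp: dist_real_def abs_path_diff_le_dist)
  qed
qed

text \<open>An unbounded interval is recorded only through the end of the line that it contains:
  there the path tends to 0, and 0 will be the value of the step function on the whole
  interval.\<close>

lemma right_open_interval_cases: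
  assumes "right_open_interval I" "I \<noteq> {}"
  obtains a b where "a < b" "I = {a..<b}" | "\<forall>\<^sub>F t in at_top. t \<in> I" | "\<forall>\<^sub>F t in at_bot. t \<in> I"
proof -
  obtain a b :: ereal where I: "I = {x. a \<le> ereal x \<and> ereal x < b}"
    using assms by (auto simp: right_open_interval_def)
  obtain t where t: "a \<le> ereal t" "ereal t < b" using assms(2) I by auto
  show thesis
  proof (cases a)
    case (real c)
    show thesis
    proof (cases b)
      case (real d)
      with \<open>a = ereal c\<close> I have "I = {c..<d}" by auto
      with \<open>a = ereal c\<close> real t that(1)[of c d] show thesis by auto
    next
      case PInf
      with \<open>a = ereal c\<close> I have "I = {c..}" by auto
      then show thesis using that(2) eventually_ge_at_top[of c] by simp
    qed (use t in auto)
  next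
    case MInf
    with I t have "{..t} \<subseteq> I"
      by (auto intro: le_less_trans[OF _ t(2)])
    then show thesis
      using that(3) eventually_mono[OF eventually_le_at_bot[of t], of "\<lambda>s. s \<in> I"] by blast
  qed (use t in auto)
qed

lemma step_approximation:
  assumes "right_open_partition \<P>"
  obtains r a b where "\<And>x e. (\<And>I s t. I \<in> \<P> \<Longrightarrow> s \<in> I \<Longrightarrow> t \<in> I \<Longrightarrow> \<bar>path x s - path x t\<bar> \<le> e)
    \<Longrightarrow> dist x (step r a b (\<lambda>i. path x (a i))) \<le> e"
proof -
  have fin: "finite \<P>" and part: "partition_on UNIV \<P>" and int: "\<And>I. I \<in> \<P> \<Longrightarrow> right_open_interval I"
    using assms by (auto simp: right_open_partition_def)
  define \<J> where "\<J> = {I \<in> \<P>. \<exists>a b. a < b \<and> I = {a..<b}}"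
  obtain h where h: "bij_betw h {0..<card \<J>} \<J>"
    using ex_bij_betw_nat_finite[of \<J>] fin by (auto simp: \<J>_def)
  define r where "r = card \<J>"
  have "h i \<in> \<J>" if "i < r" for i
    using bij_betwE[OF h] that by (simp add: r_def)
  then have "\<forall>i\<in>{..<r}. \<exists>a b. a < b \<and> h i = {a..<b}"
    by (auto simp: \<J>_def)
  then obtain a where a: "\<forall>i\<in>{..<r}. \<exists>b. a i < b \<and> h i = {a i..<b}"
    by (auto dest!: bchoice)
  obtain b where b: "\<forall>i\<in>{..<r}. a i < b i \<and> h i = {a i..<b i}"
    using bchoice[OF a] by (elim exE)
  then have ab: "\<And>i. i < r \<Longrightarrow> a i < b i" "\<And>i. i < r \<Longrightarrow> h i = {a i..<b i}"
    by auto
  have hP: "h i \<in> \<P>" if "i < r" for i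
    using h that unfolding bij_betw_def r_def by (auto simp: \<J>_def lessThan_atLeast0)
  have disj: "I = J" if "I \<in> \<P>" "J \<in> \<P>" "t \<in> I" "t \<in> J" for I J t
    using part that unfolding partition_on_def disjoint_def by blast
  have "dist x (step r a b (\<lambda>i. path x (a i))) \<le> e"
    if osc: "\<And>I s t. I \<in> \<P> \<Longrightarrow> s \<in> I \<Longrightarrow> t \<in> I \<Longrightarrow> \<bar>path x s - path x t\<bar> \<le> e" for x e
  proof (rule dist_cadlag0_le)
    fix t
    obtain I where I: "I \<in> \<P>" "t \<in> I"
      using part unfolding partition_on_def by blast
    have "(I \<in> \<J> \<or> (\<forall>\<^sub>F t in at_top. t \<in> I)) \<or> (\<forall>\<^sub>F t in at_bot. t \<in> I)"
    proof (rule right_open_interval_cases[OF int[OF I(1)]])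
      show "I \<noteq> {}" using I(2) by auto
    qed (use I(1) in \<open>auto simp: \<J>_def\<close>)
    have lim: "(path x \<longlongrightarrow> 0) at_top" "(path x \<longlongrightarrow> 0) at_bot"
      using path[of x] by auto
    show "\<bar>path x t - path (step r a b (\<lambda>i. path x (a i))) t\<bar> \<le> e"
    proof (cases "I \<in> \<J>")
      case True
      then obtain i where i: "i < r" "h i = I"
        using bij_betw_imp_surj_on[OF h] unfolding r_def by (metis imageE atLeastLessThan_iff)
      have "indicator {a j..<b j} t = (if j = i then 1 else 0 :: real)" if "j < r" for j
      proof -
        have "t \<in> h j \<longleftrightarrow> j = i"
          using disj[OF hP[OF that] I(1) _ I(2)] i h that I(2)
          unfolding bij_betw_def r_def inj_on_def by auto
        then show ?thesis using ab(2)[OF that] by (simp add: indicator_def)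
      qed
      then have "path (step r a b (\<lambda>i. path x (a i))) t = (\<Sum>j<r. path x (a j) * (if j = i then 1 else 0))"
        unfolding path_step by (intro sum.cong) auto
      also have "\<dots> = path x (a i)"
        using i by (simp add: if_distrib[of "\<lambda>u. _ * u"] cong: if_cong)
      finally show ?thesis
        using osc[OF I(1,2), of "a i"] ab[OF i(1)] i by simp
    next
      case False
      have "t \<notin> h j" if "j < r" for j
        using disj[OF hP[OF that] I(1) _ I(2)] False bij_betwE[OF h] that unfolding r_def by fastforce
      then have "path (step r a b (\<lambda>i. path x (a i))) t = 0"
        unfolding path_step using ab(2) by (intro sum.neutral) (auto simp: indicator_def)
      moreover have "\<bar>path x t\<bar> \<le> e"
      proof -
        \<comment> \<open>The value at \<open>t\<close> is compared with \<open>path x s\<close> for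
          \<open>s\<close> running to infinity inside the same interval.\<close>
        have "\<bar>path x t - 0\<bar> \<le> e" if "(path x \<longlongrightarrow> 0) F" "\<forall>\<^sub>F s in F. s \<in> I" "F \<noteq> bot" for F
        proof (rule tendsto_upperbound[OF _ _ that(3)])
          show "((\<lambda>s. \<bar>path x t - path x s\<bar>) \<longlongrightarrow> \<bar>path x t - 0\<bar>) F"
            by (intro tendsto_intros that)
          show "\<forall>\<^sub>F s in F. \<bar>path x t - path x s\<bar> \<le> e"
            using that(2) by eventually_elim (rule osc[OF I(1,2)])
        qed
        then show ?thesis
          using lim False \<open>(I \<in> \<J> \<or> _) \<or> _\<close> by (auto simp: trivial_limit_at_top_linorder trivial_limit_at_bot_linorder)
      qed
      ultimately show ?thesis by simp
    qed
  qed
  then show thesis using that by blast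
qed

text \<open>By right continuity a strict excess at \<open>t\<close> persists just to the right of
  \<open>t\<close>, hence at a rational point. This reduces the uniform distance to countably many
  coordinates.\<close>

lemma path_le_if_rational:
  assumes "\<And>q. q \<in> \<rat> \<Longrightarrow> \<bar>path x q - path y q\<bar> \<le> e"
  shows "dist x y \<le> e"
proof (rule dist_cadlag0_le)
  fix t
  have cont: "(path z \<longlongrightarrow> path z t) (at_right t)" for z
    using path[of z] by (auto simp: cadlag_def continuous_within)
  show "\<bar>path x t - path y t\<bar> \<le> e"
  proof (rule ccontr)
    assume "\<not> ?thesis"
    then have "\<forall>\<^sub>F s in at_right t. \<bar>path x s - path y s\<bar> > e"
      using cont by (intro order_tendstoD(1)[OF tendsto_rabs[OF tendsto_diff[OF cont cont]]]) auto
    then obtain u where "u > t" "\<And>s. t < s \<Longrightarrow> s < u \<Longrightarrow> \<bar>path x s - path y s\<bar> > e"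
      by (auto simp: eventually_at_right_field)
    moreover obtain q where "q \<in> \<rat>" "t < q" "q < u"
      using Rats_dense_in_real[OF \<open>u > t\<close>] by auto
    ultimately show False using assms[of q] by fastforce
  qed
qed

section \<open>Oscillation over right-open partitions\<close>

text \<open>Right-openness leaves room inside the interval to the right of \<open>s\<close>, and the
  right limit of \<open>f\<close> keeps the strict inequality there.\<close>

lemma right_open_interval_rational:
  fixes f :: "real \<Rightarrow> real"
  assumes I: "right_open_interval I" "s \<in> I" and f: "(f \<longlongrightarrow> f s) (at_right s)" "e < f s"
  obtains u where "u \<in> I \<inter> \<rat>" "e < f u"
proof -
  obtain a b :: ereal where ab: "I = {x. a \<le> ereal x \<and> ereal x < b}"
    using I(1) unfolding right_open_interval_def by (elim exE)
  then have s: "a \<le> ereal s" "ereal s < b" using I(2) by auto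
  obtain c where c: "ereal s < ereal c" "ereal c < b"
    using ereal_dense2[OF s(2)] by auto
  have "\<forall>\<^sub>F u in at_right s. e < f u" using f by (rule order_tendstoD(1))
  then obtain d where d: "d > s" "\<And>u. s < u \<Longrightarrow> u < d \<Longrightarrow> e < f u"
    by (auto simp: eventually_at_right_field)
  have "s < min c d" using c d by simp
  then obtain u where u: "u \<in> \<rat>" "s < u" "u < min c d"
    using Rats_dense_in_real by blast
  have "a \<le> ereal u" using s(1) u(2) by (meson ereal_less_eq(3) less_imp_le order_trans)
  moreover have "ereal u < b" using c(2) u(3) by (meson ereal_less_eq(3) le_less_trans less_imp_le min_less_iff_conj)
  ultimately have "u \<in> I" using ab by simp
  with u d(2)[of u] show thesis by (intro that) auto
qed

text \<open>A strict excess at \<open>s\<close> and \<open>t\<close> is moved to a rational first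
  argument and then to a rational second one, so that only one-variable limits occur.\<close>

lemma oscillation_rational:
  assumes I: "right_open_interval I"
    and osc: "\<And>s t. s \<in> I \<inter> \<rat> \<Longrightarrow> t \<in> I \<inter> \<rat> \<Longrightarrow> \<bar>path x s - path x t\<bar> \<le> e"
    and st: "s \<in> I" "t \<in> I"
  shows "\<bar>path x s - path x t\<bar> \<le> e"
proof (rule ccontr)
  assume "\<not> \<bar>path x s - path x t\<bar> \<le> e"
  then have far: "e < \<bar>path x s - path x t\<bar>" by simp
  have cont: "(path x \<longlongrightarrow> path x u) (at_right u)" for u
    using path[of x] by (simp add: cadlag_def continuous_within)
  obtain u where u: "u \<in> I \<inter> \<rat>" "e < \<bar>path x u - path x t\<bar>"
    by (rule right_open_interval_rational[OF I st(1), of "\<lambda>u. \<bar>path x u - path x t\<bar>" e])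
       (auto intro!: tendsto_intros cont far)
  obtain v where v: "v \<in> I \<inter> \<rat>" "e < \<bar>path x u - path x v\<bar>"
    by (rule right_open_interval_rational[OF I st(2), of "\<lambda>v. \<bar>path x u - path x v\<bar>" e])
       (use u in \<open>auto intro!: tendsto_intros cont\<close>)
  show False using osc[OF u(1) v(1)] v(2) by simp
qed

lemma bdd_above_oscillation: "bdd_above ((\<lambda>(s, t). \<bar>path x s - path x t\<bar>) ` (I \<times> I))"
proof -
  obtain c where c: "\<And>t. \<bar>path x t\<bar> \<le> c"
    using bounded_range_path[of x] by (auto simp: bounded_iff)
  have "\<bar>path x s - path x t\<bar> \<le> 2 * c" for s t
    using c[of s] c[of t] by linarith
  then show ?thesis by (intro bdd_aboveI[of _ "2 * c"]) auto
qed

abbreviation (input) max_oscillation :: "real set set \<Rightarrow> cadlag0 \<Rightarrow> real" where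
  "max_oscillation \<P> x \<equiv> Max ((\<lambda>I. SUP (s, t) \<in> I \<times> I. \<bar>path x s - path x t\<bar>) ` \<P>)"

text \<open>The first form feeds the approximation by step functions; the second involves countably
  many coordinates and gives measurability. Boundedness of the paths makes the real-valued suprema
  meaningful.\<close>

lemma max_oscillation_le_iff:
  assumes "right_open_partition \<P>"
  shows "max_oscillation \<P> x \<le> e \<longleftrightarrow> (\<forall>I\<in>\<P>. \<forall>s\<in>I. \<forall>t\<in>I. \<bar>path x s - path x t\<bar> \<le> e)"
    and "max_oscillation \<P> x \<le> e \<longleftrightarrow> (\<forall>I\<in>\<P>. \<forall>s\<in>I \<inter> \<rat>. \<forall>t\<in>I \<inter> \<rat>. \<bar>path x s - path x t\<bar> \<le> e)"
proof -
  have P: "finite \<P>" "\<P> \<noteq> {}" "\<And>I. I \<in> \<P> \<Longrightarrow> I \<noteq> {}" "\<And>I. I \<in> \<P> \<Longrightarrow> right_open_interval I"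
    using assms unfolding right_open_partition_def partition_on_def by auto
  have "max_oscillation \<P> x \<le> e \<longleftrightarrow> (\<forall>I\<in>\<P>. (SUP (s, t) \<in> I \<times> I. \<bar>path x s - path x t\<bar>) \<le> e)"
    using P by (subst Max_le_iff) auto
  also have "\<dots> \<longleftrightarrow> (\<forall>I\<in>\<P>. \<forall>s\<in>I. \<forall>t\<in>I. \<bar>path x s - path x t\<bar> \<le> e)"
  proof (intro ball_cong refl)
    fix I assume "I \<in> \<P>"
    then have "I \<times> I \<noteq> {}" using P by auto
    then show "(SUP (s, t) \<in> I \<times> I. \<bar>path x s - path x t\<bar>) \<le> e \<longleftrightarrow> (\<forall>s\<in>I. \<forall>t\<in>I. \<bar>path x s - path x t\<bar> \<le> e)"
      using bdd_above_oscillation by (subst cSUP_le_iff) auto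
  qed
  finally show 1: "max_oscillation \<P> x \<le> e \<longleftrightarrow> (\<forall>I\<in>\<P>. \<forall>s\<in>I. \<forall>t\<in>I. \<bar>path x s - path x t\<bar> \<le> e)" .
  show "max_oscillation \<P> x \<le> e \<longleftrightarrow> (\<forall>I\<in>\<P>. \<forall>s\<in>I \<inter> \<rat>. \<forall>t\<in>I \<inter> \<rat>. \<bar>path x s - path x t\<bar> \<le> e)"
    unfolding 1
  proof (rule ball_cong[OF refl], rule iffI)
    fix I assume I: "I \<in> \<P>" and o: "\<forall>s\<in>I \<inter> \<rat>. \<forall>t\<in>I \<inter> \<rat>. \<bar>path x s - path x t\<bar> \<le> e"
    show "\<forall>s\<in>I. \<forall>t\<in>I. \<bar>path x s - path x t\<bar> \<le> e"
    proof (intro ballI)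
      fix s t assume "s \<in> I" "t \<in> I"
      then show "\<bar>path x s - path x t\<bar> \<le> e"
        using oscillation_rational[OF P(4)[OF I], of x e s t] o by blast
    qed
  qed auto
qed

text \<open>\<open>measure\<close> is 0 on non-measurable sets, so a small probability of this event
  carries information only once the event is known to be measurable.\<close>

lemma max_oscillation_measurable:
  assumes "right_open_partition \<P>" and X: "\<And>t. (\<lambda>\<omega>. path (X \<omega>) t) \<in> borel_measurable M"
  shows "{\<omega> \<in> space M. max_oscillation \<P> (X \<omega>) > e} \<in> sets M"
proof -
  have fin: "finite \<P>" using assms(1) by (simp add: right_open_partition_def)
  have "countable (I \<inter> \<rat>)" for I :: "real set" using countable_rat by auto
  then have "{\<omega> \<in> space M. \<forall>I\<in>\<P>. \<forall>s\<in>I \<inter> \<rat>. \<forall>t\<in>I \<inter> \<rat>. \<bar>path (X \<omega>) s - path (X \<omega>) t\<bar> \<le> e} \<in> sets M"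
    using X countable_finite[OF fin] by (intro sets.sets_Collect_countable_All') measurable
  then have "{\<omega> \<in> space M. max_oscillation \<P> (X \<omega>) \<le> e} \<in> sets M"
    unfolding max_oscillation_le_iff(2)[OF assms(1)] .
  moreover have "{\<omega> \<in> space M. max_oscillation \<P> (X \<omega>) > e} = space M - {\<omega> \<in> space M. max_oscillation \<P> (X \<omega>) \<le> e}"
    by auto
  ultimately show ?thesis by auto
qed

section \<open>The continuity theorem in finite dimensions\<close>

text \<open>The complex span of the characters in the first \<open>r\<close> coordinates, generated
  inductively so that integrability and convergence of integrals follow from the case of a single
  character.\<close>

inductive trig_poly :: "nat \<Rightarrow> ((nat \<Rightarrow> real) \<Rightarrow> complex) \<Rightarrow> bool" for r where
  character: "trig_poly r (\<lambda>x. iexp (\<Sum>i<r. c i * x i))"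
| add: "trig_poly r g \<Longrightarrow> trig_poly r h \<Longrightarrow> trig_poly r (\<lambda>x. g x + h x)"
| scale: "trig_poly r g \<Longrightarrow> trig_poly r (\<lambda>x. a * g x)"

lemma trig_poly_const: "trig_poly r (\<lambda>_. a)"
  using trig_poly.scale[OF trig_poly.character[of r "\<lambda>_. 0"], of a] by simp

lemma trig_poly_mult:
  assumes "trig_poly r g" "trig_poly r h"
  shows "trig_poly r (\<lambda>x. g x * h x)"
  using assms
proof (induction arbitrary: h)
  case (character c)
  from character.prems show ?case
  proof induction
    case (character d)
    have "(\<lambda>x. iexp (\<Sum>i<r. c i * x i) * iexp (\<Sum>i<r. d i * x i))
        = (\<lambda>x. iexp (\<Sum>i<r. (c i + d i) * x i))"
      by (simp add: fun_eq_iff exp_add[symmetric] sum.distrib distrib_right distrib_left)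
    then show ?case
      using trig_poly.character[of r "\<lambda>i. c i + d i"] by simp
  next
    case (add g h)
    then show ?case
      using trig_poly.add[OF add.IH] by (simp add: distrib_left)
  next
    case (scale g a)
    then show ?case
      using trig_poly.scale[OF scale.IH, of a] by (simp add: mult.left_commute)
  qed
next
  case (add g g')
  then show ?case
    using trig_poly.add[OF add.IH(1) add.IH(2), of h h] by (simp add: distrib_right)
next
  case (scale g a)
  then show ?case
    using trig_poly.scale[OF scale.IH, of h a] by (simp add: mult.assoc)
qed

text \<open>Euler's formula combines the characters of frequencies \<open>a\<close> and
  \<open>- a\<close> in direction \<open>i\<close>. These sines become the coordinate functions of
  the Stone-Weierstrass argument.\<close>

lemma trig_poly_sin:
  assumes "i < r"
  shows "trig_poly r (\<lambda>x. complex_of_real (sin (a * x i)))"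
proof -
  have *: "(\<Sum>j<r. (if j = i then b else 0) * x j) = b * x i" for b and x :: "nat \<Rightarrow> real"
    using assms by (simp add: if_distrib[of "\<lambda>u. u * _"] cong: if_cong)
  have t: "trig_poly r (\<lambda>x. iexp (b * x i))" for b
    using trig_poly.character[of r "\<lambda>j. if j = i then b else 0"] unfolding * .
  have "complex_of_real (sin u) = (1 / (2 * \<i>)) * iexp u + (- 1 / (2 * \<i>)) * iexp (- u)" for u
    by (simp add: sin_of_real[symmetric] sin_exp_eq field_simps)
  then show ?thesis
    using trig_poly.add[OF trig_poly.scale[OF t[of a], of "1 / (2 * \<i>)"]
        trig_poly.scale[OF t[of "- a"], of "- 1 / (2 * \<i>)"]]
    by simp
qed

lemma trig_poly_integrable:
  assumes "trig_poly r h" "prob_space M" and Y: "Y \<in> borel_measurable M"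
  shows "integrable M (\<lambda>\<omega>. h (Y \<omega>))"
  using assms(1)
proof induction
  case (character c)
  interpret prob_space M by fact
  have Yi: "(\<lambda>\<omega>. Y \<omega> i) \<in> borel_measurable M" for i
    using Y by (rule measurable_product_then_coordinatewise)
  show ?case
    using Yi by (intro integrable_const_bound[where B=1]) auto
qed auto

lemma trig_poly_tendsto:
  assumes "trig_poly r h" "prob_space M" "prob_space N"
    and Y: "\<And>n. Y n \<in> borel_measurable M" and Z: "Z \<in> borel_measurable N"
    and lim: "\<And>c. (\<lambda>n. LINT \<omega>|M. iexp (\<Sum>i<r. c i * Y n \<omega> i))
        \<longlonglongrightarrow> (LINT \<omega>|N. iexp (\<Sum>i<r. c i * Z \<omega> i))"
  shows "(\<lambda>n. LINT \<omega>|M. h (Y n \<omega>)) \<longlonglongrightarrow> (LINT \<omega>|N. h (Z \<omega>))"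
  using assms(1)
proof induction
  case (character c)
  show ?case by (rule lim)
next
  case (add g h)
  note int = trig_poly_integrable[OF _ \<open>prob_space M\<close> Y] trig_poly_integrable[OF _ \<open>prob_space N\<close> Z]
  show ?case
    using tendsto_add[OF add.IH] int[OF add.hyps(1)] int[OF add.hyps(2)] by simp
next
  case (scale g a)
  then show ?case
    by (auto intro: tendsto_mult_left)
qed

text \<open>
  Composing with the sine makes the approximation bounded on the whole space: on the cube
  \<open>[-L, L]\<^sup>r\<close>, \<open>g\<close> is a continuous function of \<open>u\<^sub>i = sin (\<pi> x\<^sub>i / (2 L))\<close>, and a polynomial in \<open>u\<close> is a
  trigonometric polynomial in \<open>x\<close>.
\<close>

lemma trig_poly_approx:
  fixes g :: "(nat \<Rightarrow> real) \<Rightarrow> real"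
  assumes g: "continuous_on UNIV g" "\<And>x. \<bar>g x\<bar> \<le> C"
    and dep: "\<And>x y. (\<And>i. i < r \<Longrightarrow> x i = y i) \<Longrightarrow> g x = g y"
    and "L > 0" "e > 0"
  shows "\<exists>h. trig_poly r (\<lambda>x. complex_of_real (h x)) \<and> (\<forall>x. \<bar>h x\<bar> \<le> C + e) \<and>
    (\<forall>x. (\<forall>i<r. \<bar>x i\<bar> \<le> L) \<longrightarrow> \<bar>g x - h x\<bar> \<le> e)"
proof -
  define l where "l = 2 * L / pi"
  have l: "l > 0" using \<open>L > 0\<close> by (simp add: l_def)
  \<comment> \<open>Coordinates from \<open>r\<close> on are pinned to 0, so that the coordinates
    below \<open>r\<close> separate the points of the compact set \<open>S\<close>.\<close>
  define S :: "(nat \<Rightarrow> real) set" where "S = Pi\<^sub>E UNIV (\<lambda>i. if i < r then {-1..1} else {0})"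
  define s :: "(nat \<Rightarrow> real) \<Rightarrow> nat \<Rightarrow> real" where "s x = (\<lambda>i. if i < r then sin (1 / l * x i) else 0)" for x
  \<comment> \<open>The algebra of functions on the cube whose composition with the sines is a
    trigonometric polynomial.\<close>
  define R where "R = {q. continuous_on S q \<and> trig_poly r (\<lambda>x. complex_of_real (q (s x)))}"
  have "compactin (product_topology (\<lambda>_. euclidean) UNIV) S"
    unfolding S_def by (subst compactin_PiE) auto
  then have "compact S"
    unfolding euclidean_product_topology by (simp add: compactin_euclidean_iff)
  have coord: "continuous_on A (\<lambda>x. x i)" for A :: "(nat \<Rightarrow> real) set" and i
    by (rule continuous_on_product_then_coordinatewise) (rule continuous_on_id)
  interpret R: function_ring_on R S
  proof
    show "compact S" by fact
    fix x y assume xy: "x \<in> S" "y \<in> S" "x \<noteq> y"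
    then obtain i where i: "x i \<noteq> y i" by auto
    have "i < r"
    proof (rule ccontr)
      assume "\<not> i < r"
      then have "x i = 0" "y i = 0"
        using xy by (auto simp: S_def PiE_iff dest!: spec[of _ i])
      with i show False by simp
    qed
    have "(\<lambda>x. x i) \<in> R"
      using trig_poly_sin[OF \<open>i < r\<close>, of "1 / l"] coord \<open>i < r\<close> by (auto simp: R_def s_def)
    with i show "\<exists>f\<in>R. f x \<noteq> f y" by (intro bexI[of _ "\<lambda>x. x i"])
  qed (auto simp: R_def trig_poly_const intro!: continuous_intros dest: trig_poly.add trig_poly_mult)
  \<comment> \<open>\<open>arcsin\<close> undoes the sine as long as \<open>x i / l\<close> lies in
    \<open>[- pi / 2, pi / 2]\<close>; this dictates \<open>l = 2 * L / pi\<close>.\<close>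
  define f where "f u = g (\<lambda>i. l * arcsin (u i))" for u
  have "continuous_on S (\<lambda>u i. l * arcsin (u i))"
  proof (rule continuous_on_coordinatewise_then_product)
    fix i
    have "u i \<in> {-1..1}" if "u \<in> S" for u
      using that by (auto simp: S_def PiE_iff split: if_splits dest!: spec[of _ i])
    then show "continuous_on S (\<lambda>u. l * arcsin (u i))"
      by (intro continuous_intros coord) auto
  qed
  then have "continuous_on S f"
    unfolding f_def by (rule continuous_on_compose2[OF g(1)]) auto
  from R.Stone_Weierstrass_basic[OF this \<open>e > 0\<close>]
  obtain q where q: "q \<in> R" "\<And>u. u \<in> S \<Longrightarrow> \<bar>f u - q u\<bar> < e" by blast
  have sS: "s x \<in> S" for x by (auto simp: s_def S_def PiE_iff)
  show ?thesis
  proof (intro exI[of _ "\<lambda>x. q (s x)"] conjI allI impI)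
    show "trig_poly r (\<lambda>x. complex_of_real (q (s x)))" using q by (simp add: R_def)
    fix x
    \<comment> \<open>The point \<open>s x\<close> lies in the cube for every \<open>x\<close>, so
      the bound on \<open>q\<close> is global and not restricted to the region where
      \<open>g\<close> is approximated.\<close>
    have "\<bar>f (s x)\<bar> \<le> C" by (simp add: f_def g)
    then show "\<bar>q (s x)\<bar> \<le> C + e" using q(2)[OF sS, of x] by linarith
    assume x: "\<forall>i<r. \<bar>x i\<bar> \<le> L"
    have "f (s x) = g x"
      unfolding f_def
    proof (rule dep)
      fix i assume i: "i < r"
      have "\<bar>1 / l * x i\<bar> \<le> pi / 2"
        using x i \<open>L > 0\<close> by (auto simp: l_def abs_mult field_simps)
      then have "arcsin (sin (1 / l * x i)) = 1 / l * x i"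
        by (intro arcsin_sin) (simp_all only: abs_le_iff, linarith+)
      then show "l * arcsin (s x i) = x i"
        using i l by (simp add: s_def)
    qed
    then show "\<bar>g x - q (s x)\<bar> \<le> e" using q(2)[OF sS, of x] by simp
  qed
qed

section \<open>Passage from characters to bounded continuous functions\<close>

lemma (in prob_space) integrable_bounded:
  fixes f :: "'a \<Rightarrow> 'b::{banach,second_countable_topology}"
  assumes "f \<in> borel_measurable M" "\<And>\<omega>. \<omega> \<in> space M \<Longrightarrow> norm (f \<omega>) \<le> C"
  shows "integrable M f"
  using assms by (intro integrable_const_bound[where B=C]) auto

lemma (in prob_space) expectation_diff_le:
  fixes g h p :: "'a \<Rightarrow> real"
  assumes "integrable M g" "integrable M h" "integrable M p" "\<And>\<omega>. \<bar>g \<omega> - h \<omega>\<bar> \<le> p \<omega>"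
  shows "\<bar>expectation g - expectation h\<bar> \<le> expectation p"
proof -
  have "\<bar>expectation g - expectation h\<bar> = \<bar>LINT \<omega>|M. g \<omega> - h \<omega>\<bar>"
    using assms by simp
  also have "\<dots> \<le> (LINT \<omega>|M. \<bar>g \<omega> - h \<omega>\<bar>)" by (rule integral_abs_bound)
  also have "\<dots> \<le> expectation p"
    using assms by (intro integral_mono) auto
  finally show ?thesis .
qed

text \<open>The one-dimensional continuity theorem restated for random variables; it is applied to
  the cutoffs that control the tails of single coordinates.\<close>

lemma coordinate_weak_conv:
  fixes f :: "real \<Rightarrow> real"
  assumes "prob_space M" "prob_space N"
    and Y: "\<And>n. Y n \<in> borel_measurable M" and Z: "Z \<in> borel_measurable N"
    and lim: "\<And>t. (\<lambda>n. LINT \<omega>|M. iexp (t * Y n \<omega>)) \<longlonglongrightarrow> (LINT \<omega>|N. iexp (t * Z \<omega>))"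
    and f: "continuous_on UNIV f" "\<And>x. \<bar>f x\<bar> \<le> C"
  shows "(\<lambda>n. LINT \<omega>|M. f (Y n \<omega>)) \<longlonglongrightarrow> (LINT \<omega>|N. f (Z \<omega>))"
proof -
  interpret M: prob_space M by fact
  interpret N: prob_space N by fact
  have d: "real_distribution (distr M borel (Y n))" "real_distribution (distr N borel Z)" for n
    using Y Z by (auto intro: M.real_distribution_distr N.real_distribution_distr)
  have [measurable]: "f \<in> borel_measurable borel"
    using f(1) by (rule borel_measurable_continuous_onI)
  have "weak_conv_m (\<lambda>n. distr M borel (Y n)) (distr N borel Z)"
    using lim Y Z by (intro levy_continuity d) (simp add: char_def integral_distr)
  then have "(\<lambda>n. integral\<^sup>L (distr M borel (Y n)) f) \<longlonglongrightarrow> integral\<^sup>L (distr N borel Z) f"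
    using f by (intro weak_conv_imp_integral_bdd_continuous_conv d)
       (auto simp: continuous_on_eq_continuous_at)
  then show ?thesis
    using Y Z by (simp add: integral_distr)
qed

text \<open>On a large cube \<open>g\<close> is close to a trigonometric polynomial
  \<open>h\<close>, whose integrals converge. Off the cube both are bounded, and the mass there is
  controlled by continuous cutoffs of single coordinates, whose integrals converge by the
  one-dimensional theorem.\<close>

theorem levy_continuity_finite_dim:
  fixes Y :: "nat \<Rightarrow> 'a \<Rightarrow> nat \<Rightarrow> real" and Z :: "'b \<Rightarrow> nat \<Rightarrow> real" and g :: "(nat \<Rightarrow> real) \<Rightarrow> real"
  assumes "prob_space M" "prob_space N"
    and Y: "\<And>n. Y n \<in> borel_measurable M" and Z: "Z \<in> borel_measurable N"
    and lim: "\<And>c. (\<lambda>n. LINT \<omega>|M. iexp (\<Sum>i<r. c i * Y n \<omega> i))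
        \<longlonglongrightarrow> (LINT \<omega>|N. iexp (\<Sum>i<r. c i * Z \<omega> i))"
    and g: "continuous_on UNIV g" "\<And>x. \<bar>g x\<bar> \<le> C"
    and dep: "\<And>x y. (\<And>i. i < r \<Longrightarrow> x i = y i) \<Longrightarrow> g x = g y"
  shows "(\<lambda>n. LINT \<omega>|M. g (Y n \<omega>)) \<longlonglongrightarrow> (LINT \<omega>|N. g (Z \<omega>))"
proof -
  interpret M: prob_space M by fact
  interpret N: prob_space N by fact
  have C: "C \<ge> 0" using g(2)[of undefined] by linarith
  have Yi[measurable]: "(\<lambda>\<omega>. Y n \<omega> i) \<in> borel_measurable M" for n i
    using Y by (rule measurable_product_then_coordinatewise)
  have Zi[measurable]: "(\<lambda>\<omega>. Z \<omega> i) \<in> borel_measurable N" for i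
    using Z by (rule measurable_product_then_coordinatewise)
  \<comment> \<open>A continuous cutoff: 0 for \<open>\<bar>x\<bar> \<le> L - 1\<close> and 1 for
    \<open>\<bar>x\<bar> \<ge> L\<close>.\<close>
  define p where "p L x = min 1 (max 0 (\<bar>x\<bar> - L + 1))" for L x :: real
  have p: "continuous_on UNIV (p L)" "\<bar>p L x\<bar> \<le> 1" "p L x \<ge> 0" "\<bar>x\<bar> > L \<Longrightarrow> p L x = 1" for L x
    by (auto simp: p_def intro!: continuous_intros)
  have pm[measurable]: "p L \<in> borel_measurable borel" for L
    using p(1) by (rule borel_measurable_continuous_onI)
  have gm: "g \<in> borel_measurable borel" using g(1) by (rule borel_measurable_continuous_onI)
  have coord: "(\<lambda>n. LINT \<omega>|M. p L (Y n \<omega> i)) \<longlonglongrightarrow> (LINT \<omega>|N. p L (Z \<omega> i))" if "i < r" for L i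
  proof (rule coordinate_weak_conv[OF assms(1,2) _ _ _ p(1,2)])
    have *: "(\<Sum>j<r. (if j = i then t else 0) * x j) = t * x i" for t and x :: "nat \<Rightarrow> real"
      using that by (simp add: if_distrib[of "\<lambda>u. u * _"] cong: if_cong)
    show "(\<lambda>n. LINT \<omega>|M. iexp (t * Y n \<omega> i)) \<longlonglongrightarrow> (LINT \<omega>|N. iexp (t * Z \<omega> i))" for t
      using lim[of "\<lambda>j. if j = i then t else 0"] unfolding * .
  qed auto
  have tail: "(\<lambda>m. \<Sum>i<r. LINT \<omega>|N. p (real m) (Z \<omega> i)) \<longlonglongrightarrow> (\<Sum>i<r. LINT \<omega>|N. 0)"
  proof (intro tendsto_sum integral_dominated_convergence[where w="\<lambda>_. 1"] AE_I2)
    fix i \<omega>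
    have "eventually (\<lambda>m. p (real m) (Z \<omega> i) = 0) sequentially"
      using eventually_ge_at_top[of "nat \<lceil>\<bar>Z \<omega> i\<bar> + 1\<rceil>"]
    proof eventually_elim
      case (elim m)
      then have "\<bar>Z \<omega> i\<bar> + 1 \<le> real m"
        by (simp only: nat_ceiling_le_eq)
      then show ?case by (simp add: p_def)
    qed
    then show "(\<lambda>m. p (real m) (Z \<omega> i)) \<longlonglongrightarrow> 0" by (rule tendsto_eventually)
  qed (auto simp: p(2))
  show ?thesis
  proof (rule tendstoI)
    fix e0 :: real assume "e0 > 0"
    \<comment> \<open>\<open>K\<close> bounds \<open>\<bar>g x - h x\<bar>\<close> everywhere once
      \<open>e \<le> 1\<close>. The final error is below \<open>(3 + 2 * K) * e\<close>; the divisor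
      \<open>5 + 3 * K\<close> leaves some room.\<close>
    define K where "K = 2 * C + 1"
    define e where "e = min 1 (e0 / (5 + 3 * K))"
    have "K \<ge> 1" using C by (simp add: K_def)
    have "e \<le> e0 / (5 + 3 * K)" by (simp add: e_def)
    then have "(5 + 3 * K) * e \<le> e0"
      using \<open>K \<ge> 1\<close> by (simp add: pos_le_divide_eq mult.commute)
    then have e: "e > 0" "e \<le> 1" "(5 + 3 * K) * e \<le> e0" "K \<ge> 1"
      using \<open>e0 > 0\<close> \<open>K \<ge> 1\<close> by (auto simp: e_def)
    then have K: "2 * C + e \<le> K"
      by (simp add: K_def)
    have "\<forall>\<^sub>F m in sequentially. (\<Sum>i<r. LINT \<omega>|N. p (real m) (Z \<omega> i)) < e"
      using order_tendstoD(2)[OF tail, of e] e by simp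
    with eventually_gt_at_top[of 0] have "\<forall>\<^sub>F m in sequentially. m > 0 \<and> (\<Sum>i<r. LINT \<omega>|N. p (real m) (Z \<omega> i)) < e"
      by (rule eventually_conj)
    then obtain m where m: "m > 0" "(\<Sum>i<r. LINT \<omega>|N. p (real m) (Z \<omega> i)) < e"
      by (auto simp: eventually_sequentially)
    define L where "L = real m"
    have "L > 0" using m by (simp add: L_def)
    obtain h where h: "trig_poly r (\<lambda>x. complex_of_real (h x))" "\<And>x. \<bar>h x\<bar> \<le> C + e"
      "\<And>x. (\<And>i. i < r \<Longrightarrow> \<bar>x i\<bar> \<le> L) \<Longrightarrow> \<bar>g x - h x\<bar> \<le> e"
      using trig_poly_approx[OF g dep \<open>L > 0\<close> e(1)] by metis
    have bd: "\<bar>g x - h x\<bar> \<le> e + K * (\<Sum>i<r. p L (x i))" for x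
    proof (cases "\<forall>i<r. \<bar>x i\<bar> \<le> L")
      case True
      have "0 \<le> K * (\<Sum>i<r. p L (x i))" using e p(3) by (intro mult_nonneg_nonneg sum_nonneg) auto
      then show ?thesis using h(3)[of x] True by auto
    next
      case False
      then obtain i where i: "i < r" "\<bar>x i\<bar> > L" by auto
      have "\<bar>g x - h x\<bar> \<le> K * p L (x i)" using p(4)[OF i(2)] g(2)[of x] h(2)[of x] K by simp
      also have "\<dots> \<le> K * (\<Sum>i<r. p L (x i))"
        using e p(3) i by (intro mult_left_mono member_le_sum) auto
      finally show ?thesis using e by simp
    qed
    have intc: "integrable M (\<lambda>\<omega>. complex_of_real (h (Y n \<omega>)))"
               "integrable N (\<lambda>\<omega>. complex_of_real (h (Z \<omega>)))" for n
      using trig_poly_integrable[OF h(1) assms(1) Y] trig_poly_integrable[OF h(1) assms(2) Z] .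
    then have inth: "integrable M (\<lambda>\<omega>. h (Y n \<omega>))" "integrable N (\<lambda>\<omega>. h (Z \<omega>))" for n
      by (simp_all add: complex_of_real_integrable_eq)
    have intg: "integrable M (\<lambda>\<omega>. g (Y n \<omega>))" "integrable N (\<lambda>\<omega>. g (Z \<omega>))" for n
      using g(2) gm Y Z
      by (auto intro!: M.integrable_const_bound[where B=C] N.integrable_const_bound[where B=C]
          intro: measurable_compose)
    have intp: "integrable M (\<lambda>\<omega>. p L (Y n \<omega> i))" "integrable N (\<lambda>\<omega>. p L (Z \<omega> i))" for n i
      using p(2) by (auto intro!: M.integrable_const_bound[where B=1] N.integrable_const_bound[where B=1])
    have bM: "\<bar>(LINT \<omega>|M. g (Y n \<omega>)) - (LINT \<omega>|M. h (Y n \<omega>))\<bar> \<le> e + K * (\<Sum>i<r. LINT \<omega>|M. p L (Y n \<omega> i))" for n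
      using M.expectation_diff_le[of "\<lambda>\<omega>. g (Y n \<omega>)" "\<lambda>\<omega>. h (Y n \<omega>)"
          "\<lambda>\<omega>. e + K * (\<Sum>i<r. p L (Y n \<omega> i))"] intg inth intp bd
      by (simp add: M.prob_space)
    have bN: "\<bar>(LINT \<omega>|N. g (Z \<omega>)) - (LINT \<omega>|N. h (Z \<omega>))\<bar> \<le> e + K * (\<Sum>i<r. LINT \<omega>|N. p L (Z \<omega> i))"
      using N.expectation_diff_le[of "\<lambda>\<omega>. g (Z \<omega>)" "\<lambda>\<omega>. h (Z \<omega>)"
          "\<lambda>\<omega>. e + K * (\<Sum>i<r. p L (Z \<omega> i))"] intg inth intp bd
      by (simp add: N.prob_space)
    have "(\<lambda>n. LINT \<omega>|M. complex_of_real (h (Y n \<omega>))) \<longlonglongrightarrow> (LINT \<omega>|N. complex_of_real (h (Z \<omega>)))"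
      by (rule trig_poly_tendsto[OF h(1) assms(1,2) Y Z lim])
    then have "(\<lambda>n. LINT \<omega>|M. h (Y n \<omega>)) \<longlonglongrightarrow> (LINT \<omega>|N. h (Z \<omega>))"
      unfolding integral_complex_of_real by (simp add: tendsto_of_real_iff)
    then have "\<forall>\<^sub>F n in sequentially. \<bar>(LINT \<omega>|M. h (Y n \<omega>)) - (LINT \<omega>|N. h (Z \<omega>))\<bar> < e"
      using tendstoD[of _ _ _ e] e by (fastforce simp: dist_real_def)
    moreover have "(\<lambda>n. \<Sum>i<r. LINT \<omega>|M. p L (Y n \<omega> i)) \<longlonglongrightarrow> (\<Sum>i<r. LINT \<omega>|N. p L (Z \<omega> i))"
      by (intro tendsto_sum coord) auto
    then have "\<forall>\<^sub>F n in sequentially. (\<Sum>i<r. LINT \<omega>|M. p L (Y n \<omega> i)) < e"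
      using m(2) unfolding L_def by (rule order_tendstoD(2))
    ultimately show "\<forall>\<^sub>F n in sequentially. dist (LINT \<omega>|M. g (Y n \<omega>)) (LINT \<omega>|N. g (Z \<omega>)) < e0"
    proof eventually_elim
      case (elim n)
      have "K * (\<Sum>i<r. LINT \<omega>|M. p L (Y n \<omega> i)) \<le> K * e" "K * (\<Sum>i<r. LINT \<omega>|N. p L (Z \<omega> i)) \<le> K * e"
        using elim m(2) e unfolding L_def by (auto intro!: mult_left_mono)
      then have "\<bar>(LINT \<omega>|M. g (Y n \<omega>)) - (LINT \<omega>|N. g (Z \<omega>))\<bar> < e + e + e + (K * e + K * e)"
        using elim bM[of n] bN by linarith
      also have "\<dots> \<le> (5 + 3 * K) * e" using e by (simp add: algebra_simps)
      also have "\<dots> \<le> e0" by (rule e)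
      finally show ?case by (simp add: dist_real_def)
    qed
  qed
qed

section \<open>A martingale central limit theorem with mixed normal limit\<close>

lemma norm_integral_le:
  fixes f :: "'a \<Rightarrow> 'b::{banach,second_countable_topology}"
  assumes "integrable M f" "integrable M g" "\<And>x. x \<in> space M \<Longrightarrow> norm (f x) \<le> g x"
  shows "norm (LINT x|M. f x) \<le> (LINT x|M. g x)"
  using assms by (intro order_trans[OF integral_norm_bound] integral_mono) auto

lemma exp_diff_le:
  fixes x y K :: real
  assumes "x \<le> K" "y \<le> K"
  shows "\<bar>exp x - exp y\<bar> \<le> exp K * \<bar>x - y\<bar>"
proof -
  have *: "exp a - exp b \<le> exp K * (a - b)" if "b \<le> a" "a \<le> K" for a b :: real
  proof -
    have "exp a - exp b = exp a * (1 - exp (b - a))"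
      by (simp add: exp_diff algebra_simps)
    also have "\<dots> \<le> exp a * (a - b)"
      using exp_ge_add_one_self[of "b - a"] by (intro mult_left_mono) (linarith, simp)
    also have "\<dots> \<le> exp K * (a - b)"
      using that by (intro mult_right_mono) auto
    finally show ?thesis .
  qed
  show ?thesis
  proof (cases "y \<le> x")
    case True
    then show ?thesis using *[of y x] assms by simp
  next
    case False
    then show ?thesis using *[of x y] assms by (simp add: abs_minus_commute)
  qed
qed

text \<open>The extra exponent \<open>s / (2 * N\<^sup>2)\<close> turns the second-order term into a
  multiple of \<open>s - d\<^sup>2\<close>, which has conditional mean 0 when \<open>s\<close> is
  the conditional variance of a centred \<open>d\<close>. What remains is of order
  \<open>1 / N ^ 3\<close>, still small after \<open>N\<^sup>2\<close> steps.\<close>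

lemma exp_second_order:
  fixes d s K N :: real
  assumes "\<bar>d\<bar> \<le> K" "\<bar>s\<bar> \<le> K" "N \<ge> 1"
  shows "cmod (exp (\<i> * of_real (d / N) + of_real (s / (2 * N\<^sup>2))) - 1
      - (\<i> * of_real (d / N) + of_real ((s - d\<^sup>2) / (2 * N\<^sup>2))))
    \<le> (exp K * (2 * K) ^ 3 + K\<^sup>2) / N ^ 3"
proof -
  define z where "z = \<i> * of_real (d / N) + complex_of_real (s / (2 * N\<^sup>2))"
  have K: "K \<ge> 0" and N: "N > 0" using assms by auto
  have N2: "N \<le> N\<^sup>2" "1 \<le> N\<^sup>2" "N ^ 3 \<le> N ^ 4"
    using assms power_increasing[of 1 2 N] power_increasing[of 0 2 N] power_increasing[of 3 4 N] by auto
  have s1: "\<bar>s / (2 * N\<^sup>2)\<bar> \<le> K / N" 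
  proof -
    have "\<bar>s\<bar> / (2 * N\<^sup>2) \<le> K / N"
      using assms N2 N K by (intro frac_le) auto
    then show ?thesis using N by simp
  qed
  have "K / N \<le> K" using assms K mult_left_mono[of 1 N K] by (simp add: divide_le_eq)
  have "cmod z \<le> \<bar>d / N\<bar> + \<bar>s / (2 * N\<^sup>2)\<bar>"
    unfolding z_def
    by (rule order_trans[OF norm_triangle_ineq])
       (simp add: norm_mult del: of_real_divide of_real_mult of_real_power)
  also have "\<bar>d / N\<bar> \<le> K / N" using assms by (simp add: divide_right_mono)
  finally have z: "cmod z \<le> 2 * K / N" using s1 by simp
  have "\<bar>Re z\<bar> \<le> K" using s1 \<open>K / N \<le> K\<close> by (simp add: z_def)
  have "cmod (exp z - (\<Sum>k\<le>2. z ^ k / fact k)) \<le> exp \<bar>Re z\<bar> * cmod z ^ Suc 2 / fact 2"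
    by (rule Taylor_exp)
  also have "\<dots> \<le> exp \<bar>Re z\<bar> * cmod z ^ 3"
    by (simp add: numeral_eq_Suc)
  also have "\<dots> \<le> exp K * (2 * K / N) ^ 3"
    using z \<open>\<bar>Re z\<bar> \<le> K\<close> by (intro mult_mono power_mono) auto
  finally have 1: "cmod (exp z - (1 + z + z\<^sup>2 / 2)) \<le> exp K * (2 * K) ^ 3 / N ^ 3"
    by (simp add: numeral_eq_Suc power_divide)
  \<comment> \<open>The part of \<open>z\<^sup>2 / 2\<close> other than
    \<open>- d\<^sup>2 / (2 * N\<^sup>2)\<close>: the cross term and half the square of the real
    part of \<open>z\<close>.\<close>
  define \<rho> where "\<rho> = \<i> * of_real (d * s / (2 * N ^ 3)) + complex_of_real (s\<^sup>2 / (8 * N ^ 4))"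
  have e: "1 + z + z\<^sup>2 / 2 - 1 - (\<i> * of_real (d / N) + of_real ((s - d\<^sup>2) / (2 * N\<^sup>2))) = \<rho>"
    using N unfolding z_def \<rho>_def
    by (simp add: complex_eq_iff power2_eq_square field_simps eval_nat_numeral)
  have "cmod \<rho> \<le> \<bar>d * s / (2 * N ^ 3)\<bar> + \<bar>s\<^sup>2 / (8 * N ^ 4)\<bar>"
    unfolding \<rho>_def
    by (rule order_trans[OF norm_triangle_ineq])
       (simp add: norm_mult del: of_real_divide of_real_mult of_real_power)
  also have "\<bar>d * s / (2 * N ^ 3)\<bar> \<le> K\<^sup>2 / (2 * N ^ 3)"
    using assms K N by (auto simp: abs_mult power2_eq_square intro!: divide_right_mono mult_mono)
  also have "\<bar>s\<^sup>2 / (8 * N ^ 4)\<bar> \<le> K\<^sup>2 / (2 * N ^ 3)"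
  proof -
    have "s\<^sup>2 \<le> K\<^sup>2" using assms by (simp add: abs_le_square_iff[symmetric])
    then have "s\<^sup>2 / (8 * N ^ 4) \<le> K\<^sup>2 / (2 * N ^ 3)"
      using N2(3) zero_le_power[of N 4] N by (intro frac_le) (simp, simp, simp, linarith)
    then show ?thesis using N by simp
  qed
  finally have 2: "cmod \<rho> \<le> K\<^sup>2 / N ^ 3" by simp
  have "cmod (exp z - 1 - (\<i> * of_real (d / N) + of_real ((s - d\<^sup>2) / (2 * N\<^sup>2))))
      = cmod ((exp z - (1 + z + z\<^sup>2 / 2)) + \<rho>)"
    unfolding e[symmetric] by (simp add: algebra_simps)
  also have "\<dots> \<le> exp K * (2 * K) ^ 3 / N ^ 3 + K\<^sup>2 / N ^ 3"
    using 1 2 by (intro order_trans[OF norm_triangle_ineq] add_mono)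
  finally show ?thesis
    unfolding z_def by (simp add: add_divide_distrib)
qed

text \<open>Conditional mean and variance are expressed by testing against bounded
  \<open>G k\<close>-measurable functions, the form in which they are used. The difference
  \<open>d k\<close> is revealed at time \<open>Suc k\<close>, and \<open>v k\<close> is its
  conditional variance at time \<open>k\<close>.\<close>

locale bounded_martingale_differences = prob_space M for M :: "'a measure" +
  fixes G :: "nat \<Rightarrow> 'a measure" and d v :: "nat \<Rightarrow> 'a \<Rightarrow> real" and w :: "'a \<Rightarrow> real" and K :: real
  assumes subalgebra: "\<And>k. subalgebra M (G k)"
    and filtration: "filtration (space M) G"
    and d_meas: "\<And>k. d k \<in> borel_measurable (G (Suc k))"
    and v_meas: "\<And>k. v k \<in> borel_measurable (G k)"
    and w_meas: "w \<in> borel_measurable M"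
    and d_bound: "\<And>k \<omega>. \<omega> \<in> space M \<Longrightarrow> \<bar>d k \<omega>\<bar> \<le> K"
    and v_bound: "\<And>k \<omega>. \<omega> \<in> space M \<Longrightarrow> \<bar>v k \<omega>\<bar> \<le> K"
    and w_bound: "\<And>\<omega>. \<omega> \<in> space M \<Longrightarrow> \<bar>w \<omega>\<bar> \<le> K"
    and cond_mean: "\<And>k h C. h \<in> borel_measurable (G k) \<Longrightarrow> (\<And>\<omega>. \<omega> \<in> space M \<Longrightarrow> \<bar>h \<omega>\<bar> \<le> C) \<Longrightarrow>
        (LINT \<omega>|M. h \<omega> * d k \<omega>) = 0"
    and cond_var: "\<And>k h C. h \<in> borel_measurable (G k) \<Longrightarrow> (\<And>\<omega>. \<omega> \<in> space M \<Longrightarrow> \<bar>h \<omega>\<bar> \<le> C) \<Longrightarrow>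
        (LINT \<omega>|M. h \<omega> * (d k \<omega>)\<^sup>2) = (LINT \<omega>|M. h \<omega> * v k \<omega>)"
    and var_conv: "(\<lambda>k. LINT \<omega>|M. \<bar>v k \<omega> - w \<omega>\<bar>) \<longlonglongrightarrow> 0"
begin

lemma G_mono: "j \<le> k \<Longrightarrow> f \<in> borel_measurable (G j) \<Longrightarrow> f \<in> borel_measurable (G k)"
  using filtration.sets_F_mono[OF filtration, of j k] filtration.space_F[OF filtration]
  by (intro measurable_from_subalg[of "G k" "G j"]) (auto simp: subalgebra_def)

lemma meas_M[measurable]: "d k \<in> borel_measurable M" "v k \<in> borel_measurable M"
  using measurable_from_subalg[OF subalgebra d_meas] measurable_from_subalg[OF subalgebra v_meas] .

declare w_meas[measurable]

lemma K_nonneg: "K \<ge> 0"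
proof -
  obtain \<omega> where "\<omega> \<in> space M" using not_empty by auto
  from d_bound[OF this] show ?thesis by (metis abs_ge_zero order_trans)
qed

text \<open>The test functions of the locale are real; a complex one is split into its real and
  imaginary parts.\<close>

lemma complex_cond:
  assumes U: "U \<in> borel_measurable (G k)" "\<And>\<omega>. \<omega> \<in> space M \<Longrightarrow> cmod (U \<omega>) \<le> C"
  shows "(LINT \<omega>|M. U \<omega> * of_real (d k \<omega>)) = 0"
    and "(LINT \<omega>|M. U \<omega> * of_real ((d k \<omega>)\<^sup>2)) = (LINT \<omega>|M. U \<omega> * of_real (v k \<omega>))"
proof -
  have C: "C \<ge> 0"
  proof -
    obtain \<omega> where "\<omega> \<in> space M" using not_empty by auto
    from U(2)[OF this] show ?thesis by (metis norm_ge_zero order_trans)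
  qed
  have [measurable]: "U \<in> borel_measurable M" by (rule measurable_from_subalg[OF subalgebra U(1)])
  have RI: "(\<lambda>\<omega>. Re (U \<omega>)) \<in> borel_measurable (G k)" "(\<lambda>\<omega>. Im (U \<omega>)) \<in> borel_measurable (G k)"
    using U(1) by measurable
  have bd: "\<bar>Re (U \<omega>)\<bar> \<le> C" "\<bar>Im (U \<omega>)\<bar> \<le> C" if "\<omega> \<in> space M" for \<omega>
    using U(2)[OF that] abs_Re_le_cmod[of "U \<omega>"] abs_Im_le_cmod[of "U \<omega>"] by linarith+
  have int: "integrable M (\<lambda>\<omega>. U \<omega> * of_real (f \<omega>))" 
    if [measurable]: "f \<in> borel_measurable M" and "\<And>\<omega>. \<omega> \<in> space M \<Longrightarrow> \<bar>f \<omega>\<bar> \<le> B" for f B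
    using U(2) that(2) C by (intro integrable_const_bound[where B="C * B"]) (auto simp: norm_mult intro!: mult_mono)
  have d2: "\<bar>(d k \<omega>)\<^sup>2\<bar> \<le> K\<^sup>2" if "\<omega> \<in> space M" for \<omega>
    using power_mono[OF d_bound[OF that] abs_ge_zero, of _ 2] by simp
  note i = int[OF _ d_bound] int[OF _ d2] int[OF _ v_bound]
  show "(LINT \<omega>|M. U \<omega> * of_real (d k \<omega>)) = 0"
    using cond_mean[OF RI(1) bd(1)] cond_mean[OF RI(2) bd(2)] i(1)
    by (simp add: complex_eq_iff integral_Re[symmetric] integral_Im[symmetric])
  show "(LINT \<omega>|M. U \<omega> * of_real ((d k \<omega>)\<^sup>2)) = (LINT \<omega>|M. U \<omega> * of_real (v k \<omega>))"
    using cond_var[OF RI(1) bd(1)] cond_var[OF RI(2) bd(2)] i(2,3)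
    by (simp add: complex_eq_iff integral_Re[symmetric] integral_Im[symmetric] del: of_real_power)
qed

text \<open>
  With the limit variance replaced by \<open>v m\<close>, the exponential \<open>U m n j\<close> is up to small errors a
  martingale in \<open>j \<ge> m\<close>; it starts close to \<open>exp (- v m / 2)\<close> and ends with the exponential of the
  normalised sum.
\<close>

definition U :: "nat \<Rightarrow> nat \<Rightarrow> nat \<Rightarrow> 'a \<Rightarrow> complex" where
  "U m n j \<omega> = exp (\<i> * of_real (1 / sqrt n * (\<Sum>k=m..<j. d k \<omega>))
      + of_real (v m \<omega> * (real j - real n) / (2 * real n)))"

text \<open>Only the real part of the exponent contributes to the modulus, and
  \<open>0 \<le> n - j \<le> n\<close> bounds it by \<open>K / 2\<close>.\<close>

lemma U_bound:
  assumes "m \<le> j" "j \<le> n" "n \<ge> 1" "\<omega> \<in> space M"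
  shows "cmod (U m n j \<omega>) \<le> exp K"
proof -
  have "\<bar>v m \<omega> * (real j - real n) / (2 * real n)\<bar> = \<bar>v m \<omega>\<bar> * ((real n - real j) / (2 * real n))"
    using assms by (simp add: abs_mult)
  also have "\<dots> \<le> K * 1"
    using assms v_bound[OF assms(4)] K_nonneg by (intro mult_mono) (auto simp: field_simps)
  finally have "v m \<omega> * (real j - real n) / (2 * real n) \<le> K"
    by (simp only: mult_1_right abs_le_iff)
  then show ?thesis by (simp add: U_def)
qed

lemma U_meas:
  assumes "m \<le> j"
  shows "U m n j \<in> borel_measurable (G j)"
proof -
  have [measurable]: "d k \<in> borel_measurable (G j)" if "k \<in> {m..<j}" for k
    using that by (intro G_mono[OF _ d_meas]) auto
  have [measurable]: "v m \<in> borel_measurable (G j)"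
    by (rule G_mono[OF assms v_meas])
  show ?thesis unfolding U_def by measurable
qed

definition B :: real where "B = exp K * (2 * K) ^ 3 + K\<^sup>2"

text \<open>In the second-order expansion the linear term has conditional mean 0, and the square of
  \<open>d j\<close> may be replaced by \<open>v j\<close>. The exponent compensates with
  \<open>v m\<close> instead of \<open>v j\<close>, so the discrepancy \<open>v m - v j\<close>
  survives with weight \<open>1 / (2 * n)\<close>, next to the Taylor remainder.\<close>

lemma U_step:
  assumes "m \<le> j" "j < n"
  shows "cmod (expectation (U m n (Suc j)) - expectation (U m n j))
    \<le> exp K * ((LINT \<omega>|M. \<bar>v m \<omega> - v j \<omega>\<bar>) / (2 * real n) + B / sqrt n ^ 3)"
proof -
  have n: "n \<ge> 1" "sqrt n \<ge> 1" "j \<le> n" "m \<le> Suc j" "Suc j \<le> n" using assms by auto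
  note Ub = U_bound[OF assms(1) n(3,1)]
  have Um[measurable]: "U m n j \<in> borel_measurable M" "U m n (Suc j) \<in> borel_measurable M"
    using measurable_from_subalg[OF subalgebra U_meas] assms by auto
  define N where "N = sqrt (real n)"
  have N: "N \<ge> 1" "N\<^sup>2 = real n" using n by (auto simp: N_def)
  define x where "x \<omega> = \<i> * complex_of_real (d j \<omega> / N) + of_real (v m \<omega> / (2 * N\<^sup>2))" for \<omega>
  define y where "y \<omega> = \<i> * complex_of_real (d j \<omega> / N) + of_real ((v m \<omega> - (d j \<omega>)\<^sup>2) / (2 * N\<^sup>2))" for \<omega>
  have xm[measurable]: "x \<in> borel_measurable M" "y \<in> borel_measurable M"
    unfolding x_def y_def by measurable
  \<comment> \<open>The sum gains the difference \<open>d j\<close> and the compensating exponent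
    gains \<open>v m / (2 * n)\<close>; together they are the \<open>x\<close> of the
    expansion.\<close>
  have USuc: "U m n (Suc j) \<omega> = U m n j \<omega> * exp (x \<omega>)" for \<omega>
  proof -
    have 1: "v m \<omega> * (real (Suc j) - real n) / (2 * real n)
        = v m \<omega> * (real j - real n) / (2 * real n) + v m \<omega> / (2 * real n)"
      by (simp add: add_divide_distrib[symmetric] algebra_simps)
    have 2: "1 / sqrt n * (\<Sum>k=m..<Suc j. d k \<omega>) = 1 / sqrt n * (\<Sum>k=m..<j. d k \<omega>) + d j \<omega> / sqrt n"
      using assms by (simp add: add_divide_distrib)
    show ?thesis
      unfolding U_def x_def exp_add[symmetric] N(2) 1 2 unfolding N_def
      by (simp add: algebra_simps)
  qed
  have rem: "cmod (exp (x \<omega>) - 1 - y \<omega>) \<le> B / N ^ 3" if "\<omega> \<in> space M" for \<omega>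
    unfolding x_def y_def B_def by (rule exp_second_order[OF d_bound[OF that] v_bound[OF that] N(1)])
  have iU: "integrable M (\<lambda>\<omega>. U m n j \<omega>)" "integrable M (\<lambda>\<omega>. U m n (Suc j) \<omega>)"
    using Ub U_bound[OF n(4,5,1)] by (auto intro!: integrable_const_bound[where B="exp K"])
  have iUr: "integrable M (\<lambda>\<omega>. U m n j \<omega> * of_real (f \<omega>))" 
    if [measurable]: "f \<in> borel_measurable M" and "\<And>\<omega>. \<omega> \<in> space M \<Longrightarrow> \<bar>f \<omega>\<bar> \<le> C" for f C
    using Ub that(2)
    by (intro integrable_const_bound[where B="exp K * C"]) (auto simp: norm_mult intro!: mult_mono)
  have d2: "\<bar>(d j \<omega>)\<^sup>2\<bar> \<le> K\<^sup>2" if "\<omega> \<in> space M" for \<omega>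
    using power_mono[OF d_bound[OF that] abs_ge_zero, of _ 2] by simp
  note id = iUr[OF meas_M(1) d_bound, of j] and id2 = iUr[OF _ d2] and iv = iUr[OF meas_M(2) v_bound]
  have Uy: "U m n j \<omega> * y \<omega> = \<i> / of_real N * (U m n j \<omega> * of_real (d j \<omega>))
      + (1 / of_real (2 * N\<^sup>2)) * (U m n j \<omega> * of_real (v m \<omega>) - U m n j \<omega> * of_real ((d j \<omega>)\<^sup>2))" for \<omega>
    unfolding y_def by (simp add: algebra_simps diff_divide_distrib)
  have iUy: "integrable M (\<lambda>\<omega>. U m n j \<omega> * y \<omega>)"
    unfolding Uy using id id2 iv[of m]
    by (intro Bochner_Integration.integrable_add integrable_mult_right Bochner_Integration.integrable_diff) auto
  have "(LINT \<omega>|M. U m n j \<omega> * y \<omega>) = (1 / of_real (2 * N\<^sup>2)) *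
      ((LINT \<omega>|M. U m n j \<omega> * of_real (v m \<omega>)) - (LINT \<omega>|M. U m n j \<omega> * of_real (v j \<omega>)))"
    unfolding Uy
    using id id2 iv[of m] complex_cond[OF U_meas[OF assms(1)] Ub]
    by (subst Bochner_Integration.integral_add)
       (auto simp del: of_real_power intro!: integrable_mult_right Bochner_Integration.integrable_diff)
  also have "\<dots> = (1 / of_real (2 * N\<^sup>2)) * (LINT \<omega>|M. U m n j \<omega> * of_real (v m \<omega> - v j \<omega>))"
    using iv[of m] iv[of j] by (simp add: right_diff_distrib)
  finally have "cmod (LINT \<omega>|M. U m n j \<omega> * y \<omega>)
      = cmod (LINT \<omega>|M. U m n j \<omega> * of_real (v m \<omega> - v j \<omega>)) / (2 * N\<^sup>2)"
    by (simp add: norm_mult norm_divide norm_power)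
  also have "cmod (LINT \<omega>|M. U m n j \<omega> * of_real (v m \<omega> - v j \<omega>)) \<le> (LINT \<omega>|M. exp K * \<bar>v m \<omega> - v j \<omega>\<bar>)"
  proof (rule norm_integral_le)
    have vb: "\<bar>v m \<omega> - v j \<omega>\<bar> \<le> 2 * K" if "\<omega> \<in> space M" for \<omega>
      using v_bound[OF that, of m] v_bound[OF that, of j] by linarith
    show "integrable M (\<lambda>\<omega>. U m n j \<omega> * of_real (v m \<omega> - v j \<omega>))"
      by (rule iUr[OF _ vb]) measurable
    show "integrable M (\<lambda>\<omega>. exp K * \<bar>v m \<omega> - v j \<omega>\<bar>)"
      using vb by (intro integrable_mult_right integrable_const_bound[where B="2 * K"]) auto
  qed (auto simp: norm_mult intro!: mult_right_mono Ub simp del: of_real_diff)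
  finally have 1: "cmod (LINT \<omega>|M. U m n j \<omega> * y \<omega>) \<le> exp K * (LINT \<omega>|M. \<bar>v m \<omega> - v j \<omega>\<bar>) / (2 * N\<^sup>2)"
    by (simp add: divide_right_mono)
  have eq: "U m n j \<omega> * (exp (x \<omega>) - 1 - y \<omega>) = U m n (Suc j) \<omega> - U m n j \<omega> - U m n j \<omega> * y \<omega>" for \<omega>
    by (simp add: USuc algebra_simps)
  have 2: "cmod (LINT \<omega>|M. U m n j \<omega> * (exp (x \<omega>) - 1 - y \<omega>)) \<le> (LINT \<omega>|M. exp K * (B / N ^ 3))"
  proof (rule norm_integral_le)
    show "integrable M (\<lambda>\<omega>. U m n j \<omega> * (exp (x \<omega>) - 1 - y \<omega>))"
      unfolding eq using iU iUy by (intro Bochner_Integration.integrable_diff)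
    show "cmod (U m n j \<omega> * (exp (x \<omega>) - 1 - y \<omega>)) \<le> exp K * (B / N ^ 3)" if "\<omega> \<in> space M" for \<omega>
      unfolding norm_mult by (intro mult_mono Ub rem that) auto
  qed simp
  have "expectation (U m n (Suc j)) - expectation (U m n j)
      = (LINT \<omega>|M. U m n j \<omega> * (exp (x \<omega>) - 1 - y \<omega>)) + (LINT \<omega>|M. U m n j \<omega> * y \<omega>)"
    unfolding eq using iU iUy by simp
  also have "cmod \<dots> \<le> exp K * (B / N ^ 3) + exp K * (LINT \<omega>|M. \<bar>v m \<omega> - v j \<omega>\<bar>) / (2 * N\<^sup>2)"
    using 1 2 by (intro order_trans[OF norm_triangle_ineq] add_mono) (auto simp: prob_space)
  also have "\<dots> = exp K * ((LINT \<omega>|M. \<bar>v m \<omega> - v j \<omega>\<bar>) / (2 * real n) + B / sqrt n ^ 3)"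
    unfolding N(2) by (simp add: N_def algebra_simps)
  finally show ?thesis .
qed

text \<open>Three comparisons: the normalised sum with \<open>U m n n\<close>, this with
  \<open>U m n m\<close> by adding up the steps, and \<open>U m n m\<close> with the exponential of
  \<open>- w / 2\<close>. As \<open>m\<close> is fixed before \<open>n\<close>, the first
  \<open>m\<close> differences disappear under the normalisation.\<close>

theorem mixed_normal_limit:
  "(\<lambda>n. LINT \<omega>|M. iexp (1 / sqrt n * (\<Sum>k<n. d k \<omega>)))
     \<longlonglongrightarrow> (LINT \<omega>|M. complex_of_real (exp (- w \<omega> / 2)))"
proof (rule LIMSEQ_I)
  fix e :: real assume "e > 0"
  \<comment> \<open>The errors that do not vanish with \<open>n\<close> add up to
    \<open>3 / 2 * exp K * \<delta>\<close>, that is \<open>3 / 8 * e\<close>; the others stay below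
    \<open>e / 2\<close>.\<close>
  define \<delta> where "\<delta> = e / (4 * exp K)"
  have "\<delta> > 0" using \<open>e > 0\<close> by (simp add: \<delta>_def)
  then obtain m where m: "\<And>k. k \<ge> m \<Longrightarrow> (LINT \<omega>|M. \<bar>v k \<omega> - w \<omega>\<bar>) < \<delta>"
    using LIMSEQ_D[OF var_conv, of \<delta>] by auto
  have vw: "\<bar>v k \<omega> - w \<omega>\<bar> \<le> 2 * K" "\<bar>v m \<omega> - v k \<omega>\<bar> \<le> 2 * K" if "\<omega> \<in> space M" for k \<omega>
    using v_bound[OF that, of k] w_bound[OF that] v_bound[OF that, of m] by linarith+
  have int: "integrable M (\<lambda>\<omega>. \<bar>v k \<omega> - w \<omega>\<bar>)" "integrable M (\<lambda>\<omega>. \<bar>v m \<omega> - v k \<omega>\<bar>)" for k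
    using vw by (auto intro!: integrable_bounded[where C="2 * K"])
  have vv: "(LINT \<omega>|M. \<bar>v m \<omega> - v k \<omega>\<bar>) \<le> 2 * \<delta>" if "k \<ge> m" for k
  proof -
    have "(LINT \<omega>|M. \<bar>v m \<omega> - v k \<omega>\<bar>) \<le> (LINT \<omega>|M. \<bar>v m \<omega> - w \<omega>\<bar> + \<bar>v k \<omega> - w \<omega>\<bar>)"
      using int by (intro integral_mono) auto
    also have "\<dots> \<le> 2 * \<delta>" using int m[of m] m[OF that] by simp
    finally show ?thesis .
  qed
  \<comment> \<open>Errors that vanish for fixed \<open>m\<close>: the omitted first
    \<open>m\<close> differences, the accumulated Taylor remainders, and the excess
    \<open>v m * m / (2 * n)\<close> in the starting exponent.\<close>
  define E where "E n = m * K / sqrt n + exp K * B / sqrt n + exp K * (K * m / (2 * real n))" for n :: nat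
  have "E \<longlonglongrightarrow> 0" unfolding E_def by real_asymp
  then obtain n0 where n0: "\<And>n. n \<ge> n0 \<Longrightarrow> \<bar>E n\<bar> < e / 2"
    using LIMSEQ_D[of E 0 "e / 2"] \<open>e > 0\<close> by auto
  show "\<exists>n0. \<forall>n\<ge>n0. norm ((LINT \<omega>|M. iexp (1 / sqrt n * (\<Sum>k<n. d k \<omega>)))
      - (LINT \<omega>|M. complex_of_real (exp (- w \<omega> / 2)))) < e"
  proof (intro exI[of _ "max n0 (max m 1)"] allI impI)
    fix n assume "n \<ge> max n0 (max m 1)"
    then have n: "n \<ge> n0" "m \<le> n" "n \<ge> 1" by auto
    have B0: "B \<ge> 0" using K_nonneg by (simp add: B_def)
    have sq: "real n / sqrt n ^ 3 = 1 / sqrt n"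
      using n by (simp add: power3_eq_cube real_div_sqrt field_simps)
    have tel: "cmod (expectation (U m n j) - expectation (U m n m))
        \<le> (\<Sum>k=m..<j. exp K * (\<delta> / real n + B / sqrt n ^ 3))" if "m \<le> j" "j \<le> n" for j
      using that
    proof (induction j rule: dec_induct)
      case (step j)
      have "cmod (expectation (U m n (Suc j)) - expectation (U m n j))
          \<le> exp K * ((LINT \<omega>|M. \<bar>v m \<omega> - v j \<omega>\<bar>) / (2 * real n) + B / sqrt n ^ 3)"
        using step by (intro U_step) auto
      also have "\<dots> \<le> exp K * ((2 * \<delta>) / (2 * real n) + B / sqrt n ^ 3)"
        using vv[of j] step by (intro mult_left_mono add_right_mono divide_right_mono) auto
      finally have s: "cmod (expectation (U m n (Suc j)) - expectation (U m n j))
          \<le> exp K * (\<delta> / real n + B / sqrt n ^ 3)" by simp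
      have "cmod (expectation (U m n (Suc j)) - expectation (U m n m))
          \<le> cmod (expectation (U m n j) - expectation (U m n m))
            + cmod (expectation (U m n (Suc j)) - expectation (U m n j))"
        using norm_triangle_ineq[of "expectation (U m n j) - expectation (U m n m)"
            "expectation (U m n (Suc j)) - expectation (U m n j)"] by simp
      moreover have "cmod (expectation (U m n j) - expectation (U m n m))
          \<le> (\<Sum>k=m..<j. exp K * (\<delta> / real n + B / sqrt n ^ 3))"
        using step by simp
      ultimately show ?case
        unfolding sum.atLeastLessThan_Suc[OF \<open>m \<le> j\<close>] using s by linarith
    qed simp
    have t1: "cmod (expectation (U m n n) - expectation (U m n m)) \<le> exp K * \<delta> + exp K * B / sqrt n"
    proof -
      have "cmod (expectation (U m n n) - expectation (U m n m))
          \<le> (real n - real m) * (exp K * (\<delta> / real n + B / sqrt n ^ 3))"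
        using tel[of n] n by (simp add: of_nat_diff)
      also have "\<dots> \<le> real n * (exp K * (\<delta> / real n + B / sqrt n ^ 3))"
        using \<open>\<delta> > 0\<close> B0 by (intro mult_right_mono mult_nonneg_nonneg add_nonneg_nonneg) auto
      also have "\<dots> = exp K * \<delta> + exp K * B * (real n / sqrt n ^ 3)"
        using n by (simp add: field_simps)
      finally show ?thesis unfolding sq by simp
    qed
    define S where "S \<omega> = 1 / sqrt n * (\<Sum>k<n. d k \<omega>)" for \<omega>
    define T where "T \<omega> = 1 / sqrt n * (\<Sum>k=m..<n. d k \<omega>)" for \<omega>
    have [measurable]: "S \<in> borel_measurable M" "T \<in> borel_measurable M"
      unfolding S_def T_def by measurable
    have "S \<omega> - T \<omega> = 1 / sqrt n * (\<Sum>k<m. d k \<omega>)" for \<omega>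
      using sum.atLeastLessThan_concat[of 0 m n "\<lambda>k. d k \<omega>"] n
      by (simp add: S_def T_def lessThan_atLeast0 diff_divide_distrib[symmetric])
    moreover have "\<bar>\<Sum>k<m. d k \<omega>\<bar> \<le> m * K" if "\<omega> \<in> space M" for \<omega>
      using order_trans[OF sum_abs sum_mono[of "{..<m}" "\<lambda>k. \<bar>d k \<omega>\<bar>" "\<lambda>_. K"]] d_bound[OF that]
      by simp
    ultimately have ST: "\<bar>S \<omega> - T \<omega>\<bar> \<le> m * K / sqrt n" if "\<omega> \<in> space M" for \<omega>
      using that by (simp add: abs_mult divide_right_mono)
    have t2: "cmod ((LINT \<omega>|M. iexp (S \<omega>)) - expectation (U m n n)) \<le> m * K / sqrt n"
    proof -
      have i: "integrable M (\<lambda>\<omega>. iexp (S \<omega>))" "integrable M (\<lambda>\<omega>. iexp (T \<omega>))"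
        by (auto intro!: integrable_const_bound[where B=1])
      have "U m n n = (\<lambda>\<omega>. iexp (T \<omega>))" by (simp add: U_def T_def fun_eq_iff)
      then have "cmod ((LINT \<omega>|M. iexp (S \<omega>)) - expectation (U m n n)) = cmod (LINT \<omega>|M. iexp (S \<omega>) - iexp (T \<omega>))"
        using i by simp
      also have "\<dots> \<le> (LINT \<omega>|M. m * K / sqrt n)"
      proof (rule norm_integral_le)
        fix \<omega> assume "\<omega> \<in> space M"
        have "iexp (S \<omega>) - iexp (T \<omega>) = iexp (T \<omega>) * (iexp (S \<omega> - T \<omega>) - 1)"
          by (simp add: right_diff_distrib exp_add[symmetric])
        then have "cmod (iexp (S \<omega>) - iexp (T \<omega>)) = cmod (iexp (S \<omega> - T \<omega>) - 1)"
          by (simp add: norm_mult)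
        also have "\<dots> \<le> \<bar>S \<omega> - T \<omega>\<bar>"
          using iexp_approx1[of "S \<omega> - T \<omega>" 0] by simp
        finally show "cmod (iexp (S \<omega>) - iexp (T \<omega>)) \<le> m * K / sqrt n"
          using ST[OF \<open>\<omega> \<in> space M\<close>] by linarith
      qed (use i in auto)
      finally show ?thesis by (simp add: prob_space)
    qed
    have t3: "cmod (expectation (U m n m) - (LINT \<omega>|M. complex_of_real (exp (- w \<omega> / 2))))
        \<le> exp K * \<delta> / 2 + exp K * (K * m / (2 * real n))"
    proof -
      define a where "a \<omega> = v m \<omega> * (real m - real n) / (2 * real n)" for \<omega>
      have am[measurable]: "a \<in> borel_measurable M" unfolding a_def by measurable
      have ae: "a \<omega> - (- w \<omega> / 2) = v m \<omega> * m / (2 * real n) - (v m \<omega> - w \<omega>) / 2" for \<omega>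
        using n by (simp add: a_def field_simps)
      have a: "a \<omega> \<le> K" "- w \<omega> / 2 \<le> K" "\<bar>a \<omega> - (- w \<omega> / 2)\<bar> \<le> K * m / (2 * real n) + \<bar>v m \<omega> - w \<omega>\<bar> / 2"
        if "\<omega> \<in> space M" for \<omega>
      proof -
        have "a \<omega> \<le> \<bar>v m \<omega>\<bar> * ((real n - real m) / (2 * real n))"
          using n mult_right_mono[of "- v m \<omega>" "\<bar>v m \<omega>\<bar>" "(real n - real m) / (2 * real n)"]
          by (simp add: a_def minus_mult_commute) (simp add: field_simps)
        also have "\<dots> \<le> K * 1"
          using n v_bound[OF that] K_nonneg by (intro mult_mono) (auto simp: field_simps)
        finally show "a \<omega> \<le> K" by simp
        show "- w \<omega> / 2 \<le> K" using w_bound[OF that] K_nonneg by linarith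
        have "\<bar>v m \<omega> * m / (2 * real n)\<bar> \<le> K * m / (2 * real n)"
          using v_bound[OF that, of m] by (auto simp: abs_mult intro!: divide_right_mono mult_right_mono)
        then show "\<bar>a \<omega> - (- w \<omega> / 2)\<bar> \<le> K * m / (2 * real n) + \<bar>v m \<omega> - w \<omega>\<bar> / 2"
          unfolding ae by (intro order_trans[OF abs_triangle_ineq4] add_mono) auto
      qed
      have i: "integrable M (\<lambda>\<omega>. complex_of_real (exp (a \<omega>)))" "integrable M (\<lambda>\<omega>. complex_of_real (exp (- w \<omega> / 2)))"
        using a(1,2) by (auto intro!: integrable_const_bound[where B="exp K"])
      have "U m n m = (\<lambda>\<omega>. complex_of_real (exp (a \<omega>)))" 
        by (simp add: U_def a_def fun_eq_iff flip: exp_of_real)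
      then have "cmod (expectation (U m n m) - (LINT \<omega>|M. complex_of_real (exp (- w \<omega> / 2))))
          = cmod (LINT \<omega>|M. complex_of_real (exp (a \<omega>)) - complex_of_real (exp (- w \<omega> / 2)))"
        using i by simp
      also have "\<dots> \<le> (LINT \<omega>|M. exp K * (K * m / (2 * real n) + \<bar>v m \<omega> - w \<omega>\<bar> / 2))"
      proof (rule norm_integral_le)
        fix \<omega> assume w: "\<omega> \<in> space M"
        have "cmod (complex_of_real (exp (a \<omega>)) - complex_of_real (exp (- w \<omega> / 2))) = \<bar>exp (a \<omega>) - exp (- w \<omega> / 2)\<bar>"
          by (metis norm_of_real of_real_diff)
        also have "\<dots> \<le> exp K * \<bar>a \<omega> - (- w \<omega> / 2)\<bar>" by (rule exp_diff_le[OF a(1,2)[OF w]])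
        also have "\<dots> \<le> exp K * (K * m / (2 * real n) + \<bar>v m \<omega> - w \<omega>\<bar> / 2)"
          by (intro mult_left_mono a(3)[OF w]) simp
        finally show "cmod (complex_of_real (exp (a \<omega>)) - complex_of_real (exp (- w \<omega> / 2)))
          \<le> exp K * (K * m / (2 * real n) + \<bar>v m \<omega> - w \<omega>\<bar> / 2)" .
      qed (use i int[of m] in auto)
      also have "\<dots> = exp K * (K * m / (2 * real n) + (LINT \<omega>|M. \<bar>v m \<omega> - w \<omega>\<bar>) / 2)"
        using int[of m] by (simp add: prob_space)
      also have "\<dots> \<le> exp K * (K * m / (2 * real n) + \<delta> / 2)"
        using m[of m] by (intro mult_left_mono add_left_mono divide_right_mono) auto
      finally show ?thesis by (simp add: algebra_simps)
    qed
    have "cmod ((LINT \<omega>|M. iexp (S \<omega>)) - (LINT \<omega>|M. complex_of_real (exp (- w \<omega> / 2))))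
        \<le> cmod ((LINT \<omega>|M. iexp (S \<omega>)) - expectation (U m n n))
          + cmod (expectation (U m n n) - expectation (U m n m))
          + cmod (expectation (U m n m) - (LINT \<omega>|M. complex_of_real (exp (- w \<omega> / 2))))"
      by (rule norm_diff_triangle_le[OF norm_diff_triangle_le[OF order_refl order_refl] order_refl])
    also have "\<dots> \<le> E n + 3 / 2 * (exp K * \<delta>)"
      using t1 t2 t3 by (simp add: E_def)
    also have "\<dots> < e"
      using n0[OF n(1)] \<open>e > 0\<close> by (simp add: \<delta>_def)
    finally show "norm ((LINT \<omega>|M. iexp (1 / sqrt n * (\<Sum>k<n. d k \<omega>)))
      - (LINT \<omega>|M. complex_of_real (exp (- w \<omega> / 2)))) < e"
      by (simp add: S_def)
  qed
qed

end

section \<open>Conditionally identically distributed sequences\<close>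

text \<open>The variance of \<open>\<Sum>\<^sub>i c\<^sub>i W(u\<^sub>i)\<close> for a Brownian bridge \<open>W\<close>.\<close>

definition bridge_form :: "nat \<Rightarrow> (nat \<Rightarrow> real) \<Rightarrow> (nat \<Rightarrow> real) \<Rightarrow> real" where
  "bridge_form r c u = (\<Sum>i<r. \<Sum>j<r. c i * c j * (min (u i) (u j) - u i * u j))"

abbreviation (input) bridge_char :: "nat \<Rightarrow> (nat \<Rightarrow> real) \<Rightarrow> (nat \<Rightarrow> real) \<Rightarrow> complex" where
  "bridge_char r c u \<equiv> complex_of_real (exp (- bridge_form r c u / 2))"

lemma bridge_form_bound:
  assumes "\<And>i. i < r \<Longrightarrow> 0 \<le> u i \<and> u i \<le> 1"
  shows "\<bar>bridge_form r c u\<bar> \<le> (\<Sum>i<r. \<bar>c i\<bar>)\<^sup>2"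
proof -
  have "\<bar>bridge_form r c u\<bar> \<le> (\<Sum>i<r. \<Sum>j<r. \<bar>c i * c j * (min (u i) (u j) - u i * u j)\<bar>)"
    unfolding bridge_form_def by (intro order_trans[OF sum_abs] sum_mono) simp
  also have "\<dots> \<le> (\<Sum>i<r. \<Sum>j<r. \<bar>c i\<bar> * \<bar>c j\<bar>)"
  proof (intro sum_mono)
    fix i j assume "i \<in> {..<r}" "j \<in> {..<r}"
    then have u: "0 \<le> u i" "u i \<le> 1" "0 \<le> u j" "u j \<le> 1" using assms by auto
    have "u i * u j \<le> min (u i) (u j)"
      using mult_left_mono[of "u j" 1 "u i"] mult_right_mono[of "u i" 1 "u j"] u by simp
    moreover have "0 \<le> u i * u j" using u by simp
    moreover have "min (u i) (u j) \<le> 1" using u by simp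
    ultimately have "\<bar>min (u i) (u j) - u i * u j\<bar> \<le> 1" by linarith
    then show "\<bar>c i * c j * (min (u i) (u j) - u i * u j)\<bar> \<le> \<bar>c i\<bar> * \<bar>c j\<bar>"
      by (simp add: abs_mult mult_left_le)
  qed
  also have "\<dots> = (\<Sum>i<r. \<bar>c i\<bar>)\<^sup>2"
    by (simp add: power2_eq_square sum_product)
  finally show ?thesis .
qed

text \<open>Through this Lipschitz estimate, mean convergence of the conditional distribution
  functions becomes mean convergence of the conditional variances.\<close>

lemma bridge_form_diff:
  assumes "\<And>i. i < r \<Longrightarrow> 0 \<le> u i \<and> u i \<le> 1" "\<And>i. i < r \<Longrightarrow> 0 \<le> u' i \<and> u' i \<le> 1"
  shows "\<bar>bridge_form r c u - bridge_form r c u'\<bar>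
    \<le> (\<Sum>i<r. \<Sum>j<r. \<bar>c i\<bar> * \<bar>c j\<bar> * (2 * (\<bar>u i - u' i\<bar> + \<bar>u j - u' j\<bar>)))"
proof -
  have "\<bar>bridge_form r c u - bridge_form r c u'\<bar> = \<bar>\<Sum>i<r. \<Sum>j<r. c i * c j *
      ((min (u i) (u j) - min (u' i) (u' j)) - (u i * u j - u' i * u' j))\<bar>"
    unfolding bridge_form_def by (simp add: sum_subtractf sum.distrib algebra_simps)
  also have "\<dots> \<le> (\<Sum>i<r. \<Sum>j<r. \<bar>c i * c j *
      ((min (u i) (u j) - min (u' i) (u' j)) - (u i * u j - u' i * u' j))\<bar>)"
    by (intro order_trans[OF sum_abs] sum_mono) simp
  also have "\<dots> \<le> (\<Sum>i<r. \<Sum>j<r. \<bar>c i\<bar> * \<bar>c j\<bar> * (2 * (\<bar>u i - u' i\<bar> + \<bar>u j - u' j\<bar>)))"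
  proof (intro sum_mono)
    fix i j assume "i \<in> {..<r}" "j \<in> {..<r}"
    then have u: "0 \<le> u j" "u j \<le> 1" "0 \<le> u' i" "u' i \<le> 1" using assms by auto
    have "u i * u j - u' i * u' j = (u i - u' i) * u j + u' i * (u j - u' j)"
      by (simp add: algebra_simps)
    also have "\<bar>\<dots>\<bar> \<le> \<bar>u i - u' i\<bar> * 1 + 1 * \<bar>u j - u' j\<bar>"
      using u by (intro order_trans[OF abs_triangle_ineq] add_mono) (auto simp: abs_mult intro!: mult_left_le mult_left_le_one_le)
    finally have 1: "\<bar>u i * u j - u' i * u' j\<bar> \<le> \<bar>u i - u' i\<bar> + \<bar>u j - u' j\<bar>" by simp
    have 2: "\<bar>min (u i) (u j) - min (u' i) (u' j)\<bar> \<le> \<bar>u i - u' i\<bar> + \<bar>u j - u' j\<bar>"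
      by linarith
    have "\<bar>(min (u i) (u j) - min (u' i) (u' j)) - (u i * u j - u' i * u' j)\<bar> \<le> 2 * (\<bar>u i - u' i\<bar> + \<bar>u j - u' j\<bar>)"
      using order_trans[OF abs_triangle_ineq4 add_mono[OF 2 1]] by simp
    then show "\<bar>c i * c j * ((min (u i) (u j) - min (u' i) (u' j)) - (u i * u j - u' i * u' j))\<bar>
        \<le> \<bar>c i\<bar> * \<bar>c j\<bar> * (2 * (\<bar>u i - u' i\<bar> + \<bar>u j - u' j\<bar>))"
      unfolding abs_mult by (intro mult_left_mono) auto
  qed
  finally show ?thesis .
qed

section \<open>Conditional distribution functions and the directing measure\<close>

lemma cts_step_bounds:
  assumes "a < b"
  shows "0 \<le> cts_step a b x" "cts_step a b x \<le> 1" "indicator {..a} x \<le> cts_step a b x"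
  using assms by (auto simp: cts_step_def divide_simps split: split_indicator)

text \<open>Inside the locale \<open>X (Suc k)\<close> and \<open>\<kappa> (Suc k)\<close> are
  paired with \<open>G k\<close>, which turns the sequences starting at 1 into sequences starting at
  0.\<close>

locale cid_process = prob_space M for M :: "'a measure" +
  fixes G :: "nat \<Rightarrow> 'a measure" and X :: "nat \<Rightarrow> 'a \<Rightarrow> real"
    and \<alpha> :: "'a \<Rightarrow> real measure" and \<kappa> :: "nat \<Rightarrow> 'a \<Rightarrow> real measure"
  assumes subalgebra: "\<And>n. subalgebra M (G n)" and filtration: "filtration (space M) G"
    and cid: "cid M G X"
    and directing: "directing_measure M G X \<alpha>"
    and regular: "\<And>k. 1 \<le> k \<Longrightarrow> regular_cond_distr M (G (k - 1)) (X k) (\<kappa> k)"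
begin

sublocale sub: finite_measure_subalgebra M "G n" for n
  using subalgebra by unfold_locales

lemma X_meas: "X (Suc n) \<in> borel_measurable (G (Suc n))"
  using cid by (simp add: cid_def)

lemma X_meas_M[measurable]: "X (Suc n) \<in> borel_measurable M"
  by (rule measurable_from_subalg[OF subalgebra X_meas])

lemma \<kappa>_meas: "\<kappa> (Suc k) \<in> G k \<rightarrow>\<^sub>M prob_algebra borel"
  using regular[of "Suc k"] by (simp add: regular_cond_distr_def)

lemma \<kappa>_meas_M[measurable]: "\<kappa> (Suc k) \<in> M \<rightarrow>\<^sub>M prob_algebra borel"
  by (rule measurable_from_subalg[OF subalgebra \<kappa>_meas])

lemma \<alpha>_meas[measurable]: "\<alpha> \<in> M \<rightarrow>\<^sub>M prob_algebra borel"
  using directing by (simp add: directing_measure_def)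

lemma \<alpha>_prob: "\<omega> \<in> space M \<Longrightarrow> real_distribution (\<alpha> \<omega>)"
  using measurable_space[OF \<alpha>_meas] unfolding real_distribution_def real_distribution_axioms_def
  by (auto simp: space_prob_algebra)

lemma \<kappa>_prob: "\<omega> \<in> space M \<Longrightarrow> real_distribution (\<kappa> (Suc k) \<omega>)"
  using measurable_space[OF \<kappa>_meas_M] unfolding real_distribution_def real_distribution_axioms_def
  by (auto simp: space_prob_algebra)

lemma integrable_X: "f \<in> borel_measurable borel \<Longrightarrow> (\<And>x. \<bar>f x\<bar> \<le> C) \<Longrightarrow> integrable M (\<lambda>\<omega>. f (X (Suc k) \<omega>))"
  for f :: "real \<Rightarrow> real"
  by (intro integrable_const_bound[where B=C]) auto

text \<open>The defining property at \<open>n = 0\<close> equates conditional expectations given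
  \<open>G 0\<close>; taking expectations removes the conditioning.\<close>

lemma identically_distributed:
  fixes f :: "real \<Rightarrow> real"
  assumes f: "f \<in> borel_measurable borel" "\<And>x. \<bar>f x\<bar> \<le> C"
  shows "expectation (\<lambda>\<omega>. f (X (Suc k) \<omega>)) = expectation (\<lambda>\<omega>. f (X 1 \<omega>))"
proof -
  have "bounded (range f)" using f(2) by (auto simp: bounded_iff)
  then have "AE \<omega> in M. real_cond_exp M (G 0) (\<lambda>\<omega>. f (X (Suc k) \<omega>)) \<omega> = real_cond_exp M (G 0) (\<lambda>\<omega>. f (X (Suc 0) \<omega>)) \<omega>"
    using cid f(1) unfolding cid_def by blast
  then have "expectation (real_cond_exp M (G 0) (\<lambda>\<omega>. f (X (Suc k) \<omega>))) = expectation (real_cond_exp M (G 0) (\<lambda>\<omega>. f (X (Suc 0) \<omega>)))"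
    by (intro integral_cong_AE) auto
  then show ?thesis
    using sub.real_cond_exp_int(2)[OF integrable_X[OF f]] by simp
qed

text \<open>The directing measure is accessible through continuous functions only, so the indicator
  of \<open>{..t}\<close> is bounded above by ramps \<open>f j\<close>. For the conditional laws
  this costs \<open>b j\<close> in mean, independently of \<open>k\<close> because the
  \<open>X k\<close> have the same law; under \<open>\<alpha>\<close> it costs \<open>a j\<close>.
  For a fixed ramp the conditional expectations converge by the definition of
  \<open>\<alpha>\<close>.\<close>

lemma conditional_cdf_tendsto:
  "(\<lambda>k. LINT \<omega>|M. \<bar>measure (\<kappa> (Suc k) \<omega>) {..t} - measure (\<alpha> \<omega>) {..t}\<bar>) \<longlonglongrightarrow> 0"
proof -
  define f where "f j = cts_step t (t + 1 / real (Suc j))" for j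
  let ?F = "\<lambda>j \<omega>. LINT x|\<alpha> \<omega>. f j x"
  let ?C = "\<lambda>j k. real_cond_exp M (G k) (\<lambda>\<omega>. f j (X (Suc k) \<omega>))"
  have fc: "continuous_on UNIV (f j)" for j
    unfolding f_def by (intro uniformly_continuous_imp_continuous cts_step_uniformly_continuous) simp
  then have fm[measurable]: "f j \<in> borel_measurable borel" for j
    by (rule borel_measurable_continuous_onI)
  have f01: "0 \<le> f j x" "f j x \<le> 1" "indicator {..t} x \<le> f j x" for j x
    unfolding f_def by (intro cts_step_bounds, simp)+
  have fabs: "\<bar>f j x\<bar> \<le> 1" for j x using f01(1,2)[of j x] by simp
  have flim: "(\<lambda>j. f j x) \<longlonglongrightarrow> indicator {..t} x" for x
  proof (cases "x \<le> t")
    case False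
    then have "(\<lambda>j. t + 1 / real (Suc j)) \<longlonglongrightarrow> t + 0" by (intro tendsto_intros LIMSEQ_Suc lim_1_over_n)
    then have "\<forall>\<^sub>F j in sequentially. t + 1 / real (Suc j) < x"
      using False by (intro order_tendstoD(2)) auto
    then have "\<forall>\<^sub>F j in sequentially. f j x = indicator {..t} x"
      by eventually_elim (use False in \<open>auto simp: f_def cts_step_def\<close>)
    then show ?thesis by (rule tendsto_eventually)
  qed (simp add: f_def cts_step_def)
  define b where "b j = expectation (\<lambda>\<omega>. f j (X 1 \<omega>)) - expectation (\<lambda>\<omega>. indicator {..t} (X 1 \<omega>))" for j
  define a where "a j = expectation (\<lambda>\<omega>. \<bar>?F j \<omega> - measure (\<alpha> \<omega>) {..t}\<bar>)" for j
  define e where "e j k = expectation (\<lambda>\<omega>. \<bar>?C j k \<omega> - ?F j \<omega>\<bar>)" for j k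
  have X1[measurable]: "X 1 \<in> borel_measurable M" using X_meas_M[of 0] by simp
  have "(\<lambda>j. expectation (\<lambda>\<omega>. f j (X 1 \<omega>))) \<longlonglongrightarrow> expectation (\<lambda>\<omega>. indicator {..t} (X 1 \<omega>))"
    by (rule integral_dominated_convergence[where w="\<lambda>_. 1"]) (auto simp: flim fabs)
  then have b: "b \<longlonglongrightarrow> 0" unfolding b_def by (simp add: LIM_zero)
  have \<alpha>m: "(\<lambda>\<omega>. ?F j \<omega>) \<in> borel_measurable M" "(\<lambda>\<omega>. measure (\<alpha> \<omega>) {..t}) \<in> borel_measurable M" for j
    using measurable_compose[OF measurable_prob_algebraD[OF \<alpha>_meas] integral_measurable_subprob_algebra[OF fm]]
      measurable_compose[OF \<alpha>_meas measurable_measure_prob_algebra] by auto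
  note [measurable] = \<alpha>m
  have \<alpha>01: "\<bar>?F j \<omega>\<bar> \<le> 1" "(\<lambda>j. ?F j \<omega>) \<longlonglongrightarrow> measure (\<alpha> \<omega>) {..t}"
    if "\<omega> \<in> space M" for j \<omega>
  proof -
    interpret A: real_distribution "\<alpha> \<omega>" by (rule \<alpha>_prob[OF that])
    have "norm (?F j \<omega>) \<le> (LINT x|\<alpha> \<omega>. 1)"
      using fabs by (intro norm_integral_le A.integrable_const_bound[where B=1]) auto
    then show "\<bar>?F j \<omega>\<bar> \<le> 1"
      using A.prob_space by simp
    have "(\<lambda>j. ?F j \<omega>) \<longlonglongrightarrow> (LINT x|\<alpha> \<omega>. indicator {..t} x)"
      by (rule integral_dominated_convergence[where w="\<lambda>_. 1"]) (auto simp: flim fabs)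
    then show "(\<lambda>j. ?F j \<omega>) \<longlonglongrightarrow> measure (\<alpha> \<omega>) {..t}" by simp
  qed
  have cdf1: "\<bar>measure (\<alpha> \<omega>) {..t}\<bar> \<le> 1" if "\<omega> \<in> space M" for \<omega>
    using prob_space.prob_le_1[of "\<alpha> \<omega>"] \<alpha>_prob[OF that] by (simp add: real_distribution_def)
  have "a \<longlonglongrightarrow> expectation (\<lambda>\<omega>. 0)"
    unfolding a_def
  proof (rule integral_dominated_convergence[where w="\<lambda>_. 2"])
    show "AE \<omega> in M. (\<lambda>j. \<bar>?F j \<omega> - measure (\<alpha> \<omega>) {..t}\<bar>) \<longlonglongrightarrow> 0"
      using \<alpha>01(2) by (intro AE_I2 tendsto_rabs_zero LIM_zero)
    show "AE \<omega> in M. norm \<bar>?F j \<omega> - measure (\<alpha> \<omega>) {..t}\<bar> \<le> 2" for j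
    proof (rule AE_I2)
      fix \<omega> assume "\<omega> \<in> space M"
      from \<alpha>01(1)[OF this, of j] cdf1[OF this]
      show "norm \<bar>?F j \<omega> - measure (\<alpha> \<omega>) {..t}\<bar> \<le> 2"
        unfolding real_norm_def by linarith
    qed
  qed auto
  then have a: "a \<longlonglongrightarrow> 0" by simp
  have ce01: "AE \<omega> in M. \<bar>?C j k \<omega>\<bar> \<le> 1" for j k
  proof -
    have "AE \<omega> in M. - 1 \<le> f j (X (Suc k) \<omega>)" "AE \<omega> in M. f j (X (Suc k) \<omega>) \<le> 1"
      using fabs by (auto simp: abs_le_iff minus_le_iff)
    from sub.real_cond_exp_ge_c[OF integrable_X[OF fm fabs] this(1)]
      sub.real_cond_exp_le_c[OF integrable_X[OF fm fabs] this(2)]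
    show ?thesis by eventually_elim (simp add: abs_le_iff)
  qed
  have e: "e j \<longlonglongrightarrow> 0" for j
  proof -
    have "e j \<longlonglongrightarrow> expectation (\<lambda>\<omega>. 0)"
      unfolding e_def
    proof (rule integral_dominated_convergence[where w="\<lambda>_. 2"])
      have "bounded (range (f j))" using fabs by (auto simp: bounded_iff)
      then have "AE \<omega> in M. (\<lambda>k. ?C j k \<omega>) \<longlonglongrightarrow> ?F j \<omega>"
        using directing fc unfolding directing_measure_def by blast
      then show "AE \<omega> in M. (\<lambda>k. \<bar>?C j k \<omega> - ?F j \<omega>\<bar>) \<longlonglongrightarrow> 0"
        by eventually_elim (intro tendsto_rabs_zero LIM_zero)
      show "AE \<omega> in M. norm \<bar>?C j k \<omega> - ?F j \<omega>\<bar> \<le> 2" for k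
        using ce01[of k j] AE_space
      proof eventually_elim
        case (elim \<omega>)
        then show ?case using \<alpha>01(1)[of \<omega> j] by simp
      qed
    qed auto
    then show ?thesis by simp
  qed
  have bd: "(LINT \<omega>|M. \<bar>measure (\<kappa> (Suc k) \<omega>) {..t} - measure (\<alpha> \<omega>) {..t}\<bar>) \<le> b j + e j k + a j" for j k
  proof -
    let ?c = "\<lambda>f. real_cond_exp M (G k) (\<lambda>\<omega>. f (X (Suc k) \<omega>))"
    let ?I = "indicator {..t} :: real \<Rightarrow> real"
    have iI: "integrable M (\<lambda>\<omega>. ?I (X (Suc k) \<omega>))" by (rule integrable_X[where C=1]) auto
    have iF: "integrable M (\<lambda>\<omega>. f j (X (Suc k) \<omega>))" by (rule integrable_X[where C=1]) (auto simp: fabs)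
    note ic = sub.real_cond_exp_int(1)[OF iI, of k] sub.real_cond_exp_int(1)[OF iF, of k]
    have \<kappa>e: "AE \<omega> in M. measure (\<kappa> (Suc k) \<omega>) {..t} = ?c ?I \<omega>"
      using regular[of "Suc k"] by (simp add: regular_cond_distr_def)
    \<comment> \<open>Since the ramp dominates the indicator, this difference needs no absolute
      value, and its mean is the difference of the means.\<close>
    have mono: "AE \<omega> in M. ?c ?I \<omega> \<le> ?c (f j) \<omega>"
      by (intro sub.real_cond_exp_mono iI iF AE_I2 f01)
    have i\<alpha>: "integrable M (\<lambda>\<omega>. ?F j \<omega>)" "integrable M (\<lambda>\<omega>. measure (\<alpha> \<omega>) {..t})"
      using \<alpha>01(1) cdf1 by (auto intro!: integrable_const_bound[where B=1])
    have "(LINT \<omega>|M. \<bar>measure (\<kappa> (Suc k) \<omega>) {..t} - measure (\<alpha> \<omega>) {..t}\<bar>)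
        \<le> (LINT \<omega>|M. (?c (f j) \<omega> - ?c ?I \<omega>) + \<bar>?c (f j) \<omega> - ?F j \<omega>\<bar>
            + \<bar>?F j \<omega> - measure (\<alpha> \<omega>) {..t}\<bar>)"
    proof (rule integral_mono_AE')
      show "AE \<omega> in M. \<bar>measure (\<kappa> (Suc k) \<omega>) {..t} - measure (\<alpha> \<omega>) {..t}\<bar>
        \<le> (?c (f j) \<omega> - ?c ?I \<omega>) + \<bar>?c (f j) \<omega> - ?F j \<omega>\<bar>
            + \<bar>?F j \<omega> - measure (\<alpha> \<omega>) {..t}\<bar>"
        using \<kappa>e mono by eventually_elim linarith
      show "integrable M (\<lambda>\<omega>. (?c (f j) \<omega> - ?c ?I \<omega>) + \<bar>?c (f j) \<omega> - ?F j \<omega>\<bar>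
            + \<bar>?F j \<omega> - measure (\<alpha> \<omega>) {..t}\<bar>)"
        using ic i\<alpha> by (intro Bochner_Integration.integrable_add Bochner_Integration.integrable_diff integrable_abs)
      show "AE \<omega> in M. 0 \<le> (?c (f j) \<omega> - ?c ?I \<omega>) + \<bar>?c (f j) \<omega> - ?F j \<omega>\<bar>
            + \<bar>?F j \<omega> - measure (\<alpha> \<omega>) {..t}\<bar>"
        using mono by eventually_elim linarith
    qed
    also have "\<dots> = (expectation (?c (f j)) - expectation (?c ?I)) + e j k + a j"
      unfolding e_def a_def using ic i\<alpha> by simp
    also have "expectation (?c (f j)) - expectation (?c ?I) = b j"
      unfolding sub.real_cond_exp_int(2)[OF iI] sub.real_cond_exp_int(2)[OF iF] b_def
      using identically_distributed[OF fm fabs, of j k] identically_distributed[of ?I 1 k] by simp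
    finally show ?thesis .
  qed
  show ?thesis
  proof (rule LIMSEQ_I)
    fix \<epsilon> :: real assume "\<epsilon> > 0"
    have "(\<lambda>j. b j + a j) \<longlonglongrightarrow> 0 + 0" by (intro tendsto_add a b)
    then have "\<forall>\<^sub>F j in sequentially. b j + a j < \<epsilon> / 2"
      using \<open>\<epsilon> > 0\<close> by (intro order_tendstoD(2)) auto
    \<comment> \<open>The ramp is fixed before \<open>k\<close> tends to infinity.\<close>
    then obtain j where j: "b j + a j < \<epsilon> / 2"
      using eventually_happens' sequentially_bot by blast
    obtain k0 where k0: "\<And>k. k \<ge> k0 \<Longrightarrow> \<bar>e j k\<bar> < \<epsilon> / 2"
      using LIMSEQ_D[OF e[of j], of "\<epsilon> / 2"] \<open>\<epsilon> > 0\<close> by auto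
    show "\<exists>k0. \<forall>k\<ge>k0. norm ((LINT \<omega>|M. \<bar>measure (\<kappa> (Suc k) \<omega>) {..t} - measure (\<alpha> \<omega>) {..t}\<bar>) - 0) < \<epsilon>"
    proof (intro exI[of _ k0] allI impI)
      fix k assume "k \<ge> k0"
      have "0 \<le> (LINT \<omega>|M. \<bar>measure (\<kappa> (Suc k) \<omega>) {..t} - measure (\<alpha> \<omega>) {..t}\<bar>)" by simp
      then show "norm ((LINT \<omega>|M. \<bar>measure (\<kappa> (Suc k) \<omega>) {..t} - measure (\<alpha> \<omega>) {..t}\<bar>) - 0) < \<epsilon>"
        using bd[of k j] k0[OF \<open>k \<ge> k0\<close>] j unfolding real_norm_def diff_0_right by linarith
    qed
  qed
qed

abbreviation (input) compensated :: "nat \<Rightarrow> real \<Rightarrow> 'a \<Rightarrow> real" where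
  "compensated k t \<omega> \<equiv> indicator {..t} (X (Suc k) \<omega>) - measure (\<kappa> (Suc k) \<omega>) {..t}"

text \<open>This turns the almost sure identity in the definition of a regular conditional
  distribution into the tested form required by the martingale locale.\<close>

lemma cond_indicator:
  assumes h: "h \<in> borel_measurable (G k)" "\<And>\<omega>. \<omega> \<in> space M \<Longrightarrow> \<bar>h \<omega>\<bar> \<le> C"
  shows "(LINT \<omega>|M. h \<omega> * indicator {..t} (X (Suc k) \<omega>)) = (LINT \<omega>|M. h \<omega> * measure (\<kappa> (Suc k) \<omega>) {..t})"
proof -
  have [measurable]: "h \<in> borel_measurable M" by (rule measurable_from_subalg[OF subalgebra h(1)])
  have int: "integrable M (\<lambda>\<omega>. h \<omega> * indicator {..t} (X (Suc k) \<omega>))"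
  proof (rule integrable_bounded)
    fix \<omega> assume "\<omega> \<in> space M"
    from h(2)[OF this] show "norm (h \<omega> * indicator {..t} (X (Suc k) \<omega>)) \<le> C"
      by (auto split: split_indicator)
  qed measurable
  have [measurable]: "(\<lambda>\<omega>. measure (\<kappa> (Suc k) \<omega>) {..t}) \<in> borel_measurable M"
    by (rule measurable_compose[OF \<kappa>_meas_M measurable_measure_prob_algebra]) simp
  have \<kappa>e: "AE \<omega> in M. measure (\<kappa> (Suc k) \<omega>) {..t} = real_cond_exp M (G k) (\<lambda>\<omega>. indicator {..t} (X (Suc k) \<omega>)) \<omega>"
    using regular[of "Suc k"] by (simp add: regular_cond_distr_def)
  have "(LINT \<omega>|M. h \<omega> * measure (\<kappa> (Suc k) \<omega>) {..t})
      = (LINT \<omega>|M. h \<omega> * real_cond_exp M (G k) (\<lambda>\<omega>. indicator {..t} (X (Suc k) \<omega>)) \<omega>)"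
    using \<kappa>e by (intro integral_cong_AE) auto
  also have "\<dots> = (LINT \<omega>|M. h \<omega> * indicator {..t} (X (Suc k) \<omega>))"
    by (rule sub.real_cond_exp_intg(2)[OF int h(1)]) simp
  finally show ?thesis ..
qed

text \<open>An instance of the mixed limit theorem. The point to check is the conditional
  covariance: a product of indicators of two half-lines is the indicator of the smaller one, which
  yields the bridge covariance \<open>min (p k i) (p k j) - p k i * p k j\<close>.\<close>

lemma compensated_sums_mixed_normal:
  "(\<lambda>n. LINT \<omega>|M. iexp (1 / sqrt n * (\<Sum>k<n. \<Sum>i<r. c i * compensated k (\<tau> i) \<omega>)))
    \<longlonglongrightarrow> (LINT \<omega>|M. bridge_char r c (\<lambda>i. measure (\<alpha> \<omega>) {..\<tau> i}))"
proof -
  define A where "A = (\<Sum>i<r. \<bar>c i\<bar>)"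
  \<comment> \<open>\<open>A\<close> bounds the differences and \<open>A\<^sup>2\<close> bounds both
    quadratic forms; the sum serves for all three.\<close>
  define K where "K = A + A\<^sup>2"
  have "A \<ge> 0" by (simp add: A_def sum_nonneg)
  then have K: "A \<le> K" "A\<^sup>2 \<le> K" by (auto simp: K_def)
  define I where "I k i \<omega> = (indicator {..\<tau> i} (X (Suc k) \<omega>) :: real)" for k i \<omega>
  define p where "p k i \<omega> = measure (\<kappa> (Suc k) \<omega>) {..\<tau> i}" for k i \<omega>
  define q where "q i \<omega> = measure (\<alpha> \<omega>) {..\<tau> i}" for i \<omega>
  have pG: "p k i \<in> borel_measurable (G k)" for k i
    unfolding p_def by (rule measurable_compose[OF \<kappa>_meas measurable_measure_prob_algebra]) simp
  have [measurable]: "p k i \<in> borel_measurable M" for k i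
    by (rule measurable_from_subalg[OF subalgebra pG])
  have IG: "I k i \<in> borel_measurable (G (Suc k))" for k i
    unfolding I_def by (rule measurable_compose[OF X_meas]) simp
  have [measurable]: "I k i \<in> borel_measurable M" for k i
    by (rule measurable_from_subalg[OF subalgebra IG])
  have [measurable]: "q i \<in> borel_measurable M" for i
    unfolding q_def by (rule measurable_compose[OF \<alpha>_meas measurable_measure_prob_algebra]) simp
  have p01: "0 \<le> p k i \<omega> \<and> p k i \<omega> \<le> 1" and q01: "0 \<le> q i \<omega> \<and> q i \<omega> \<le> 1" if "\<omega> \<in> space M" for k i \<omega>
    using prob_space.prob_le_1[of "\<alpha> \<omega>"] \<alpha>_prob[OF that] prob_space.prob_le_1[of "\<kappa> (Suc k) \<omega>"] \<kappa>_prob[OF that]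
    by (auto simp: real_distribution_def p_def q_def)
  have I01: "0 \<le> I k i \<omega> \<and> I k i \<omega> \<le> 1" for k i \<omega> by (simp add: I_def)
  have sub_G: "f \<in> borel_measurable (G k) \<Longrightarrow> f \<in> borel_measurable (G (Suc k))" for f :: "'a \<Rightarrow> real" and k
    using filtration.sets_F_mono[OF filtration, of k "Suc k"] filtration.space_F[OF filtration]
    by (intro measurable_from_subalg[of "G (Suc k)" "G k"]) (auto simp: subalgebra_def)
  define d where "d k \<omega> = (\<Sum>i<r. c i * (I k i \<omega> - p k i \<omega>))" for k \<omega>
  define v where "v k \<omega> = bridge_form r c (\<lambda>i. p k i \<omega>)" for k \<omega>
  define w where "w \<omega> = bridge_form r c (\<lambda>i. q i \<omega>)" for \<omega>
  have hint: "integrable M (\<lambda>\<omega>. h \<omega> * f \<omega>)"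
    if "h \<in> borel_measurable (G k)" "\<And>\<omega>. \<omega> \<in> space M \<Longrightarrow> \<bar>h \<omega>\<bar> \<le> C"
      "f \<in> borel_measurable M" "\<And>\<omega>. \<omega> \<in> space M \<Longrightarrow> 0 \<le> f \<omega> \<and> f \<omega> \<le> 1" for h f :: "'a \<Rightarrow> real" and k C
  proof (rule integrable_bounded)
    show "(\<lambda>\<omega>. h \<omega> * f \<omega>) \<in> borel_measurable M"
      using measurable_from_subalg[OF subalgebra that(1)] that(3) by measurable
    fix \<omega> assume "\<omega> \<in> space M"
    from that(2)[OF this] that(4)[OF this] have "\<bar>h \<omega>\<bar> * \<bar>f \<omega>\<bar> \<le> C * 1" by (intro mult_mono) auto
    then show "norm (h \<omega> * f \<omega>) \<le> C" by (simp add: abs_mult)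
  qed
  have cI: "(LINT \<omega>|M. h \<omega> * I k i \<omega>) = (LINT \<omega>|M. h \<omega> * p k i \<omega>)"
    if "h \<in> borel_measurable (G k)" "\<And>\<omega>. \<omega> \<in> space M \<Longrightarrow> \<bar>h \<omega>\<bar> \<le> C" for h :: "'a \<Rightarrow> real" and k C i
    unfolding I_def p_def by (rule cond_indicator[OF that])
  interpret D: bounded_martingale_differences M G d v w K
  proof
    show "d k \<in> borel_measurable (G (Suc k))" for k
      using IG sub_G[OF pG] unfolding d_def by measurable
    show "v k \<in> borel_measurable (G k)" for k
      using pG unfolding v_def bridge_form_def by measurable
    show "w \<in> borel_measurable M"
      unfolding w_def bridge_form_def by measurable
    show "\<bar>d k \<omega>\<bar> \<le> K" if "\<omega> \<in> space M" for k \<omega>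
    proof -
      have "\<bar>d k \<omega>\<bar> \<le> (\<Sum>i<r. \<bar>c i\<bar> * \<bar>I k i \<omega> - p k i \<omega>\<bar>)"
        unfolding d_def by (rule order_trans[OF sum_abs]) (simp add: abs_mult)
      also have "\<dots> \<le> A"
        unfolding A_def
      proof (rule sum_mono)
        fix i
        have "\<bar>I k i \<omega> - p k i \<omega>\<bar> \<le> 1" using I01[of k i \<omega>] p01[OF that, of k i] by linarith
        then show "\<bar>c i\<bar> * \<bar>I k i \<omega> - p k i \<omega>\<bar> \<le> \<bar>c i\<bar>" by (rule mult_left_le) simp
      qed
      finally show ?thesis using K by linarith
    qed
    show "\<bar>v k \<omega>\<bar> \<le> K" "\<bar>w \<omega>\<bar> \<le> K" if "\<omega> \<in> space M" for k \<omega>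
      using bridge_form_bound[of r "\<lambda>i. p k i \<omega>" c] bridge_form_bound[of r "\<lambda>i. q i \<omega>" c] p01[OF that] q01[OF that] K
      unfolding v_def w_def A_def by (meson order_trans)+
    fix k C and h :: "'a \<Rightarrow> real" assume h: "h \<in> borel_measurable (G k)" "\<And>\<omega>. \<omega> \<in> space M \<Longrightarrow> \<bar>h \<omega>\<bar> \<le> C"
    have int: "integrable M (\<lambda>\<omega>. h \<omega> * I k i \<omega>)" "integrable M (\<lambda>\<omega>. h \<omega> * p k i \<omega>)" for i
      using hint[OF h, of "I k i"] hint[OF h, of "p k i"] I01 p01 by auto
    have "(LINT \<omega>|M. h \<omega> * d k \<omega>) = (LINT \<omega>|M. (\<Sum>i<r. c i * (h \<omega> * I k i \<omega> - h \<omega> * p k i \<omega>)))"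
      unfolding d_def by (simp add: sum_distrib_left algebra_simps)
    also have "\<dots> = (\<Sum>i<r. c i * ((LINT \<omega>|M. h \<omega> * I k i \<omega>) - (LINT \<omega>|M. h \<omega> * p k i \<omega>)))"
      using int by (simp add: Bochner_Integration.integral_sum)
    also have "\<dots> = 0" using cI[OF h] by simp
    finally show "(LINT \<omega>|M. h \<omega> * d k \<omega>) = 0" .
    have prod: "(LINT \<omega>|M. h \<omega> * ((I k i \<omega> - p k i \<omega>) * (I k j \<omega> - p k j \<omega>)))
        = (LINT \<omega>|M. h \<omega> * (min (p k i \<omega>) (p k j \<omega>) - p k i \<omega> * p k j \<omega>))"
      and prod_int: "integrable M (\<lambda>\<omega>. h \<omega> * ((I k i \<omega> - p k i \<omega>) * (I k j \<omega> - p k j \<omega>)))"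
        "integrable M (\<lambda>\<omega>. h \<omega> * (min (p k i \<omega>) (p k j \<omega>) - p k i \<omega> * p k j \<omega>))" for i j
    proof -
      \<comment> \<open>The smaller of the two thresholds is again one of the \<open>\<tau>\<close>,
        so the product of the indicators is \<open>I k l\<close>.\<close>
      obtain l where l: "\<tau> l = min (\<tau> i) (\<tau> j)" by (metis min_def)
      have Il: "I k i \<omega> * I k j \<omega> = I k l \<omega>" for \<omega>
        by (simp add: I_def l split: split_indicator)
      have pl: "min (p k i \<omega>) (p k j \<omega>) = p k l \<omega>" if "\<omega> \<in> space M" for \<omega>
      proof -
        interpret P: real_distribution "\<kappa> (Suc k) \<omega>" by (rule \<kappa>_prob[OF that])
        have "measure (\<kappa> (Suc k) \<omega>) {..x} \<le> measure (\<kappa> (Suc k) \<omega>) {..y}" if "x \<le> y" for x y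
          using that by (intro P.finite_measure_mono) auto
        from this[of "\<tau> i" "\<tau> j"] this[of "\<tau> j" "\<tau> i"] show ?thesis
          unfolding p_def l by (auto simp: min_def)
      qed
      \<comment> \<open>The factor \<open>p k i\<close> is known at time \<open>k\<close> and can be
        absorbed into the test function.\<close>
      have hp: "(\<lambda>\<omega>. h \<omega> * p k i \<omega>) \<in> borel_measurable (G k)" for i
        using h(1) pG by measurable
      have hpb: "\<bar>h \<omega> * p k i \<omega>\<bar> \<le> C" if "\<omega> \<in> space M" for i \<omega>
        using mult_mono[of "\<bar>h \<omega>\<bar>" C "\<bar>p k i \<omega>\<bar>" 1] h(2)[OF that] p01[OF that, of k i] by (auto simp: abs_mult)
      have i1: "integrable M (\<lambda>\<omega>. (h \<omega> * p k i \<omega>) * I k j \<omega>)" for i j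
        using hint[OF hp hpb, of "I k j"] I01 by auto
      have i2: "integrable M (\<lambda>\<omega>. (h \<omega> * p k i \<omega>) * p k j \<omega>)" for i j
        using hint[OF hp hpb, of "p k j"] p01 by auto
      have e: "h \<omega> * ((I k i \<omega> - p k i \<omega>) * (I k j \<omega> - p k j \<omega>))
          = h \<omega> * I k l \<omega> - (h \<omega> * p k i \<omega>) * I k j \<omega> - (h \<omega> * p k j \<omega>) * I k i \<omega> + (h \<omega> * p k i \<omega>) * p k j \<omega>" for \<omega>
        unfolding Il[symmetric] by (simp add: algebra_simps)
      have e': "h \<omega> * (min (p k i \<omega>) (p k j \<omega>) - p k i \<omega> * p k j \<omega>) = h \<omega> * p k l \<omega> - (h \<omega> * p k i \<omega>) * p k j \<omega>"
        if "\<omega> \<in> space M" for \<omega>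
        unfolding pl[OF that] by (simp add: algebra_simps)
      show "integrable M (\<lambda>\<omega>. h \<omega> * ((I k i \<omega> - p k i \<omega>) * (I k j \<omega> - p k j \<omega>)))"
        unfolding e using int i1 i2 by simp
      show "integrable M (\<lambda>\<omega>. h \<omega> * (min (p k i \<omega>) (p k j \<omega>) - p k i \<omega> * p k j \<omega>))"
        using int(2)[of l] i2[of i j] by (subst Bochner_Integration.integrable_cong[OF refl e']) auto
      have "(LINT \<omega>|M. h \<omega> * ((I k i \<omega> - p k i \<omega>) * (I k j \<omega> - p k j \<omega>)))
          = (LINT \<omega>|M. h \<omega> * I k l \<omega>) - (LINT \<omega>|M. (h \<omega> * p k i \<omega>) * I k j \<omega>)
            - (LINT \<omega>|M. (h \<omega> * p k j \<omega>) * I k i \<omega>) + (LINT \<omega>|M. (h \<omega> * p k i \<omega>) * p k j \<omega>)"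
        unfolding e using int i1 i2 by simp
      also have "\<dots> = (LINT \<omega>|M. h \<omega> * p k l \<omega>) - (LINT \<omega>|M. (h \<omega> * p k i \<omega>) * p k j \<omega>)"
      proof -
        have "(LINT \<omega>|M. (h \<omega> * p k j \<omega>) * p k i \<omega>) = (LINT \<omega>|M. (h \<omega> * p k i \<omega>) * p k j \<omega>)"
          by (simp add: ac_simps)
        with cI[OF h, of l] cI[OF hp hpb, of i j] cI[OF hp hpb, of j i] show ?thesis by linarith
      qed
      also have "\<dots> = (LINT \<omega>|M. h \<omega> * (min (p k i \<omega>) (p k j \<omega>) - p k i \<omega> * p k j \<omega>))"
        using int(2)[of l] i2[of i j] by (subst Bochner_Integration.integral_cong[OF refl e']) auto
      finally show "(LINT \<omega>|M. h \<omega> * ((I k i \<omega> - p k i \<omega>) * (I k j \<omega> - p k j \<omega>)))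
        = (LINT \<omega>|M. h \<omega> * (min (p k i \<omega>) (p k j \<omega>) - p k i \<omega> * p k j \<omega>))" .
    qed
    have "h \<omega> * (d k \<omega>)\<^sup>2 = (\<Sum>i<r. \<Sum>j<r. c i * c j * (h \<omega> * ((I k i \<omega> - p k i \<omega>) * (I k j \<omega> - p k j \<omega>))))" for \<omega>
      unfolding d_def power2_eq_square sum_product by (simp add: sum_distrib_left algebra_simps)
    moreover have "h \<omega> * v k \<omega> = (\<Sum>i<r. \<Sum>j<r. c i * c j * (h \<omega> * (min (p k i \<omega>) (p k j \<omega>) - p k i \<omega> * p k j \<omega>)))" for \<omega>
      unfolding v_def bridge_form_def by (simp add: sum_distrib_left algebra_simps)
    ultimately show "(LINT \<omega>|M. h \<omega> * (d k \<omega>)\<^sup>2) = (LINT \<omega>|M. h \<omega> * v k \<omega>)"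
      using prod prod_int by (simp add: Bochner_Integration.integral_sum)
  next
    show "(\<lambda>k. LINT \<omega>|M. \<bar>v k \<omega> - w \<omega>\<bar>) \<longlonglongrightarrow> 0"
    proof (rule tendsto_sandwich[OF _ _ tendsto_const])
      have ip: "integrable M (\<lambda>\<omega>. \<bar>p k i \<omega> - q i \<omega>\<bar>)" for k i
      proof (rule integrable_bounded)
        fix \<omega> assume "\<omega> \<in> space M"
        from p01[OF this, of k i] q01[OF this, of i] show "norm \<bar>p k i \<omega> - q i \<omega>\<bar> \<le> 1" by (simp add: abs_le_iff)
      qed measurable
      let ?R = "\<lambda>k. \<Sum>i<r. \<Sum>j<r. \<bar>c i\<bar> * \<bar>c j\<bar> * (2 * ((LINT \<omega>|M. \<bar>p k i \<omega> - q i \<omega>\<bar>) + (LINT \<omega>|M. \<bar>p k j \<omega> - q j \<omega>\<bar>)))"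
      have "(\<lambda>k. LINT \<omega>|M. \<bar>p k i \<omega> - q i \<omega>\<bar>) \<longlonglongrightarrow> 0" for i
        unfolding p_def q_def by (rule conditional_cdf_tendsto)
      then show "?R \<longlonglongrightarrow> 0"
        by (intro tendsto_null_sum tendsto_mult_right_zero tendsto_add_zero)
      show "\<forall>\<^sub>F k in sequentially. (LINT \<omega>|M. \<bar>v k \<omega> - w \<omega>\<bar>) \<le> ?R k"
      proof (intro always_eventually allI)
        fix k
        have "(LINT \<omega>|M. \<bar>v k \<omega> - w \<omega>\<bar>) \<le> (LINT \<omega>|M. (\<Sum>i<r. \<Sum>j<r. \<bar>c i\<bar> * \<bar>c j\<bar> * (2 * (\<bar>p k i \<omega> - q i \<omega>\<bar> + \<bar>p k j \<omega> - q j \<omega>\<bar>))))"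
        proof (rule integral_mono')
          show "integrable M (\<lambda>\<omega>. \<Sum>i<r. \<Sum>j<r. \<bar>c i\<bar> * \<bar>c j\<bar> * (2 * (\<bar>p k i \<omega> - q i \<omega>\<bar> + \<bar>p k j \<omega> - q j \<omega>\<bar>)))"
            using ip by simp
          show "\<bar>v k \<omega> - w \<omega>\<bar> \<le> (\<Sum>i<r. \<Sum>j<r. \<bar>c i\<bar> * \<bar>c j\<bar> * (2 * (\<bar>p k i \<omega> - q i \<omega>\<bar> + \<bar>p k j \<omega> - q j \<omega>\<bar>)))"
            if "\<omega> \<in> space M" for \<omega>
            unfolding v_def w_def using p01[OF that] q01[OF that] by (intro bridge_form_diff) auto
        qed (auto intro!: sum_nonneg)
        also have "\<dots> = ?R k"
          using ip by (simp add: Bochner_Integration.integral_sum)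
        finally show "(LINT \<omega>|M. \<bar>v k \<omega> - w \<omega>\<bar>) \<le> ?R k" .
      qed
    qed simp
  qed (use subalgebra filtration.space_F[OF filtration] filtration.sets_F_mono[OF filtration] in blast)+
  show ?thesis
    using D.mixed_normal_limit unfolding d_def w_def I_def p_def q_def .
qed

end

section \<open>Time-changed Brownian bridges\<close>

lemma normal_law_moments:
  assumes "0 \<le> \<sigma>"
  shows "integrable (normal_law m \<sigma>) (\<lambda>x. x)" "integrable (normal_law m \<sigma>) (\<lambda>x. x\<^sup>2)"
    and "(LINT x|normal_law m \<sigma>. x) = m" "(LINT x|normal_law m \<sigma>. x\<^sup>2) = m\<^sup>2 + \<sigma>\<^sup>2"
    and "(LINT x|normal_law m \<sigma>. iexp x) = iexp m * of_real (exp (- \<sigma>\<^sup>2 / 2))"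
proof -
  have "integrable (normal_law m \<sigma>) (\<lambda>x. x) \<and> integrable (normal_law m \<sigma>) (\<lambda>x. x\<^sup>2) \<and>
    (LINT x|normal_law m \<sigma>. x) = m \<and> (LINT x|normal_law m \<sigma>. x\<^sup>2) = m\<^sup>2 + \<sigma>\<^sup>2 \<and>
    (LINT x|normal_law m \<sigma>. iexp x) = iexp m * of_real (exp (- \<sigma>\<^sup>2 / 2))"
  proof (cases "\<sigma> = 0")
    case True
    have i: "integrable (return borel m) f" if "f \<in> borel_measurable borel" for f :: "real \<Rightarrow> real"
      using that by (intro integrableI_bounded) (auto simp: nn_integral_return)
    have "integrable (return borel m) (\<lambda>x. x)" "integrable (return borel m) (\<lambda>x. x\<^sup>2)"
      by (intro i, measurable)+
    moreover have "(LINT x|return borel m. x) = m" "(LINT x|return borel m. x\<^sup>2) = m\<^sup>2"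
      "(LINT x|return borel m. iexp x) = iexp m"
      by (subst integral_return; simp)+
    moreover have "normal_law m \<sigma> = return borel m"
      using True by (simp add: normal_law_def)
    ultimately show ?thesis
      using True by (simp only: power_zero_numeral) simp
  next
    case False
    with assms have s: "\<sigma> > 0" by simp
    define D where "D = density lborel (\<lambda>x. ennreal (normal_density m \<sigma> x))"
    have D: "normal_law m \<sigma> = D" using False by (simp add: normal_law_def D_def)
    interpret D: prob_space D unfolding D_def using s by (rule prob_space_normal_density)
    have [measurable_cong]: "sets D = sets borel" by (simp add: D_def)
    have i1: "integrable D (\<lambda>x. x)"
      using integrable_normal_moment_nz_1[OF s, of m] by (simp add: D_def integrable_density)
    have i2: "integrable D (\<lambda>x. (x - m)\<^sup>2)"
      using integrable_normal_moment[OF s, of m 2] by (simp add: D_def integrable_density)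
    have e1: "(LINT x|D. x) = m"
      using integral_normal_moment_nz_1[OF s, of m] by (simp add: D_def integral_density)
    have e2: "(LINT x|D. (x - m)\<^sup>2) = \<sigma>\<^sup>2"
      using integral_normal_moment_even[OF s, of m 1] by (simp add: D_def integral_density)
    have eq: "(\<lambda>x::real. x\<^sup>2) = (\<lambda>x. (x - m)\<^sup>2 + 2 * m * x - m\<^sup>2)"
      by (simp add: fun_eq_iff power2_eq_square algebra_simps)
    have i3: "integrable D (\<lambda>x. x\<^sup>2)"
      using i1 i2 by (subst eq) simp
    have "(LINT x|D. x\<^sup>2) = \<sigma>\<^sup>2 + 2 * m * m - m\<^sup>2"
      using i1 i2 e1 e2 D.prob_space by (subst eq) simp
    then have e3: "(LINT x|D. x\<^sup>2) = m\<^sup>2 + \<sigma>\<^sup>2" by (simp add: power2_eq_square)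
    have "distributed D lborel (\<lambda>x. x) (normal_density m \<sigma>)"
      unfolding distributed_def using distr_id[of D] by (simp add: D_def distr_id2)
    then have "distributed D lborel (\<lambda>x. (x - m) / \<sigma>) std_normal_density"
      using D.normal_standard_normal_convert[OF s] by simp
    then have d: "distr D lborel (\<lambda>x. (x - m) / \<sigma>) = std_normal_distribution"
      by (simp add: distributed_def)
    have "(LINT x|D. iexp x) = (LINT x|D. iexp m * iexp (\<sigma> * ((x - m) / \<sigma>)))"
    proof (intro Bochner_Integration.integral_cong refl)
      fix x
      have "iexp x = iexp (m + \<sigma> * ((x - m) / \<sigma>))" using s by simp
      then show "iexp x = iexp m * iexp (\<sigma> * ((x - m) / \<sigma>))"
        by (simp only: of_real_add distrib_left exp_add)
    qed
    also have "\<dots> = iexp m * (LINT x|D. iexp (\<sigma> * ((x - m) / \<sigma>)))"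
      by simp
    also have "(LINT x|D. iexp (\<sigma> * ((x - m) / \<sigma>))) = (\<integral>y. iexp (\<sigma> * y) \<partial>distr D lborel (\<lambda>x. (x - m) / \<sigma>))"
      by (subst integral_distr) auto
    also have "\<dots> = of_real (exp (- \<sigma>\<^sup>2 / 2))"
      unfolding d using char_std_normal_distribution by (simp add: char_def fun_eq_iff)
    finally show ?thesis unfolding D using i1 i3 e1 e3 by simp
  qed
  then show "integrable (normal_law m \<sigma>) (\<lambda>x. x)" "integrable (normal_law m \<sigma>) (\<lambda>x. x\<^sup>2)"
    "(LINT x|normal_law m \<sigma>. x) = m" "(LINT x|normal_law m \<sigma>. x\<^sup>2) = m\<^sup>2 + \<sigma>\<^sup>2"
    "(LINT x|normal_law m \<sigma>. iexp x) = iexp m * of_real (exp (- \<sigma>\<^sup>2 / 2))" by auto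
qed

text \<open>\<open>gaussian_process\<close> says that a linear combination is normal with
  unspecified parameters; they are identified by computing its first two moments from the covariance
  of the bridge. The transform at frequency 1 is enough, as the coefficients carry the
  frequency.\<close>

lemma brownian_bridge_char:
  assumes "prob_space N" and W: "brownian_bridge N W" and u: "\<And>i. i < r \<Longrightarrow> u i \<in> {0..1}"
  shows "(LINT \<omega>|N. iexp (\<Sum>i<r. c i * W (u i) \<omega>)) = bridge_char r c u"
proof -
  interpret prob_space N by fact
  have gauss: "gaussian_process N {0..1} W"
    and mean: "\<And>u. u \<in> {0..1} \<Longrightarrow> (LINT \<omega>|N. W u \<omega>) = 0"
    and cov: "\<And>u v. u \<in> {0..1} \<Longrightarrow> v \<in> {0..1} \<Longrightarrow> (LINT \<omega>|N. W u \<omega> * W v \<omega>) = min u v - u * v"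
    using W by (auto simp: brownian_bridge_def)
  have Wm: "W u \<in> borel_measurable N" if "u \<in> {0..1}" for u
    using gauss that by (simp add: gaussian_process_def)
  have law: "\<exists>m \<sigma>. 0 \<le> \<sigma> \<and> distr N borel (\<lambda>\<omega>. \<Sum>u\<in>J. b u * W u \<omega>) = normal_law m \<sigma>"
    if "finite J" "J \<subseteq> {0..1}" for J b
    using gauss that by (simp add: gaussian_process_def)
  have W2: "integrable N (\<lambda>\<omega>. W u \<omega>)" "integrable N (\<lambda>\<omega>. (W u \<omega>)\<^sup>2)" if "u \<in> {0..1}" for u
  proof -
    obtain m \<sigma> where "0 \<le> \<sigma>" and d: "distr N borel (W u) = normal_law m \<sigma>"
      using law[of "{u}" "\<lambda>_. 1"] \<open>u \<in> {0..1}\<close> by auto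
    from normal_law_moments(1,2)[OF this(1), of m]
    show "integrable N (\<lambda>\<omega>. W u \<omega>)" "integrable N (\<lambda>\<omega>. (W u \<omega>)\<^sup>2)"
      unfolding d[symmetric] using Wm[OF that] by (simp_all add: integrable_distr_eq)
  qed
  have WW: "integrable N (\<lambda>\<omega>. W u \<omega> * W v \<omega>)" if uv: "u \<in> {0..1}" "v \<in> {0..1}" for u v
  proof (rule Bochner_Integration.integrable_bound)
    show "integrable N (\<lambda>\<omega>. (W u \<omega>)\<^sup>2 + (W v \<omega>)\<^sup>2)"
      using W2 uv by simp
    show "(\<lambda>\<omega>. W u \<omega> * W v \<omega>) \<in> borel_measurable N"
      using Wm uv by simp
    show "AE \<omega> in N. norm (W u \<omega> * W v \<omega>) \<le> norm ((W u \<omega>)\<^sup>2 + (W v \<omega>)\<^sup>2)"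
    proof (intro AE_I2)
      fix \<omega>
      have "2 * \<bar>W u \<omega>\<bar> * \<bar>W v \<omega>\<bar> \<le> \<bar>W u \<omega>\<bar>\<^sup>2 + \<bar>W v \<omega>\<bar>\<^sup>2" by (rule sum_squares_bound)
      moreover have "0 \<le> \<bar>W u \<omega>\<bar> * \<bar>W v \<omega>\<bar>" by simp
      ultimately show "norm (W u \<omega> * W v \<omega>) \<le> norm ((W u \<omega>)\<^sup>2 + (W v \<omega>)\<^sup>2)"
        unfolding real_norm_def abs_mult power2_abs by linarith
    qed
  qed
  define S where "S \<omega> = (\<Sum>i<r. c i * W (u i) \<omega>)" for \<omega>
  have Sm: "S \<in> borel_measurable N"
    unfolding S_def using Wm[OF u] by (intro borel_measurable_sum borel_measurable_times) auto
  \<comment> \<open>The definition of a Gaussian process sums over a set of times, so indices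
    sharing the same \<open>u i\<close> are merged and their coefficients added.\<close>
  define b where "b v = (\<Sum>i | i \<in> {..<r} \<and> u i = v. c i)" for v
  have "S \<omega> = (\<Sum>v\<in>u ` {..<r}. b v * W v \<omega>)" for \<omega>
  proof -
    have "S \<omega> = (\<Sum>v\<in>u ` {..<r}. \<Sum>i | i \<in> {..<r} \<and> u i = v. c i * W (u i) \<omega>)"
      unfolding S_def by (rule sum.image_gen) simp
    also have "\<dots> = (\<Sum>v\<in>u ` {..<r}. b v * W v \<omega>)"
      unfolding b_def sum_distrib_right by (intro sum.cong refl) simp
    finally show ?thesis .
  qed
  then have "S = (\<lambda>\<omega>. \<Sum>v\<in>u ` {..<r}. b v * W v \<omega>)" by blast
  moreover have "u ` {..<r} \<subseteq> {0..1}" using u by blast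
  ultimately obtain m \<sigma> where s: "0 \<le> \<sigma>" and d: "distr N borel S = normal_law m \<sigma>"
    using law[of "u ` {..<r}" b] by auto
  have "m = (LINT \<omega>|N. S \<omega>)"
    using normal_law_moments(3)[OF s, of m] Sm unfolding d[symmetric] by (simp add: integral_distr)
  also have "\<dots> = (\<Sum>i<r. c i * (LINT \<omega>|N. W (u i) \<omega>))"
    unfolding S_def using W2(1)[OF u] by (subst Bochner_Integration.integral_sum) auto
  also have "\<dots> = 0" using mean[OF u] by simp
  finally have m: "m = 0" .
  have "m\<^sup>2 + \<sigma>\<^sup>2 = (LINT \<omega>|N. (S \<omega>)\<^sup>2)"
    using normal_law_moments(4)[OF s, of m] Sm unfolding d[symmetric] by (simp add: integral_distr)
  also have "\<dots> = (LINT \<omega>|N. (\<Sum>i<r. \<Sum>j<r. c i * c j * (W (u i) \<omega> * W (u j) \<omega>)))"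
    unfolding S_def power2_eq_square sum_product by (simp add: ac_simps)
  also have "\<dots> = (\<Sum>i<r. \<Sum>j<r. c i * c j * (LINT \<omega>|N. W (u i) \<omega> * W (u j) \<omega>))"
  proof (subst Bochner_Integration.integral_sum)
    show "(\<Sum>i<r. LINT \<omega>|N. (\<Sum>j<r. c i * c j * (W (u i) \<omega> * W (u j) \<omega>)))
        = (\<Sum>i<r. \<Sum>j<r. c i * c j * (LINT \<omega>|N. W (u i) \<omega> * W (u j) \<omega>))"
      using WW[OF u u] by (intro sum.cong refl, subst Bochner_Integration.integral_sum) auto
  qed (use WW[OF u u] in auto)
  also have "\<dots> = bridge_form r c u"
    unfolding bridge_form_def using cov[OF u u] by (intro sum.cong refl) auto
  finally have "\<sigma>\<^sup>2 = bridge_form r c u" using m by simp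
  moreover have "(LINT \<omega>|N. iexp (S \<omega>)) = (LINT x|distr N borel S. iexp x)"
    using Sm by (simp add: integral_distr)
  ultimately show ?thesis
    using normal_law_moments(5)[OF s, of m] unfolding d[symmetric] by (simp add: S_def m)
qed

text \<open>
  Evaluating a path at a random time is not measurable for the product \<open>\<sigma>\<close>-algebra, hence the random
  times are first rounded to a grid. The clamping to \<open>[0, 1]\<close> is idle for values in \<open>[0, 1]\<close>.
\<close>

definition grid_point :: "nat \<Rightarrow> int \<Rightarrow> real" where
  "grid_point k j = max 0 (min 1 (real_of_int j / real (Suc k)))"

abbreviation (input) rounded :: "nat \<Rightarrow> real \<Rightarrow> real" where
  "rounded k x \<equiv> grid_point k \<lfloor>real (Suc k) * x\<rfloor>"

lemma grid_point_range: "grid_point k j \<in> {0..1}"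
  by (simp add: grid_point_def)

lemma grid_point_tendsto:
  assumes "x \<in> {0..1}"
  shows "(\<lambda>k. rounded k x) \<longlonglongrightarrow> x"
proof -
  have "\<bar>rounded k x - x\<bar> \<le> 1 / real (Suc k)" for k
  proof -
    define y where "y = real_of_int \<lfloor>real (Suc k) * x\<rfloor> / real (Suc k)"
    have "y \<le> x" by (simp add: y_def divide_le_eq mult.commute)
    moreover have "x - 1 / real (Suc k) \<le> y"
    proof -
      have "real (Suc k) * x - 1 \<le> real_of_int \<lfloor>real (Suc k) * x\<rfloor>" by linarith
      then have "(real (Suc k) * x - 1) / real (Suc k) \<le> y"
        unfolding y_def by (intro divide_right_mono) auto
      then show ?thesis by (simp add: diff_divide_distrib)
    qed
    moreover have "0 \<le> y" using assms by (simp add: y_def)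
    ultimately show ?thesis
      using assms unfolding grid_point_def y_def[symmetric] by auto
  qed
  then have "(\<lambda>k. rounded k x - x) \<longlonglongrightarrow> 0"
    by (intro Lim_null_comparison[OF _ LIMSEQ_Suc[OF lim_1_over_n]]) auto
  then show ?thesis by (rule LIM_zero_cancel)
qed

lemma grid_point_measurable: "(\<lambda>x. rounded k x) \<in> borel_measurable borel"
  unfolding grid_point_def by measurable

lemma bridge_form_measurable:
  assumes "\<And>i. (\<lambda>x. u x i) \<in> borel_measurable M"
  shows "(\<lambda>x. bridge_form r c (u x)) \<in> borel_measurable M"
  unfolding bridge_form_def
  by (intro borel_measurable_sum borel_measurable_times borel_measurable_diff borel_measurable_min
      borel_measurable_const assms)

lemma distribution_function_range:
  assumes "distribution_function F"
  shows "F t \<in> {0..1}"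
proof -
  have m: "mono F" and b: "(F \<longlongrightarrow> 0) at_bot" and t: "(F \<longlongrightarrow> 1) at_top"
    using assms by (auto simp: distribution_function_def)
  have "0 \<le> F t"
    by (rule tendsto_upperbound[OF b]) (auto intro: eventually_mono[OF eventually_le_at_bot[of t]] monoD[OF m])
  moreover have "F t \<le> 1"
    by (rule tendsto_lowerbound[OF t]) (auto intro: eventually_mono[OF eventually_ge_at_top[of t]] monoD[OF m])
  ultimately show ?thesis by simp
qed

locale bridge_time_change = prob_space N for N :: "'b measure" +
  fixes W :: "real \<Rightarrow> 'b \<Rightarrow> real" and F :: "'b \<Rightarrow> real \<Rightarrow> real"
  assumes bridge: "brownian_bridge N W"
    and df: "\<And>\<omega>. \<omega> \<in> space N \<Longrightarrow> distribution_function (F \<omega>)"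
    and indep: "indep_var (\<Pi>\<^sub>M u\<in>{0..1}. borel) (\<lambda>\<omega>. \<lambda>u\<in>{0..1}. W u \<omega>) (\<Pi>\<^sub>M t\<in>UNIV. borel) F"
begin

lemma W_meas: "u \<in> {0..1} \<Longrightarrow> W u \<in> borel_measurable N"
  using bridge by (simp add: brownian_bridge_def gaussian_process_def)

lemma F_meas[measurable]: "(\<lambda>\<omega>. F \<omega> t) \<in> borel_measurable N"
  using measurable_compose[OF indep_var_rv2[OF indep] measurable_component_singleton[of t UNIV]] by simp

lemma F_range: "\<omega> \<in> space N \<Longrightarrow> F \<omega> t \<in> {0..1}"
  using distribution_function_range[OF df] .

definition W_grid :: "nat \<Rightarrow> real \<Rightarrow> 'b \<Rightarrow> real" where
  "W_grid k t \<omega> = W (rounded k (F \<omega> t)) \<omega>"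

text \<open>The rounded time is determined by an integer, so the composition is glued from countably
  many variables \<open>W\<close> at deterministic times.\<close>

lemma W_grid_meas[measurable]: "W_grid k t \<in> borel_measurable N"
proof -
  have "(\<lambda>\<omega>. W (grid_point k (\<lfloor>real (Suc k) * F \<omega> t\<rfloor>)) \<omega>) \<in> borel_measurable N"
    by (rule measurable_compose_countable[where f="\<lambda>j. W (grid_point k j)"])
       (auto intro: W_meas grid_point_range)
  then show ?thesis by (simp add: W_grid_def[abs_def])
qed

lemma W_grid_tendsto:
  assumes "continuous_on {0..1} (\<lambda>u. W u \<omega>)" "\<omega> \<in> space N"
  shows "(\<lambda>k. W_grid k t \<omega>) \<longlonglongrightarrow> W (F \<omega> t) \<omega>"
  unfolding W_grid_def
  using continuous_on_tendsto_compose[OF assms(1) grid_point_tendsto[OF F_range[OF assms(2)]] F_range[OF assms(2)]]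
    grid_point_range by simp

text \<open>Independence makes the joint law of bridge and time change a product, and Fubini's
  theorem integrates the bridge out at frozen times.\<close>

lemma W_grid_char:
  "(LINT \<omega>|N. iexp (\<Sum>i<r. c i * W_grid k (\<tau> i) \<omega>))
    = (LINT \<omega>|N. bridge_char r c (\<lambda>i. rounded k (F \<omega> (\<tau> i))))"
proof -
  let ?S = "\<Pi>\<^sub>M u\<in>{0..1::real}. borel :: real measure" and ?T = "\<Pi>\<^sub>M t\<in>(UNIV::real set). borel :: real measure"
  let ?w = "\<lambda>\<omega>. \<lambda>u\<in>{0..1}. W u \<omega>"
  note rv = indep_var_rv1[OF indep] indep_var_rv2[OF indep]
  have joint: "distr N ?S ?w \<Otimes>\<^sub>M distr N ?T F = distr N (?S \<Otimes>\<^sub>M ?T) (\<lambda>\<omega>. (?w \<omega>, F \<omega>))"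
    using indep unfolding indep_var_distribution_eq by simp
  define H where "H w f = iexp (\<Sum>i<r. c i * w (rounded k (f (\<tau> i))))" for w f :: "real \<Rightarrow> real"
  \<comment> \<open>Joint measurability holds because a rounded time takes countably many values, so
    only those coordinates of the first component are read.\<close>
  have comp: "(\<lambda>x. fst x (rounded k (snd x (\<tau> i)))) \<in> borel_measurable (?S \<Otimes>\<^sub>M ?T)" for i
  proof (rule measurable_compose_countable[where f="\<lambda>j x. fst x (grid_point k j)"])
    show "(\<lambda>x. fst x (grid_point k j)) \<in> borel_measurable (?S \<Otimes>\<^sub>M ?T)" for j
      by (rule measurable_compose[OF measurable_fst measurable_component_singleton[OF grid_point_range]])
    have "(\<lambda>x. snd x (\<tau> i)) \<in> borel_measurable (?S \<Otimes>\<^sub>M ?T)"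
      by (rule measurable_compose[OF measurable_snd measurable_component_singleton]) simp
    then show "(\<lambda>x. \<lfloor>real (Suc k) * snd x (\<tau> i)\<rfloor>) \<in> measurable (?S \<Otimes>\<^sub>M ?T) (count_space UNIV)"
      by measurable
  qed
  have Hm: "case_prod H \<in> borel_measurable (?S \<Otimes>\<^sub>M ?T)"
    unfolding H_def split_beta' using comp by measurable
  interpret Pw: prob_space "distr N ?S ?w" by (rule prob_space_distr[OF rv(1)])
  interpret Pf: prob_space "distr N ?T F" by (rule prob_space_distr[OF rv(2)])
  interpret PP: pair_prob_space "distr N ?S ?w" "distr N ?T F" ..
  have iH: "integrable (distr N ?S ?w \<Otimes>\<^sub>M distr N ?T F) (case_prod H)"
  proof (rule PP.P.integrable_const_bound[where B=1])
    show "AE x in distr N ?S ?w \<Otimes>\<^sub>M distr N ?T F. norm (case_prod H x) \<le> 1"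
      by (simp add: H_def split_beta')
    show "case_prod H \<in> borel_measurable (distr N ?S ?w \<Otimes>\<^sub>M distr N ?T F)"
      unfolding joint using Hm by simp
  qed
  have "(LINT \<omega>|N. iexp (\<Sum>i<r. c i * W_grid k (\<tau> i) \<omega>)) = (LINT \<omega>|N. H (?w \<omega>) (F \<omega>))"
    unfolding H_def W_grid_def using grid_point_range by simp
  also have "\<dots> = (\<integral>x. case_prod H x \<partial>distr N (?S \<Otimes>\<^sub>M ?T) (\<lambda>\<omega>. (?w \<omega>, F \<omega>)))"
    using Hm rv by (subst integral_distr) auto
  also have "\<dots> = (\<integral>x. case_prod H x \<partial>(distr N ?S ?w \<Otimes>\<^sub>M distr N ?T F))"
    unfolding joint ..
  also have "\<dots> = (LINT f|distr N ?T F. LINT w|distr N ?S ?w. H w f)"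
    using iH by (rule PP.integral_snd[symmetric])
  also have "\<dots> = (LINT f|distr N ?T F. bridge_char r c (\<lambda>i. rounded k (f (\<tau> i))))"
  proof (rule Bochner_Integration.integral_cong[OF refl])
    fix f
    have [measurable]: "(\<lambda>w. w (grid_point k j)) \<in> borel_measurable ?S" for j
      by (rule measurable_component_singleton[OF grid_point_range])
    have Hf: "(\<lambda>w. H w f) \<in> borel_measurable ?S"
      unfolding H_def by measurable
    have "(LINT w|distr N ?S ?w. H w f) = (LINT \<omega>|N. H (?w \<omega>) f)"
      by (rule integral_distr[OF rv(1) Hf])
    also have "\<dots> = bridge_char r c (\<lambda>i. rounded k (f (\<tau> i)))"
      unfolding H_def using brownian_bridge_char[OF prob_space_axioms bridge, of r "\<lambda>i. rounded k (f (\<tau> i))" c]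
        grid_point_range by simp
    finally show "(LINT w|distr N ?S ?w. H w f) = bridge_char r c (\<lambda>i. rounded k (f (\<tau> i)))" .
  qed
  also have "\<dots> = (LINT \<omega>|N. bridge_char r c (\<lambda>i. rounded k (F \<omega> (\<tau> i))))"
  proof (subst integral_distr[OF rv(2)])
    have "(\<lambda>f. rounded k (f (\<tau> i))) \<in> borel_measurable ?T" for i
    proof (rule measurable_compose[OF _ grid_point_measurable])
      show "(\<lambda>f. f (\<tau> i)) \<in> borel_measurable ?T" by (rule measurable_component_singleton) simp
    qed
    note [measurable] = bridge_form_measurable[OF this]
    show "(\<lambda>f. bridge_char r c (\<lambda>i. rounded k (f (\<tau> i)))) \<in> borel_measurable ?T"
      by measurable
  qed simp
  finally show ?thesis .
qed

text \<open>Both sides of the identity for rounded times converge by dominated convergence: one by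
  continuity of bridge paths, the other because the covariance is continuous in the times.\<close>

lemma time_changed_char:
  assumes Y: "\<And>i. Y i \<in> borel_measurable N" "\<And>i. AE \<omega> in N. Y i \<omega> = W (F \<omega> (\<tau> i)) \<omega>"
  shows "(LINT \<omega>|N. iexp (\<Sum>i<r. c i * Y i \<omega>)) = (LINT \<omega>|N. bridge_char r c (\<lambda>i. F \<omega> (\<tau> i)))"
proof (rule LIMSEQ_unique)
  have cont: "AE \<omega> in N. continuous_on {0..1} (\<lambda>u. W u \<omega>)"
    using bridge by (simp add: brownian_bridge_def)
  have Yall: "AE \<omega> in N. \<forall>i. Y i \<omega> = W (F \<omega> (\<tau> i)) \<omega>"
    using Y(2) by (simp add: AE_all_countable)
  show "(\<lambda>k. LINT \<omega>|N. iexp (\<Sum>i<r. c i * W_grid k (\<tau> i) \<omega>)) \<longlonglongrightarrow> (LINT \<omega>|N. iexp (\<Sum>i<r. c i * Y i \<omega>))"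
  proof (rule integral_dominated_convergence[where w="\<lambda>_. 1"])
    show "AE \<omega> in N. (\<lambda>k. iexp (\<Sum>i<r. c i * W_grid k (\<tau> i) \<omega>)) \<longlonglongrightarrow> iexp (\<Sum>i<r. c i * Y i \<omega>)"
      using cont Yall AE_space
    proof eventually_elim
      case (elim \<omega>)
      then show ?case
        using W_grid_tendsto[of \<omega>] by (auto intro!: tendsto_intros)
    qed
  qed (use Y(1) in auto)
  show "(\<lambda>k. LINT \<omega>|N. iexp (\<Sum>i<r. c i * W_grid k (\<tau> i) \<omega>))
      \<longlonglongrightarrow> (LINT \<omega>|N. bridge_char r c (\<lambda>i. F \<omega> (\<tau> i)))"
    unfolding W_grid_char
  proof (rule integral_dominated_convergence[where w="\<lambda>_. exp ((\<Sum>i<r. \<bar>c i\<bar>)\<^sup>2)"])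
    note [measurable] = bridge_form_measurable[OF F_meas]
      bridge_form_measurable[OF measurable_compose[OF F_meas grid_point_measurable]]
    show "(\<lambda>\<omega>. bridge_char r c (\<lambda>i. F \<omega> (\<tau> i))) \<in> borel_measurable N"
      "(\<lambda>\<omega>. bridge_char r c (\<lambda>i. rounded k (F \<omega> (\<tau> i)))) \<in> borel_measurable N" for k
      by measurable
    show "AE \<omega> in N. (\<lambda>k. bridge_char r c (\<lambda>i. rounded k (F \<omega> (\<tau> i))))
        \<longlonglongrightarrow> bridge_char r c (\<lambda>i. F \<omega> (\<tau> i))"
    proof (rule AE_I2)
      fix \<omega> assume "\<omega> \<in> space N"
      from grid_point_tendsto[OF F_range[OF this]]
      show "(\<lambda>k. bridge_char r c (\<lambda>i. rounded k (F \<omega> (\<tau> i))))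
        \<longlonglongrightarrow> bridge_char r c (\<lambda>i. F \<omega> (\<tau> i))"
        unfolding bridge_form_def by (intro tendsto_intros) auto
    qed
    show "AE \<omega> in N. norm (bridge_char r c (\<lambda>i. rounded k (F \<omega> (\<tau> i))))
        \<le> exp ((\<Sum>i<r. \<bar>c i\<bar>)\<^sup>2)" for k
    proof (rule AE_I2)
      fix \<omega>
      have "\<bar>bridge_form r c (\<lambda>i. rounded k (F \<omega> (\<tau> i)))\<bar> \<le> (\<Sum>i<r. \<bar>c i\<bar>)\<^sup>2"
        using grid_point_range by (intro bridge_form_bound) auto
      moreover have "0 \<le> (\<Sum>i<r. \<bar>c i\<bar>)\<^sup>2" by simp
      ultimately show "norm (bridge_char r c (\<lambda>i. rounded k (F \<omega> (\<tau> i))))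
        \<le> exp ((\<Sum>i<r. \<bar>c i\<bar>)\<^sup>2)"
        by (simp only: norm_of_real abs_exp_cancel exp_le_cancel_iff)
    qed
  qed auto
qed

text \<open>\<open>Z\<close> is described only almost surely, and \<open>N\<close> need not be
  complete. Off a measurable null set each coordinate is the limit of \<open>W_grid\<close>; on that
  set a fixed element is substituted.\<close>

lemma coordinate_measurable_version:
  assumes Z: "AE \<omega> in N. \<forall>t. path (Z \<omega>) t = W (F \<omega> t) \<omega>"
  obtains Z0 where "\<And>t. (\<lambda>\<omega>. path (Z0 \<omega>) t) \<in> borel_measurable N" "AE \<omega> in N. Z \<omega> = Z0 \<omega>"
proof -
  have "AE \<omega> in N. continuous_on {0..1} (\<lambda>u. W u \<omega>) \<and> (\<forall>t. path (Z \<omega>) t = W (F \<omega> t) \<omega>)"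
    using bridge Z by (auto simp: brownian_bridge_def)
  then obtain E where E: "E \<in> null_sets N"
    "{\<omega> \<in> space N. \<not> (continuous_on {0..1} (\<lambda>u. W u \<omega>) \<and> (\<forall>t. path (Z \<omega>) t = W (F \<omega> t) \<omega>))} \<subseteq> E"
    unfolding eventually_ae_filter by auto
  have [measurable]: "E \<in> sets N" using E(1) by auto
  define Z0 where "Z0 \<omega> = (if \<omega> \<in> E then undefined else Z \<omega>)" for \<omega>
  show thesis
  proof
    fix t
    show "(\<lambda>\<omega>. path (Z0 \<omega>) t) \<in> borel_measurable N"
    proof (rule borel_measurable_LIMSEQ_real)
      show "(\<lambda>\<omega>. if \<omega> \<in> E then path undefined t else W_grid k t \<omega>) \<in> borel_measurable N" for k
        by measurable
      fix \<omega> assume w: "\<omega> \<in> space N"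
      show "(\<lambda>k. if \<omega> \<in> E then path undefined t else W_grid k t \<omega>) \<longlonglongrightarrow> path (Z0 \<omega>) t"
      proof (cases "\<omega> \<in> E")
        case False
        with w E(2) have "continuous_on {0..1} (\<lambda>u. W u \<omega>)" "path (Z \<omega>) t = W (F \<omega> t) \<omega>" by auto
        with W_grid_tendsto[OF this(1) w, of t] False show ?thesis by (simp add: Z0_def)
      qed (simp add: Z0_def)
    qed
    show "AE \<omega> in N. Z \<omega> = Z0 \<omega>"
      using AE_not_in[OF E(1)] by eventually_elim (simp add: Z0_def)
  qed
qed

end

section \<open>From finite-dimensional to weak convergence\<close>

lemma continuous_coordinate: "continuous_on S (\<lambda>v :: 'a \<Rightarrow> 'b::topological_space. v i)"
  by (rule continuous_on_product_then_coordinatewise) (rule continuous_on_id)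

abbreviation (input) proj :: "nat \<Rightarrow> (nat \<Rightarrow> real) \<Rightarrow> (nat \<Rightarrow> real) \<Rightarrow> cadlag0 \<Rightarrow> cadlag0" where
  "proj r a b x \<equiv> step r a b (\<lambda>i. path x (a i))"

lemma continuous_proj: "continuous_on S (proj r a b)"
  by (intro continuous_step continuous_path)

text \<open>The second point is not confined to \<open>K\<close>: it will be a value of the process
  close to \<open>K\<close>. The witness is a Lebesgue number for the cover of \<open>K\<close> by
  preimages of balls of radius \<open>\<delta> / 2\<close>.\<close>

lemma continuous_near_compact:
  fixes f :: "'a::metric_space \<Rightarrow> real"
  assumes f: "continuous_on UNIV f" and K: "compact K" and "\<delta> > 0"
  obtains \<epsilon> where "\<epsilon> > 0" "\<And>x y. x \<in> K \<Longrightarrow> dist x y < \<epsilon> \<Longrightarrow> \<bar>f x - f y\<bar> < \<delta>"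
proof -
  define \<G> where "\<G> = range (\<lambda>c. f -` ball c (\<delta> / 2))"
  have op: "open G" if "G \<in> \<G>" for G
    using that open_vimage[OF open_ball f] by (auto simp: \<G>_def)
  have cov: "K \<subseteq> \<Union>\<G>"
  proof
    fix x
    have "x \<in> f -` ball (f x) (\<delta> / 2)" using \<open>\<delta> > 0\<close> by simp
    then show "x \<in> \<Union>\<G>" unfolding \<G>_def by blast
  qed
  obtain e where e: "0 < e" "\<And>x. x \<in> K \<Longrightarrow> \<exists>G\<in>\<G>. ball x e \<subseteq> G"
    by (rule Heine_Borel_lemma[OF K cov op]) (assumption, blast)
  show thesis
  proof
    show "e > 0" by fact
    fix x y assume xy: "x \<in> K" "dist x y < e"
    then obtain c where "ball x e \<subseteq> f -` ball c (\<delta> / 2)"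
      using e(2)[OF xy(1)] by (auto simp: \<G>_def)
    moreover have "x \<in> ball x e" "y \<in> ball x e" using xy e(1) by auto
    ultimately have "f x \<in> ball c (\<delta> / 2)" "f y \<in> ball c (\<delta> / 2)" by blast+
    then show "\<bar>f x - f y\<bar> < \<delta>"
      unfolding mem_ball dist_real_def by linarith
  qed
qed

lemma (in prob_space) exists_tail_bound:
  assumes "X \<in> borel_measurable M" "e > 0"
  obtains c :: real where "prob {\<omega> \<in> space M. X \<omega> > c} < e"
proof -
  interpret D: real_distribution "distr M borel X" using assms(1) by (rule real_distribution_distr)
  have "\<forall>\<^sub>F c in at_top. 1 - e < cdf (distr M borel X) c"
    using D.cdf_lim_at_top_prob assms(2) by (intro order_tendstoD(1)) auto
  then obtain c where c: "1 - e < cdf (distr M borel X) c"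
    using eventually_happens' trivial_limit_at_top_linorder by blast
  have "cdf (distr M borel X) c = prob {\<omega> \<in> space M. X \<omega> \<le> c}"
    using assms(1) by (simp add: cdf_def measure_distr vimage_def Int_def conj_commute)
  moreover have "{\<omega> \<in> space M. X \<omega> > c} = space M - {\<omega> \<in> space M. X \<omega> \<le> c}" by auto
  moreover have "{\<omega> \<in> space M. X \<omega> \<le> c} \<in> sets M" using assms(1) by measurable
  ultimately show thesis
    using c that[of c] by (simp add: prob_compl)
qed

text \<open>\<open>g + \<delta> + 2 * C * indicator A\<close> is an integrable majorant of
  \<open>f\<close>, and every majorant lies above
  \<open>g - (\<delta> + 2 * C * indicator A)\<close>; so the estimate covers non-measurable
  \<open>f\<close>.\<close>

lemma (in prob_space) outer_expectation_approx:
  fixes f g :: "'a \<Rightarrow> real"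
  assumes g: "g \<in> borel_measurable M" "\<And>\<omega>. \<omega> \<in> space M \<Longrightarrow> \<bar>g \<omega>\<bar> \<le> C"
    and f: "\<And>\<omega>. \<omega> \<in> space M \<Longrightarrow> \<bar>f \<omega>\<bar> \<le> C"
    and A: "A \<in> sets M" and close: "\<And>\<omega>. \<omega> \<in> space M - A \<Longrightarrow> \<bar>f \<omega> - g \<omega>\<bar> \<le> \<delta>" and "0 \<le> \<delta>"
  shows "\<bar>outer_expectation M f - expectation g\<bar> \<le> \<delta> + 2 * C * prob A"
proof -
  have ig: "integrable M g" using g by (intro integrable_const_bound[where B=C]) auto
  have iA: "integrable M (\<lambda>\<omega>. 2 * C * indicator A \<omega>)" using A by (simp add: less_top[symmetric])
  have eA: "(LINT \<omega>|M. 2 * C * indicator A \<omega>) = 2 * C * prob A" using A by simp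
  have bd: "\<bar>f \<omega> - g \<omega>\<bar> \<le> \<delta> + 2 * C * indicator A \<omega>" if "\<omega> \<in> space M" for \<omega>
  proof (cases "\<omega> \<in> A")
    case True
    then show ?thesis using f[OF that] g(2)[OF that] \<open>0 \<le> \<delta>\<close> by simp
  next
    case False
    then show ?thesis using close[of \<omega>] that by simp
  qed
  define S where "S = {(LINT \<omega>|M. U \<omega>) | U. integrable M U \<and> (\<forall>\<omega>\<in>space M. f \<omega> \<le> U \<omega>)}"
  have up: "expectation g + \<delta> + 2 * C * prob A \<in> S"
  proof -
    have "f \<omega> \<le> g \<omega> + \<delta> + 2 * C * indicator A \<omega>" if "\<omega> \<in> space M" for \<omega>
      using bd[OF that] by linarith
    moreover have "(LINT \<omega>|M. g \<omega> + \<delta> + 2 * C * indicator A \<omega>) = expectation g + \<delta> + 2 * C * prob A"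
      using ig iA eA by (simp add: prob_space)
    ultimately show ?thesis
      unfolding S_def using ig iA
      by (intro CollectI exI[of _ "\<lambda>\<omega>. g \<omega> + \<delta> + 2 * C * indicator A \<omega>"]) auto
  qed
  have low: "expectation g - (\<delta> + 2 * C * prob A) \<le> s" if s: "s \<in> S" for s
  proof -
    obtain U where U: "s = (LINT \<omega>|M. U \<omega>)" "integrable M U" "\<forall>\<omega>\<in>space M. f \<omega> \<le> U \<omega>"
      using s by (auto simp: S_def)
    have "(LINT \<omega>|M. g \<omega> - (\<delta> + 2 * C * indicator A \<omega>)) \<le> (LINT \<omega>|M. U \<omega>)"
    proof (rule integral_mono)
      fix \<omega> assume w: "\<omega> \<in> space M"
      have "f \<omega> \<le> U \<omega>" using U(3) w by blast
      with bd[OF w] show "g \<omega> - (\<delta> + 2 * C * indicator A \<omega>) \<le> U \<omega>" by linarith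
    qed (use ig iA U in auto)
    moreover have "(LINT \<omega>|M. g \<omega> - (\<delta> + 2 * C * indicator A \<omega>)) = expectation g - (\<delta> + 2 * C * prob A)"
      using ig iA eA by (simp add: prob_space)
    ultimately show ?thesis using U(1) by simp
  qed
  have "Inf S \<le> expectation g + \<delta> + 2 * C * prob A"
    using up low by (intro cInf_lower bdd_belowI) auto
  moreover have "expectation g - (\<delta> + 2 * C * prob A) \<le> Inf S"
    using up low by (intro cInf_greatest) auto
  ultimately show ?thesis
    unfolding outer_expectation_def S_def[symmetric] by linarith
qed

text \<open>The abstract input for weak convergence: converging transforms of finitely many
  coordinates, and for each tolerance one grid, common to all \<open>n\<close>, that works outside
  measurable events of eventually small probability. Both processes are measurable only coordinate
  by coordinate.\<close>

locale asymptotically_step = M: prob_space M + N: prob_space N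
  for M :: "'a measure" and N :: "'b measure" +
  fixes Y :: "nat \<Rightarrow> 'a \<Rightarrow> cadlag0" and Z :: "'b \<Rightarrow> cadlag0"
  assumes Y_meas: "\<And>n t. (\<lambda>\<omega>. path (Y n \<omega>) t) \<in> borel_measurable M"
    and Z_meas: "\<And>t. (\<lambda>\<omega>. path (Z \<omega>) t) \<in> borel_measurable N"
    and char_conv: "\<And>(r :: nat) c \<tau>. (\<lambda>n. LINT \<omega>|M. iexp (\<Sum>i<r. c i * path (Y n \<omega>) (\<tau> i)))
        \<longlonglongrightarrow> (LINT \<omega>|N. iexp (\<Sum>i<r. c i * path (Z \<omega>) (\<tau> i)))"
    and approx: "\<And>\<epsilon> \<eta>. 0 < \<epsilon> \<Longrightarrow> 0 < \<eta> \<Longrightarrow> \<exists>r a b A. (\<forall>n. A n \<in> sets M) \<and>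
        (\<forall>n. \<forall>\<omega>\<in>space M - A n. dist (Y n \<omega>) (proj r a b (Y n \<omega>)) \<le> \<epsilon>) \<and>
        (\<forall>\<^sub>F n in sequentially. measure M (A n) < \<eta>)"
begin

lemma finite_dim_conv:
  fixes g :: "(nat \<Rightarrow> real) \<Rightarrow> real" and r :: nat
  assumes g: "continuous_on UNIV g" "\<And>x. \<bar>g x\<bar> \<le> C"
    and dep: "\<And>x y. (\<And>i. i < r \<Longrightarrow> x i = y i) \<Longrightarrow> g x = g y"
  shows "(\<lambda>n. LINT \<omega>|M. g (\<lambda>i. path (Y n \<omega>) (\<tau> i))) \<longlonglongrightarrow> (LINT \<omega>|N. g (\<lambda>i. path (Z \<omega>) (\<tau> i)))"
proof (rule levy_continuity_finite_dim[where r=r and C=C and g=g and Y="\<lambda>n \<omega> i. path (Y n \<omega>) (\<tau> i)"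
      and Z="\<lambda>\<omega> i. path (Z \<omega>) (\<tau> i)"])
  show "(\<lambda>\<omega> i. path (Y n \<omega>) (\<tau> i)) \<in> borel_measurable M" for n
    by (rule measurable_coordinatewise_then_product) (rule Y_meas)
  show "(\<lambda>\<omega> i. path (Z \<omega>) (\<tau> i)) \<in> borel_measurable N"
    by (rule measurable_coordinatewise_then_product) (rule Z_meas)
  show "(\<lambda>n. LINT \<omega>|M. iexp (\<Sum>i<r. c i * path (Y n \<omega>) (\<tau> i)))
      \<longlonglongrightarrow> (LINT \<omega>|N. iexp (\<Sum>i<r. c i * path (Z \<omega>) (\<tau> i)))" for c
    by (rule char_conv)
  show "g x = g y" if "\<And>i. i < r \<Longrightarrow> x i = y i" for x y
    using that by (rule dep)
qed (rule M.prob_space_axioms N.prob_space_axioms g)+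

lemma proj_conv:
  fixes f :: "cadlag0 \<Rightarrow> real"
  assumes f: "continuous_on UNIV f" "\<And>x. \<bar>f x\<bar> \<le> C"
  shows "(\<lambda>n. LINT \<omega>|M. f (proj r a b (Y n \<omega>))) \<longlonglongrightarrow> (LINT \<omega>|N. f (proj r a b (Z \<omega>)))"
proof (rule finite_dim_conv[where g="\<lambda>v. f (step r a b v)" and \<tau>=a])
  have "continuous_on UNIV (\<lambda>v. step r a b v)"
    by (intro continuous_step continuous_coordinate)
  then show "continuous_on UNIV (\<lambda>v. f (step r a b v))"
    by (rule continuous_on_compose2[OF f(1)]) simp
  show "f (step r a b v) = f (step r a b w)" if "\<And>i. i < r \<Longrightarrow> v i = w i" for v w
    using step_cong[OF that] by simp
qed (rule f(2))

text \<open>The projection is a continuous function of a sequence of coordinates, hence Borel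
  measurable even if \<open>X\<close> itself is not.\<close>

lemma proj_measurable:
  assumes "\<And>t. (\<lambda>\<omega>. path (X \<omega>) t) \<in> borel_measurable L"
  shows "(\<lambda>\<omega>. proj r a b (X \<omega>)) \<in> borel_measurable L"
proof -
  have "continuous_on UNIV (\<lambda>v. step r a b v)"
    by (intro continuous_step continuous_coordinate)
  from borel_measurable_continuous_onI[OF this] show ?thesis
    by (rule measurable_compose[rotated])
       (auto intro!: measurable_coordinatewise_then_product assms)
qed

abbreviation (input) rational :: "nat \<Rightarrow> real" where
  "rational j \<equiv> real_of_rat (from_nat j)"

lemma far_eq:
  "{\<omega> \<in> space L. dist (X \<omega>) (proj r a b (X \<omega>)) > \<epsilon>} =
   {\<omega> \<in> space L. \<exists>j. \<bar>path (X \<omega>) (rational j) - path (proj r a b (X \<omega>)) (rational j)\<bar> > \<epsilon>}"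
proof (intro Collect_cong conj_cong refl iffI)
  fix \<omega> assume "dist (X \<omega>) (proj r a b (X \<omega>)) > \<epsilon>"
  then have "\<not> (\<forall>q\<in>\<rat>. \<bar>path (X \<omega>) q - path (proj r a b (X \<omega>)) q\<bar> \<le> \<epsilon>)"
    using path_le_if_rational[of "X \<omega>" "proj r a b (X \<omega>)" \<epsilon>] by fastforce
  then have "\<exists>q. \<bar>path (X \<omega>) (real_of_rat q) - path (proj r a b (X \<omega>)) (real_of_rat q)\<bar> > \<epsilon>"
    unfolding Rats_def by (simp add: not_le)
  then obtain q where "\<bar>path (X \<omega>) (real_of_rat q) - path (proj r a b (X \<omega>)) (real_of_rat q)\<bar> > \<epsilon>"
    by blast
  then show "\<exists>j. \<bar>path (X \<omega>) (rational j) - path (proj r a b (X \<omega>)) (rational j)\<bar> > \<epsilon>"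
    by (intro exI[of _ "to_nat q"]) simp
next
  fix \<omega> assume "\<exists>j. \<bar>path (X \<omega>) (rational j) - path (proj r a b (X \<omega>)) (rational j)\<bar> > \<epsilon>"
  then show "dist (X \<omega>) (proj r a b (X \<omega>)) > \<epsilon>"
    using abs_path_diff_le_dist less_le_trans by blast
qed

lemma far_measurable:
  assumes "\<And>t. (\<lambda>\<omega>. path (X \<omega>) t) \<in> borel_measurable L"
  shows "{\<omega> \<in> space L. dist (X \<omega>) (proj r a b (X \<omega>)) > \<epsilon>} \<in> sets L"
proof -
  note [measurable] = assms
  have "(\<lambda>\<omega>. path (proj r a b (X \<omega>)) t) \<in> borel_measurable L" for t
    unfolding path_step by measurable
  note [measurable] = this
  show ?thesis unfolding far_eq by measurable
qed

text \<open>The event on the limit side involves infinitely many coordinates. Its indicator is the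
  limit of \<open>G k (Z \<omega>)\<close>, where \<open>G k\<close> depends continuously on
  finitely many coordinates; at \<open>Y n\<close> it is at most the indicator of
  \<open>A n\<close>. The limit in \<open>n\<close> is taken for fixed \<open>k\<close>.\<close>

lemma limit_near_proj:
  assumes A: "\<And>n. A n \<in> sets M"
    and near: "\<And>n \<omega>. \<omega> \<in> space M - A n \<Longrightarrow> dist (Y n \<omega>) (proj r a b (Y n \<omega>)) \<le> \<epsilon>"
    and small: "\<forall>\<^sub>F n in sequentially. measure M (A n) < \<eta>"
  shows "measure N {\<omega> \<in> space N. dist (Z \<omega>) (proj r a b (Z \<omega>)) > \<epsilon>} \<le> \<eta>"
proof -
  define q :: "nat \<Rightarrow> real" where "q j = rational j" for j
  define ex where "ex x j = max 0 (\<bar>path x (q j) - path (proj r a b x) (q j)\<bar> - \<epsilon>)" for x j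
  define G where "G k x = min 1 (real k * (\<Sum>j<k. ex x j))" for k x
  define E where "E = {\<omega> \<in> space N. dist (Z \<omega>) (proj r a b (Z \<omega>)) > \<epsilon>}"
  have E: "E \<in> sets N" unfolding E_def by (rule far_measurable) (rule Z_meas)
  have G01: "0 \<le> G k x" "G k x \<le> 1" for k x
    unfolding G_def ex_def by (auto intro!: mult_nonneg_nonneg sum_nonneg)
  have Gconv: "(\<lambda>n. LINT \<omega>|M. G k (Y n \<omega>)) \<longlonglongrightarrow> (LINT \<omega>|N. G k (Z \<omega>))" for k
  proof -
    \<comment> \<open>The first \<open>r\<close> arguments are the grid points read by the
      projection, the next \<open>k\<close> are the rationals at which the distance is
      tested.\<close>
    define \<tau> where "\<tau> i = (if i < r then a i else q (i - r))" for i
    define g where "g v = min 1 (real k * (\<Sum>j<k. max 0 (\<bar>v (r + j) - (\<Sum>i<r. v i * indicator {a i..<b i} (q j))\<bar> - \<epsilon>)))"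
      for v :: "nat \<Rightarrow> real"
    have gG: "g (\<lambda>i. path x (\<tau> i)) = G k x" for x
      unfolding g_def G_def ex_def path_step by (simp add: \<tau>_def)
    have "(\<lambda>n. LINT \<omega>|M. g (\<lambda>i. path (Y n \<omega>) (\<tau> i))) \<longlonglongrightarrow> (LINT \<omega>|N. g (\<lambda>i. path (Z \<omega>) (\<tau> i)))"
    proof (rule finite_dim_conv[where g=g and \<tau>=\<tau>])
      show "continuous_on UNIV g"
        unfolding g_def by (intro continuous_intros continuous_coordinate)
      show "\<bar>g v\<bar> \<le> 1" for v
      proof -
        have "0 \<le> g v" unfolding g_def by (auto intro!: mult_nonneg_nonneg sum_nonneg)
        moreover have "g v \<le> 1" by (simp add: g_def)
        ultimately show ?thesis by simp
      qed
      show "g v = g w" if "\<And>i. i < r + k \<Longrightarrow> v i = w i" for v w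
        unfolding g_def using that by simp
    qed
    then show ?thesis unfolding gG .
  qed
  have Gle: "(LINT \<omega>|M. G k (Y n \<omega>)) \<le> measure M (A n)" for k n
  proof -
    have "G k (Y n \<omega>) \<le> indicator (A n) \<omega>" if "\<omega> \<in> space M" for \<omega>
    proof (cases "\<omega> \<in> A n")
      case False
      with near that have d: "dist (Y n \<omega>) (proj r a b (Y n \<omega>)) \<le> \<epsilon>" by simp
      have "ex (Y n \<omega>) j = 0" for j
        using order_trans[OF abs_path_diff_le_dist d, of "q j"] by (simp add: ex_def)
      then show ?thesis by (simp add: G_def)
    qed (simp add: G01)
    then have "(LINT \<omega>|M. G k (Y n \<omega>)) \<le> (LINT \<omega>|M. indicator (A n) \<omega>)"
      using A[of n] G01 by (intro integral_mono') (auto simp: less_top[symmetric])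
    then show ?thesis using A by simp
  qed
  have GZ: "(LINT \<omega>|N. G k (Z \<omega>)) \<le> \<eta>" for k
  proof (rule tendsto_upperbound[OF Gconv])
    show "\<forall>\<^sub>F n in sequentially. (LINT \<omega>|M. G k (Y n \<omega>)) \<le> \<eta>"
      using small
    proof eventually_elim
      case (elim n)
      then show ?case using Gle[of k n] by linarith
    qed
  qed simp
  have "(\<lambda>k. LINT \<omega>|N. G k (Z \<omega>)) \<longlonglongrightarrow> (LINT \<omega>|N. indicator E \<omega>)"
  proof (rule integral_dominated_convergence[where w="\<lambda>_. 1"])
    note [measurable] = Z_meas
    show "(\<lambda>\<omega>. G k (Z \<omega>)) \<in> borel_measurable N" for k
      unfolding G_def ex_def path_step by measurable
    show "AE \<omega> in N. (\<lambda>k. G k (Z \<omega>)) \<longlonglongrightarrow> indicator E \<omega>"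
    proof (rule AE_I2)
      fix \<omega> assume w: "\<omega> \<in> space N"
      show "(\<lambda>k. G k (Z \<omega>)) \<longlonglongrightarrow> indicator E \<omega>"
      proof (cases "\<omega> \<in> E")
        case True
        then obtain j where j: "\<bar>path (Z \<omega>) (q j) - path (proj r a b (Z \<omega>)) (q j)\<bar> > \<epsilon>"
          unfolding E_def far_eq q_def by blast
        \<comment> \<open>One positive excess is enough: the factor \<open>k\<close> in
          \<open>G k\<close> eventually lifts the sum above 1.\<close>
        then have ex: "ex (Z \<omega>) j > 0" by (simp add: ex_def)
        have "\<forall>\<^sub>F k in sequentially. G k (Z \<omega>) = 1"
          using eventually_gt_at_top[of j] eventually_ge_at_top[of "nat \<lceil>1 / ex (Z \<omega>) j\<rceil>"]
        proof eventually_elim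
          case (elim k)
          then have "1 / ex (Z \<omega>) j \<le> real k" by (simp only: nat_ceiling_le_eq)
          then have "1 \<le> real k * ex (Z \<omega>) j" using ex by (simp add: divide_le_eq)
          also have "\<dots> \<le> real k * (\<Sum>j<k. ex (Z \<omega>) j)"
            using elim(1) by (intro mult_left_mono member_le_sum) (auto simp: ex_def)
          finally show ?case by (simp add: G_def)
        qed
        with True show ?thesis by (simp add: tendsto_eventually)
      next
        case False
        then have d: "dist (Z \<omega>) (proj r a b (Z \<omega>)) \<le> \<epsilon>" using w by (simp add: E_def)
        have "ex (Z \<omega>) j = 0" for j
          using order_trans[OF abs_path_diff_le_dist d, of "q j"] by (simp add: ex_def)
        with False show ?thesis by (simp add: G_def)
      qed
    qed
  qed (use E G01 in auto)
  then have "(\<lambda>k. LINT \<omega>|N. G k (Z \<omega>)) \<longlonglongrightarrow> measure N E"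
    using E by simp
  then show ?thesis
    unfolding E_def[symmetric] by (rule tendsto_upperbound) (use GZ in auto)
qed

text \<open>All data of a grid form one tuple, so that a single choice over \<open>m\<close>
  suffices. Tolerance and probability are both \<open>(1/2) ^ m\<close>, which is summable.\<close>

definition good_grid :: "nat \<Rightarrow> nat \<times> (nat \<Rightarrow> real) \<times> (nat \<Rightarrow> real) \<times> (nat \<Rightarrow> 'a set) \<Rightarrow> bool" where
  "good_grid m s = (case s of (r, a, b, A) \<Rightarrow> (\<forall>n. A n \<in> sets M) \<and>
      (\<forall>n. \<forall>\<omega>\<in>space M - A n. dist (Y n \<omega>) (proj r a b (Y n \<omega>)) \<le> (1/2) ^ m) \<and>
      (\<forall>\<^sub>F n in sequentially. measure M (A n) < (1/2) ^ m))"

text \<open>Almost surely \<open>Z\<close> is the uniform limit of its projections, each of which is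
  Borel; this gives the measurable version. Bounded heights on a fixed grid form a compact family,
  which gives tightness. For convergence, one fine projection is used on both sides, and tightness
  makes \<open>f\<close> uniformly continuous where most of the mass lies.\<close>

theorem convergence_and_tightness:
  obtains Z' where "Z' \<in> borel_measurable N" "AE \<omega> in N. Z \<omega> = Z' \<omega>"
    "\<And>\<epsilon>. \<epsilon> > 0 \<Longrightarrow> \<exists>K. compact K \<and> measure (distr N borel Z') K > 1 - \<epsilon>"
    "\<And>f :: cadlag0 \<Rightarrow> real. continuous_on UNIV f \<Longrightarrow> bounded (range f) \<Longrightarrow>
      (\<lambda>n. outer_expectation M (\<lambda>\<omega>. f (Y n \<omega>))) \<longlonglongrightarrow> (LINT \<omega>|N. f (Z' \<omega>))"
proof -
  have "\<forall>m. \<exists>s. good_grid m s"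
  proof
    fix m :: nat
    have "(0::real) < (1/2) ^ m" by simp
    from approx[OF this this] obtain r a b A where "(\<forall>n. A n \<in> sets M) \<and>
        (\<forall>n. \<forall>\<omega>\<in>space M - A n. dist (Y n \<omega>) (proj r a b (Y n \<omega>)) \<le> (1/2) ^ m) \<and>
        (\<forall>\<^sub>F n in sequentially. measure M (A n) < (1/2) ^ m)"
      by (elim exE)
    then have "good_grid m (r, a, b, A)" unfolding good_grid_def prod.case .
    then show "\<exists>s. good_grid m s" ..
  qed
  from choice[OF this] obtain s where s: "\<And>m. good_grid m (s m)" by blast
  define r where "r m = fst (s m)" for m
  define a where "a m = fst (snd (s m))" for m
  define b where "b m = fst (snd (snd (s m)))" for m
  define A where "A m = snd (snd (snd (s m)))" for m
  define P where "P m = proj (r m) (a m) (b m)" for m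
  have A: "A m n \<in> sets M" and near: "\<omega> \<in> space M - A m n \<Longrightarrow> dist (Y n \<omega>) (P m (Y n \<omega>)) \<le> (1/2) ^ m"
    and small: "\<forall>\<^sub>F n in sequentially. measure M (A m n) < (1/2) ^ m" for m n \<omega>
  proof -
    have "(\<forall>n. A m n \<in> sets M) \<and>
        (\<forall>n. \<forall>\<omega>\<in>space M - A m n. dist (Y n \<omega>) (P m (Y n \<omega>)) \<le> (1/2) ^ m) \<and>
        (\<forall>\<^sub>F n in sequentially. measure M (A m n) < (1/2) ^ m)"
      using s[of m] unfolding good_grid_def r_def a_def b_def A_def P_def
      unfolding case_prod_beta .
    then show "A m n \<in> sets M" "\<omega> \<in> space M - A m n \<Longrightarrow> dist (Y n \<omega>) (P m (Y n \<omega>)) \<le> (1/2) ^ m"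
      "\<forall>\<^sub>F n in sequentially. measure M (A m n) < (1/2) ^ m" by blast+
  qed
  have Pcont: "continuous_on S (P m)" for S m unfolding P_def by (rule continuous_proj)
  have PZ[measurable]: "(\<lambda>\<omega>. P m (Z \<omega>)) \<in> borel_measurable N" for m
    unfolding P_def by (rule proj_measurable) (rule Z_meas)
  have PY[measurable]: "(\<lambda>\<omega>. P m (Y n \<omega>)) \<in> borel_measurable M" for m n
    unfolding P_def by (rule proj_measurable) (rule Y_meas)
  define E where "E m = {\<omega> \<in> space N. dist (Z \<omega>) (P m (Z \<omega>)) > (1/2) ^ m}" for m
  have Em[measurable]: "E m \<in> sets N" for m
    unfolding E_def P_def by (rule far_measurable) (rule Z_meas)
  have Ele: "measure N (E m) \<le> (1/2) ^ m" for m
    unfolding E_def P_def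
    using limit_near_proj[OF A near[unfolded P_def] small] .
  \<comment> \<open>The bounds on \<open>E m\<close> are summable, so by Borel-Cantelli almost every
    point lies in only finitely many of these events.\<close>
  have "AE \<omega> in N. eventually (\<lambda>m. \<omega> \<in> space N - E m) sequentially"
  proof (rule borel_cantelli_AE1)
    show "summable (\<lambda>m. measure N (E m))"
      by (rule summable_comparison_test'[of "\<lambda>m. (1/2) ^ m" 0]) (auto simp: Ele summable_geometric)
  qed (auto simp: less_top[symmetric])
  then obtain E0 where E0: "E0 \<in> null_sets N"
    "{\<omega> \<in> space N. \<not> eventually (\<lambda>m. \<omega> \<in> space N - E m) sequentially} \<subseteq> E0"
    unfolding eventually_ae_filter by auto
  have [measurable]: "E0 \<in> sets N" using E0(1) by auto
  have PZlim: "(\<lambda>m. P m (Z \<omega>)) \<longlonglongrightarrow> Z \<omega>" if "\<omega> \<in> space N - E0" for \<omega>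
  proof (rule iffD2[OF tendsto_dist_iff], rule tendsto_0_le[where K=1])
    show "(\<lambda>m. (1/2::real) ^ m) \<longlonglongrightarrow> 0" by (rule LIMSEQ_realpow_zero) auto
    have "eventually (\<lambda>m. \<omega> \<in> space N - E m) sequentially" using that E0(2) by auto
    then show "\<forall>\<^sub>F m in sequentially. norm (dist (P m (Z \<omega>)) (Z \<omega>)) \<le> norm ((1/2::real) ^ m) * 1"
      by eventually_elim (auto simp: E_def dist_commute)
  qed
  define Z' where "Z' \<omega> = (if \<omega> \<in> E0 then undefined else Z \<omega>)" for \<omega>
  have Z'm[measurable]: "Z' \<in> borel_measurable N"
  proof (rule borel_measurable_LIMSEQ_metric)
    show "(\<lambda>\<omega>. if \<omega> \<in> E0 then undefined else P m (Z \<omega>)) \<in> borel_measurable N" for m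
      by measurable
    show "(\<lambda>m. if \<omega> \<in> E0 then undefined else P m (Z \<omega>)) \<longlonglongrightarrow> Z' \<omega>" if "\<omega> \<in> space N" for \<omega>
      using PZlim[of \<omega>] that by (auto simp: Z'_def)
  qed
  have Z'eq: "AE \<omega> in N. Z \<omega> = Z' \<omega>"
    using AE_not_in[OF E0(1)] by eventually_elim (simp add: Z'_def)
  have tight: "\<exists>K. compact K \<and> measure (distr N borel Z') K > 1 - \<epsilon>" if "\<epsilon> > 0" for \<epsilon>
  proof -
    \<comment> \<open>This sum bounds every height of the projection and so confines it to a compact
      family of step functions.\<close>
    define X where "X m x = (\<Sum>i<r m. \<bar>path x (a m i)\<bar>)" for m x
    have Xc: "continuous_on UNIV (X m)" for m
      unfolding X_def by (intro continuous_intros continuous_path)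
    have Xm: "X m \<in> borel_measurable borel" for m by (rule borel_measurable_continuous_onI[OF Xc])
    have "\<exists>c. measure N {\<omega> \<in> space N. X m (Z' \<omega>) > c} < (1/2) ^ m" for m
      using N.exists_tail_bound[OF measurable_compose[OF Z'm Xm], of "(1/2) ^ m"] by auto
    then obtain c where c: "\<And>m. measure N {\<omega> \<in> space N. X m (Z' \<omega>) > c m} < (1/2) ^ m" by metis
    \<comment> \<open>Elements close to their projection and with bounded heights. An intersection
      over all late \<open>m\<close> is totally bounded, as at each scale it stays near a compact
      family.\<close>
    define Q where "Q m = {x. dist x (P m x) \<le> (1/2) ^ m} \<inter> {x. X m x \<le> c m}" for m
    have Qcl: "closed (Q m)" for m
      unfolding Q_def by (intro closed_Int closed_Collect_le continuous_intros Pcont Xc)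
    \<comment> \<open>\<open>Z'\<close> leaves \<open>Q (m0 + m)\<close> with probability at most
      \<open>2 * (1/2) ^ (m0 + m)\<close>; summed over \<open>m\<close> this is
      \<open>4 * (1/2) ^ m0\<close>.\<close>
    obtain m0 where m0: "(1/2::real) ^ m0 < \<epsilon> / 4"
      using real_arch_pow_inv[of "\<epsilon> / 4" "1/2"] \<open>\<epsilon> > 0\<close> by auto
    define K where "K = (\<Inter>m. Q (m0 + m))"
    have "closed K" unfolding K_def using Qcl by auto
    have "compact K"
      unfolding compact_eq_totally_bounded complete_eq_closed
    proof (intro conjI allI impI)
      show "closed K" by fact
      fix e :: real assume "e > 0"
      obtain m1 where m1: "(1/2::real) ^ m1 < e / 2"
        using real_arch_pow_inv[of "e / 2" "1/2"] \<open>e > 0\<close> by auto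
      define m where "m = m0 + m1"
      have m: "(1/2::real) ^ m < e / 2"
      proof -
        have "(1/2::real) ^ m \<le> (1/2) ^ m1" by (rule power_decreasing) (auto simp: m_def)
        with m1 show ?thesis by linarith
      qed
      \<comment> \<open>Compact by Tychonoff's theorem; its image under the step map contains the
        projections of all elements of \<open>K\<close>.\<close>
      define V where "V = (Pi\<^sub>E UNIV (\<lambda>i::nat. {- \<bar>c m\<bar>..\<bar>c m\<bar>}))"
      have "compactin (product_topology (\<lambda>_. euclidean) UNIV) V"
        unfolding V_def by (subst compactin_PiE) auto
      then have "compact V"
        unfolding euclidean_product_topology by (simp add: compactin_euclidean_iff)
      have "continuous_on V (\<lambda>v. step (r m) (a m) (b m) v)"
        by (intro continuous_step continuous_coordinate)
      then have "compact ((\<lambda>v. step (r m) (a m) (b m) v) ` V)"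
        using \<open>compact V\<close> by (rule compact_continuous_image)
      then obtain k where k: "finite k" "(\<lambda>v. step (r m) (a m) (b m) v) ` V \<subseteq> (\<Union>x\<in>k. ball x (e / 2))"
        using \<open>e > 0\<close> unfolding compact_eq_totally_bounded by (meson half_gt_zero)
      have "K \<subseteq> (\<Union>x\<in>k. ball x e)"
      proof
        fix x assume "x \<in> K"
        then have x: "x \<in> Q m" by (auto simp: K_def m_def)
        define v where "v i = (if i < r m then path x (a m i) else 0)" for i
        have "\<bar>v i\<bar> \<le> \<bar>c m\<bar>" for i
        proof (cases "i < r m")
          case True
          then have "\<bar>path x (a m i)\<bar> \<le> X m x"
            unfolding X_def by (intro member_le_sum[where f="\<lambda>i. \<bar>path x (a m i)\<bar>"]) auto
          moreover have "X m x \<le> c m" using x by (simp add: Q_def)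
          ultimately have "\<bar>path x (a m i)\<bar> \<le> \<bar>c m\<bar>" by linarith
          then show ?thesis using True by (simp add: v_def)
        qed (simp add: v_def)
        then have "v i \<in> {- \<bar>c m\<bar>..\<bar>c m\<bar>}" for i
          unfolding atLeastAtMost_iff by (metis abs_le_D1 abs_le_D2 minus_le_iff)
        then have "v \<in> V" by (simp add: V_def PiE_iff)
        moreover have "P m x = step (r m) (a m) (b m) v"
          unfolding P_def by (rule step_cong) (simp add: v_def)
        ultimately have "P m x \<in> (\<Union>x\<in>k. ball x (e / 2))" using k(2) by blast
        then obtain y where y: "y \<in> k" "dist y (P m x) < e / 2" by auto
        have "dist x (P m x) < e / 2" using x m by (simp add: Q_def)
        then have "dist y x < e"
          using y(2) dist_triangle[of y x "P m x"] by (simp add: dist_commute)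
        with y(1) show "x \<in> (\<Union>x\<in>k. ball x e)" by auto
      qed
      with k(1) show "\<exists>k. finite k \<and> K \<subseteq> (\<Union>x\<in>k. ball x e)" by blast
    qed
    have [measurable]: "K \<in> sets borel" using \<open>closed K\<close> by (rule borel_closed)
    define R where "R m = {\<omega> \<in> space N. Z' \<omega> \<notin> Q m}" for m
    have Qm: "Q m \<in> sets borel" for m using Qcl by (rule borel_closed)
    have Rm: "R m \<in> sets N" for m
      unfolding R_def using Qm[of m] by measurable
    have Rle: "measure N (R m) \<le> 2 * (1/2) ^ m" for m
    proof -
      have "X m \<in> borel_measurable borel" by (rule Xm)
      note [measurable] = this
      have "measure N (R m) \<le> measure N ((E m \<union> E0) \<union> {\<omega> \<in> space N. X m (Z' \<omega>) > c m})"
      proof (rule N.finite_measure_mono)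
        show "R m \<subseteq> (E m \<union> E0) \<union> {\<omega> \<in> space N. X m (Z' \<omega>) > c m}"
          by (auto simp: R_def Q_def E_def Z'_def not_le)
        show "(E m \<union> E0) \<union> {\<omega> \<in> space N. X m (Z' \<omega>) > c m} \<in> sets N" by measurable
      qed
      also have "\<dots> \<le> measure N (E m \<union> E0) + measure N {\<omega> \<in> space N. X m (Z' \<omega>) > c m}"
        by (intro measure_Un_le) measurable
      also have "measure N (E m \<union> E0) \<le> measure N (E m) + measure N E0"
        by (intro measure_Un_le) measurable
      finally show ?thesis
        using Ele[of m] c[of m] null_setsD1[OF E0(1)] by (simp add: measure_def)
    qed
    have sm: "summable (\<lambda>m. 2 * (1/2::real) ^ (m0 + m))"
      by (simp add: power_add summable_mult summable_geometric)
    have sR: "summable (\<lambda>m. measure N (R (m0 + m)))"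
      by (rule summable_comparison_test'[OF sm, of 0]) (use Rle in auto)
    have "measure N (\<Union>m. R (m0 + m)) \<le> (\<Sum>m. measure N (R (m0 + m)))"
      using Rm sR by (intro N.finite_measure_subadditive_countably) auto
    also have "\<dots> \<le> (\<Sum>m. 2 * (1/2::real) ^ (m0 + m))"
      using Rle sR sm by (intro suminf_le) auto
    also have "\<dots> = 4 * (1/2::real) ^ m0"
      by (simp add: power_add suminf_mult suminf_geometric summable_geometric)
    also have "\<dots> < \<epsilon>" using m0 by simp
    finally have "measure N (\<Union>m. R (m0 + m)) < \<epsilon>" .
    moreover have "Z' -` K \<inter> space N = space N - (\<Union>m. R (m0 + m))"
      by (auto simp: K_def R_def)
    ultimately have "measure (distr N borel Z') K > 1 - \<epsilon>"
      using Rm by (simp add: measure_distr N.prob_compl)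
    with \<open>compact K\<close> show ?thesis by blast
  qed
  have conv: "(\<lambda>n. outer_expectation M (\<lambda>\<omega>. f (Y n \<omega>))) \<longlonglongrightarrow> (LINT \<omega>|N. f (Z' \<omega>))"
    if f: "continuous_on UNIV f" "bounded (range f)" for f :: "cadlag0 \<Rightarrow> real"
  proof -
    obtain C where C: "\<And>x. \<bar>f x\<bar> \<le> C" using f(2) by (auto simp: bounded_iff)
    have C0: "C \<ge> 0" using C[of undefined] by linarith
    have proj_lim: "(\<lambda>m. LINT \<omega>|N. g (P m (Z \<omega>))) \<longlonglongrightarrow> (LINT \<omega>|N. g (Z' \<omega>))"
      if g: "continuous_on UNIV g" "\<And>x. \<bar>g x\<bar> \<le> D" for g :: "cadlag0 \<Rightarrow> real" and D
    proof (rule integral_dominated_convergence[where w="\<lambda>_. D"])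
      have [measurable]: "g \<in> borel_measurable borel" using g(1) by (rule borel_measurable_continuous_onI)
      show "(\<lambda>\<omega>. g (Z' \<omega>)) \<in> borel_measurable N" "(\<lambda>\<omega>. g (P m (Z \<omega>))) \<in> borel_measurable N" for m
        by measurable
      show "AE \<omega> in N. (\<lambda>m. g (P m (Z \<omega>))) \<longlonglongrightarrow> g (Z' \<omega>)"
        using AE_not_in[OF E0(1)] AE_space
      proof eventually_elim
        case (elim \<omega>)
        then have "(\<lambda>m. P m (Z \<omega>)) \<longlonglongrightarrow> Z' \<omega>" using PZlim[of \<omega>] by (simp add: Z'_def)
        then show ?case
          using continuous_on_tendsto_compose[OF g(1)] by simp
      qed
    qed (use g in auto)
    have Yconv: "(\<lambda>n. LINT \<omega>|M. g (P m (Y n \<omega>))) \<longlonglongrightarrow> (LINT \<omega>|N. g (P m (Z \<omega>)))"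
      if "continuous_on UNIV g" "\<And>x. \<bar>g x\<bar> \<le> D" for g :: "cadlag0 \<Rightarrow> real" and D m
      unfolding P_def by (rule proj_conv[OF that])
    show ?thesis
    proof (rule tendstoI)
      fix e :: real assume "e > 0"
      \<comment> \<open>The final error is below \<open>4 * \<eta> + 4 * C * \<eta>\<close> plus the
        slack left by \<open>8 * (C + 1) * \<eta> \<le> e\<close>, and
        \<open>\<eta> \<le> 1/2\<close> forces \<open>K\<close> to be nonempty.\<close>
      define \<eta> where "\<eta> = min (1/2) (e / (8 * (C + 1)))"
      have \<eta>: "\<eta> > 0" "\<eta> \<le> 1/2" "8 * (C + 1) * \<eta> \<le> e"
      proof -
        show "\<eta> > 0" using \<open>e > 0\<close> C0 by (simp add: \<eta>_def)
        show "\<eta> \<le> 1/2" unfolding \<eta>_def by (rule min.cobounded1)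
        have "\<eta> \<le> e / (8 * (C + 1))" by (simp add: \<eta>_def)
        then show "8 * (C + 1) * \<eta> \<le> e" using C0 by (simp add: pos_le_divide_eq mult.commute)
      qed
      obtain K where K: "compact K" "measure (distr N borel Z') K > 1 - \<eta>" using tight[OF \<eta>(1)] by auto
      have Kne: "K \<noteq> {}" using K(2) \<eta>(2) by auto
      have Km[measurable]: "K \<in> sets borel" using K(1) by (intro borel_closed compact_imp_closed)
      obtain \<epsilon> where \<epsilon>: "\<epsilon> > 0" "\<And>x y. x \<in> K \<Longrightarrow> dist x y < \<epsilon> \<Longrightarrow> \<bar>f x - f y\<bar> < \<eta>"
        using continuous_near_compact[OF f(1) K(1) \<eta>(1)] by blast
      \<comment> \<open>A continuous function equal to 1 on \<open>K\<close> and to 0 at distance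
        \<open>\<epsilon> / 2\<close> or more. Unlike an indicator it carries closeness to
        \<open>K\<close> from \<open>Z'\<close> to the projections of \<open>Z\<close>, and from
        these to the projections of \<open>Y n\<close>.\<close>
      define h where "h x = max 0 (1 - 2 * infdist x K / \<epsilon>)" for x
      have hc: "continuous_on UNIV h"
        unfolding h_def using \<epsilon>(1) by (intro continuous_intros) auto
      have h01: "0 \<le> h x" "h x \<le> 1" for x
        using \<epsilon>(1) infdist_nonneg[of x K] by (auto simp: h_def)
      have habs: "\<bar>h x\<bar> \<le> 1" for x using h01[of x] by simp
      have [measurable]: "h \<in> borel_measurable borel" "f \<in> borel_measurable borel"
        using hc f(1) by (auto intro: borel_measurable_continuous_onI)
      have hnear: "\<exists>x\<in>K. dist x y < \<epsilon> / 2" if "h y \<noteq> 0" for y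
      proof -
        have "infdist y K < \<epsilon> / 2" using that \<epsilon>(1) by (auto simp: h_def max_def field_simps split: if_splits)
        then show ?thesis
          unfolding infdist_notempty[OF Kne]
          by (subst (asm) cINF_less_iff[OF Kne]) (auto simp: dist_commute intro: bdd_belowI2[of _ 0])
      qed
      have "1 - \<eta> < (LINT \<omega>|N. (indicator K (Z' \<omega>) :: real))"
      proof -
        have "(LINT \<omega>|N. (indicator K (Z' \<omega>) :: real)) = (LINT x|distr N borel Z'. indicator K x)"
          by (subst integral_distr) auto
        then show ?thesis using K(2) by simp
      qed
      also have "\<dots> \<le> (LINT \<omega>|N. h (Z' \<omega>))"
      proof (rule integral_mono)
        show "integrable N (\<lambda>\<omega>. indicator K (Z' \<omega>) :: real)"
          by (rule N.integrable_const_bound[where B=1]) auto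
        show "integrable N (\<lambda>\<omega>. h (Z' \<omega>))"
          by (rule N.integrable_const_bound[where B=1]) (use habs in auto)
        show "indicator K (Z' \<omega>) \<le> h (Z' \<omega>)" for \<omega>
          using h01[of "Z' \<omega>"] by (cases "Z' \<omega> \<in> K") (auto simp: h_def)
      qed
      finally have hZ: "1 - \<eta> < (LINT \<omega>|N. h (Z' \<omega>))" .
      have "\<forall>\<^sub>F m in sequentially. (1/2::real) ^ m < min \<eta> (\<epsilon> / 2)"
        using \<eta>(1) \<epsilon>(1) by (intro order_tendstoD(2)[OF LIMSEQ_realpow_zero]) auto
      moreover have "\<forall>\<^sub>F m in sequentially. 1 - \<eta> < (LINT \<omega>|N. h (P m (Z \<omega>)))"
        by (rule order_tendstoD(1)[OF proj_lim[OF hc habs] hZ])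
      moreover have "\<forall>\<^sub>F m in sequentially. dist (LINT \<omega>|N. f (P m (Z \<omega>))) (LINT \<omega>|N. f (Z' \<omega>)) < \<eta>"
        by (rule tendstoD[OF proj_lim[OF f(1) C] \<eta>(1)])
      ultimately have "\<forall>\<^sub>F m in sequentially. (1/2::real) ^ m < min \<eta> (\<epsilon> / 2) \<and> 1 - \<eta> < (LINT \<omega>|N. h (P m (Z \<omega>)))
          \<and> dist (LINT \<omega>|N. f (P m (Z \<omega>))) (LINT \<omega>|N. f (Z' \<omega>)) < \<eta>"
        by eventually_elim simp
      \<comment> \<open>The projection is fixed here, fine enough for the limit process and for both
        tolerances; afterwards only \<open>n\<close> varies.\<close>
      then obtain m where m: "(1/2::real) ^ m < \<eta>" "(1/2::real) ^ m < \<epsilon> / 2" "1 - \<eta> < (LINT \<omega>|N. h (P m (Z \<omega>)))"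
          "dist (LINT \<omega>|N. f (P m (Z \<omega>))) (LINT \<omega>|N. f (Z' \<omega>)) < \<eta>"
        using eventually_happens'[OF sequentially_bot] by fastforce
      have "\<forall>\<^sub>F n in sequentially. 1 - \<eta> < (LINT \<omega>|M. h (P m (Y n \<omega>)))"
        by (rule order_tendstoD(1)[OF Yconv[OF hc habs] m(3)])
      moreover have "\<forall>\<^sub>F n in sequentially. dist (LINT \<omega>|M. f (P m (Y n \<omega>))) (LINT \<omega>|N. f (P m (Z \<omega>))) < \<eta>"
        by (rule tendstoD[OF Yconv[OF f(1) C] \<eta>(1)])
      ultimately show "\<forall>\<^sub>F n in sequentially. dist (outer_expectation M (\<lambda>\<omega>. f (Y n \<omega>))) (LINT \<omega>|N. f (Z' \<omega>)) < e"
        using small[of m]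
      proof eventually_elim
        case (elim n)
        \<comment> \<open>Off \<open>H\<close> the projection is within
          \<open>\<epsilon> / 2\<close> of a point of \<open>K\<close>, and the probability of
          \<open>H\<close> is at most 1 minus the mean of \<open>h\<close>.\<close>
        define H where "H = {\<omega> \<in> space M. h (P m (Y n \<omega>)) = 0}"
        have [measurable]: "H \<in> sets M" "A m n \<in> sets M" unfolding H_def by (measurable, rule A)
        have "(LINT \<omega>|M. h (P m (Y n \<omega>))) \<le> (LINT \<omega>|M. 1 - indicator H \<omega>)"
        proof (rule integral_mono)
          show "integrable M (\<lambda>\<omega>. h (P m (Y n \<omega>)))"
            by (rule M.integrable_const_bound[where B=1]) (use habs in auto)
          show "integrable M (\<lambda>\<omega>. 1 - indicator H \<omega> :: real)"
            by (rule M.integrable_const_bound[where B=1]) (auto split: split_indicator)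
          show "h (P m (Y n \<omega>)) \<le> 1 - indicator H \<omega>" for \<omega>
            using h01[of "P m (Y n \<omega>)"] by (cases "\<omega> \<in> H") (auto simp: H_def)
        qed
        also have "\<dots> = 1 - measure M H"
          by (subst Bochner_Integration.integral_diff) (auto simp: M.prob_space less_top[symmetric])
        finally have "measure M H < \<eta>" using elim by linarith
        moreover have "measure M (H \<union> A m n) \<le> measure M H + measure M (A m n)"
          by (rule measure_Un_le) auto
        ultimately have HA: "measure M (H \<union> A m n) \<le> 2 * \<eta>" using elim m by linarith
        have "\<bar>outer_expectation M (\<lambda>\<omega>. f (Y n \<omega>)) - (LINT \<omega>|M. f (P m (Y n \<omega>)))\<bar>
            \<le> 2 * \<eta> + 2 * C * measure M (H \<union> A m n)"
        proof (rule M.outer_expectation_approx)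
          fix \<omega> assume w: "\<omega> \<in> space M - (H \<union> A m n)"
          then have "h (P m (Y n \<omega>)) \<noteq> 0" by (auto simp: H_def)
          \<comment> \<open>Both \<open>Y n\<close> and its projection lie within
            \<open>\<epsilon>\<close> of this point of \<open>K\<close>, so their values under
            \<open>f\<close> differ by at most \<open>2 * \<eta>\<close>.\<close>
          then obtain x where x: "x \<in> K" "dist x (P m (Y n \<omega>)) < \<epsilon> / 2" using hnear by blast
          have "dist (Y n \<omega>) (P m (Y n \<omega>)) < \<epsilon> / 2" using near[of \<omega> m n] w m(2) by auto
          then have "dist x (Y n \<omega>) < \<epsilon>"
            using x(2) dist_triangle[of x "Y n \<omega>" "P m (Y n \<omega>)"] by (simp add: dist_commute)
          moreover have "dist x (P m (Y n \<omega>)) < \<epsilon>" using x(2) \<epsilon>(1) by simp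
          ultimately show "\<bar>f (Y n \<omega>) - f (P m (Y n \<omega>))\<bar> \<le> 2 * \<eta>"
            using \<epsilon>(2)[OF x(1), of "Y n \<omega>"] \<epsilon>(2)[OF x(1), of "P m (Y n \<omega>)"] by linarith
        qed (use C \<eta> in auto)
        also have "\<dots> \<le> 2 * \<eta> + 2 * C * (2 * \<eta>)"
          using HA C0 by (intro add_left_mono mult_left_mono) auto
        finally have "\<bar>outer_expectation M (\<lambda>\<omega>. f (Y n \<omega>)) - (LINT \<omega>|M. f (P m (Y n \<omega>)))\<bar> \<le> 2 * \<eta> + 4 * (C * \<eta>)"
          by simp
        moreover have "0 \<le> C * \<eta>" using C0 \<eta> by simp
        moreover have "8 * (C * \<eta>) + 8 * \<eta> \<le> e" using \<eta>(3) by (simp add: algebra_simps)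
        ultimately show ?case
          using elim m(4) \<eta>(1) unfolding dist_real_def by linarith
      qed
    qed
  qed
  show thesis by (rule that[OF Z'm Z'eq tight conv])
qed

end

theorem theorem4p2:
  fixes M :: "'a measure" and G :: "nat \<Rightarrow> 'a measure" and X :: "nat \<Rightarrow> 'a \<Rightarrow> real"
    and \<alpha> :: "'a \<Rightarrow> real measure" and \<kappa> :: "nat \<Rightarrow> 'a \<Rightarrow> real measure"
    and B :: "nat \<Rightarrow> 'a \<Rightarrow> cadlag0"
    and N :: "'b measure" and GF :: "'b \<Rightarrow> cadlag0"
  assumes "filtered_prob_space M G"
    and "cid M G X"
    and "directing_measure M G X \<alpha>"
    and "\<And>k. 1 \<le> k \<Longrightarrow> regular_cond_distr M (G (k - 1)) (X k) (\<kappa> k)"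
    and "\<And>n \<omega> t. 1 \<le> n \<Longrightarrow> \<omega> \<in> space M \<Longrightarrow>
           path (B n \<omega>) t =
             1 / sqrt (real n) * (\<Sum>k = 1..n. indicator {..t} (X k \<omega>) - measure (\<kappa> k \<omega>) {..t})"
    and "\<And>\<epsilon> \<eta> :: real. 0 < \<epsilon> \<Longrightarrow> 0 < \<eta> \<Longrightarrow>
           \<exists>\<P>. right_open_partition \<P> \<and>
             limsup (\<lambda>n. ereal (measure M {\<omega> \<in> space M.
               Max ((\<lambda>I. SUP (s, t) \<in> I \<times> I. \<bar>path (B n \<omega>) s - path (B n \<omega>) t\<bar>) ` \<P>) > \<epsilon>})) < ereal \<eta>"
    and "time_changed_bridge M \<alpha> N GF"
  shows "converges_in_distribution M B N GF \<and> tight_random_element N GF"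
proof -
  interpret cid_process M G X \<alpha> \<kappa>
    using assms(1-4) unfolding filtered_prob_space_def
    by (auto simp: cid_process_def cid_process_axioms_def)
  obtain W F where "prob_space N" and W: "brownian_bridge N W"
    and F: "\<And>\<omega>. \<omega> \<in> space N \<Longrightarrow> distribution_function (F \<omega>)"
    and indep: "prob_space.indep_var N (\<Pi>\<^sub>M u\<in>{0..1}. borel) (\<lambda>\<omega>. \<lambda>u\<in>{0..1}. W u \<omega>) (\<Pi>\<^sub>M t\<in>UNIV. borel) F"
    and fidi: "\<And>(r :: nat) t. distr N (\<Pi>\<^sub>M i\<in>{1..r}. borel) (\<lambda>\<omega>. \<lambda>i\<in>{1..r}. F \<omega> (t i))
         = distr M (\<Pi>\<^sub>M i\<in>{1..r}. borel) (\<lambda>\<omega>. \<lambda>i\<in>{1..r}. measure (\<alpha> \<omega>) {..t i})"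
    and GF: "AE \<omega> in N. \<forall>t. path (GF \<omega>) t = W (F \<omega> t) \<omega>"
    using assms(7) unfolding time_changed_bridge_def by blast
  interpret N: bridge_time_change N W F
    using \<open>prob_space N\<close> W F indep by (simp add: bridge_time_change_def bridge_time_change_axioms_def)
  \<comment> \<open>\<open>GF\<close> is given only through an almost sure identity; an almost
    surely equal element with measurable coordinates takes its place.\<close>
  obtain Z0 where Z0: "\<And>t. (\<lambda>\<omega>. path (Z0 \<omega>) t) \<in> borel_measurable N" "AE \<omega> in N. GF \<omega> = Z0 \<omega>"
    using N.coordinate_measurable_version[OF GF] by blast
  define \<alpha>_cdf where "\<alpha>_cdf t \<omega> = measure (\<alpha> \<omega>) {..t}" for t \<omega>
  have \<alpha>_cdf[measurable]: "\<alpha>_cdf t \<in> borel_measurable M" for t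
    unfolding \<alpha>_cdf_def by (rule measurable_compose[OF \<alpha>_meas measurable_measure_prob_algebra]) simp
  \<comment> \<open>The formula for the paths of \<open>B n\<close> is available for
    \<open>n \<ge> 1\<close>, so the argument runs along \<open>Suc n\<close>.\<close>
  have B_meas: "(\<lambda>\<omega>. path (B (Suc n) \<omega>) t) \<in> borel_measurable M" for n t
  proof -
    have [measurable]: "X k \<in> borel_measurable M" "(\<lambda>\<omega>. measure (\<kappa> k \<omega>) {..t}) \<in> borel_measurable M"
      if "k \<in> {1..Suc n}" for k
    proof -
      obtain j where j: "k = Suc j" using \<open>k \<in> {1..Suc n}\<close> by (cases k) auto
      show "X k \<in> borel_measurable M" unfolding j by (rule X_meas_M)
      show "(\<lambda>\<omega>. measure (\<kappa> k \<omega>) {..t}) \<in> borel_measurable M"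
        unfolding j by (rule measurable_compose[OF \<kappa>_meas_M measurable_measure_prob_algebra]) simp
    qed
    have "(\<lambda>\<omega>. 1 / sqrt (real (Suc n)) * (\<Sum>k = 1..Suc n. indicator {..t} (X k \<omega>) - measure (\<kappa> k \<omega>) {..t}))
        \<in> borel_measurable M"
      by measurable
    then show ?thesis
      by (subst measurable_cong[OF assms(5)]) auto
  qed
  have char_conv: "(\<lambda>n. LINT \<omega>|M. iexp (\<Sum>i<r. c i * path (B (Suc n) \<omega>) (\<tau> i)))
      \<longlonglongrightarrow> (LINT \<omega>|N. iexp (\<Sum>i<r. c i * path (Z0 \<omega>) (\<tau> i)))" for r :: nat and c \<tau>
  proof -
    \<comment> \<open>The hypothesis on finite-dimensional laws is indexed by \<open>{1..r}\<close>
      and the sums by \<open>i < r\<close>; hence \<open>Suc i\<close> here and \<open>i - 1\<close>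
      in the families below.\<close>
    let ?Q = "\<lambda>x. bridge_char r c (\<lambda>i. x (Suc i))"
    let ?P = "\<Pi>\<^sub>M i\<in>{1..r}. borel :: real measure"
    have Q: "?Q \<in> borel_measurable ?P"
    proof -
      have "(\<lambda>x. x (Suc i)) \<in> borel_measurable ?P" if "i < r" for i
        using that by (intro measurable_component_singleton) auto
      then have "(\<lambda>x. bridge_form r c (\<lambda>i. x (Suc i))) \<in> borel_measurable ?P"
        unfolding bridge_form_def
        by (intro borel_measurable_sum borel_measurable_times borel_measurable_diff borel_measurable_min
            borel_measurable_const) auto
      note [measurable] = this
      show ?thesis by measurable
    qed
    have form_eq: "bridge_form r c (\<lambda>i. (\<lambda>i\<in>{1..r}. u (\<tau> (i - 1))) (Suc i)) = bridge_form r c (\<lambda>i. u (\<tau> i))"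
      for u :: "real \<Rightarrow> real"
      unfolding bridge_form_def by (intro sum.cong refl) auto
    have "AE \<omega> in N. path (Z0 \<omega>) t = W (F \<omega> t) \<omega>" for t
      using GF Z0(2) by eventually_elim simp
    then have "(LINT \<omega>|N. iexp (\<Sum>i<r. c i * path (Z0 \<omega>) (\<tau> i)))
        = (LINT \<omega>|N. bridge_char r c (\<lambda>i. F \<omega> (\<tau> i)))"
      by (intro N.time_changed_char Z0)
    also have "\<dots> = (\<integral>x. ?Q x \<partial>distr N ?P (\<lambda>\<omega>. \<lambda>i\<in>{1..r}. F \<omega> (\<tau> (i - 1))))"
    proof -
      have rm: "(\<lambda>\<omega>. \<lambda>i\<in>{1..r}. F \<omega> (\<tau> (i - 1))) \<in> N \<rightarrow>\<^sub>M ?P"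
        by (intro measurable_restrict N.F_meas)
      show ?thesis
        unfolding integral_distr[OF rm Q] form_eq ..
    qed
    also have "\<dots> = (\<integral>x. ?Q x \<partial>distr M ?P (\<lambda>\<omega>. \<lambda>i\<in>{1..r}. \<alpha>_cdf (\<tau> (i - 1)) \<omega>))"
      unfolding \<alpha>_cdf_def fidi[of r "\<lambda>i. \<tau> (i - 1)"] ..
    also have "\<dots> = (LINT \<omega>|M. bridge_char r c (\<lambda>i. \<alpha>_cdf (\<tau> i) \<omega>))"
    proof -
      have rm: "(\<lambda>\<omega>. \<lambda>i\<in>{1..r}. \<alpha>_cdf (\<tau> (i - 1)) \<omega>) \<in> M \<rightarrow>\<^sub>M ?P"
        by (intro measurable_restrict \<alpha>_cdf)
      show ?thesis
        unfolding integral_distr[OF rm Q] form_eq[of "\<lambda>t. \<alpha>_cdf t \<omega>" for \<omega>] ..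
    qed
    finally have lim: "(LINT \<omega>|N. iexp (\<Sum>i<r. c i * path (Z0 \<omega>) (\<tau> i)))
        = (LINT \<omega>|M. bridge_char r c (\<lambda>i. measure (\<alpha> \<omega>) {..\<tau> i}))"
      unfolding \<alpha>_cdf_def .
    have "(\<Sum>i<r. c i * path (B (Suc n) \<omega>) (\<tau> i)) = 1 / sqrt (Suc n) * (\<Sum>k<Suc n. \<Sum>i<r. c i * compensated k (\<tau> i) \<omega>)" if "\<omega> \<in> space M" for n \<omega>
    proof -
      have Bp: "path (B (Suc n) \<omega>) t = 1 / sqrt (Suc n) * (\<Sum>k<Suc n. compensated k t \<omega>)" for t
      proof -
        have "1 \<le> Suc n" by simp
        from assms(5)[OF this that, of t] show ?thesis
          unfolding One_nat_def sum.atLeast1_atMost_eq .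
      qed
      have "(\<Sum>i<r. c i * path (B (Suc n) \<omega>) (\<tau> i)) = (\<Sum>i<r. c i * (1 / sqrt (Suc n) * (\<Sum>k<Suc n. compensated k (\<tau> i) \<omega>)))"
        unfolding Bp ..
      also have "\<dots> = 1 / sqrt (Suc n) * (\<Sum>i<r. \<Sum>k<Suc n. c i * compensated k (\<tau> i) \<omega>)"
        by (simp only: sum_distrib_left mult.left_commute)
      also have "(\<Sum>i<r. \<Sum>k<Suc n. c i * compensated k (\<tau> i) \<omega>)
        = (\<Sum>k<Suc n. \<Sum>i<r. c i * compensated k (\<tau> i) \<omega>)"
        by (rule sum.swap)
      finally show ?thesis .
    qed
    then have "(LINT \<omega>|M. iexp (\<Sum>i<r. c i * path (B (Suc n) \<omega>) (\<tau> i)))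
        = (LINT \<omega>|M. iexp (1 / sqrt (Suc n) * (\<Sum>k<Suc n. \<Sum>i<r. c i * compensated k (\<tau> i) \<omega>)))" for n
      by (intro Bochner_Integration.integral_cong refl) (simp only:)
    with LIMSEQ_Suc[OF compensated_sums_mixed_normal[of c \<tau> r]] show ?thesis
      unfolding lim by (simp only:)
  qed
  interpret asymptotically_step M N "\<lambda>n. B (Suc n)" Z0
  proof
    fix \<epsilon> \<eta> :: real assume "0 < \<epsilon>" "0 < \<eta>"
    then obtain \<P> where \<P>: "right_open_partition \<P>"
      and lim: "limsup (\<lambda>n. ereal (measure M {\<omega> \<in> space M. max_oscillation \<P> (B n \<omega>) > \<epsilon>})) < ereal \<eta>"
      using assms(6) by blast
    obtain r a b where grid: "\<And>x e. (\<And>I s t. I \<in> \<P> \<Longrightarrow> s \<in> I \<Longrightarrow> t \<in> I \<Longrightarrow> \<bar>path x s - path x t\<bar> \<le> e)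
        \<Longrightarrow> dist x (proj r a b x) \<le> e"
      using step_approximation[OF \<P>] by blast
    define A where "A n = {\<omega> \<in> space M. max_oscillation \<P> (B (Suc n) \<omega>) > \<epsilon>}" for n
    have "A n \<in> sets M" for n
      unfolding A_def by (rule max_oscillation_measurable[OF \<P> B_meas])
    moreover have "dist (B (Suc n) \<omega>) (proj r a b (B (Suc n) \<omega>)) \<le> \<epsilon>" if "\<omega> \<in> space M - A n" for n \<omega>
    proof (rule grid)
      have "max_oscillation \<P> (B (Suc n) \<omega>) \<le> \<epsilon>" using that by (auto simp: A_def)
      then show "\<bar>path (B (Suc n) \<omega>) s - path (B (Suc n) \<omega>) t\<bar> \<le> \<epsilon>" if "I \<in> \<P>" "s \<in> I" "t \<in> I" for I s t
        using that unfolding max_oscillation_le_iff(1)[OF \<P>] by blast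
    qed
    moreover have "\<forall>\<^sub>F n in sequentially. measure M (A n) < \<eta>"
    proof -
      have "\<forall>\<^sub>F n in sequentially. measure M {\<omega> \<in> space M. max_oscillation \<P> (B n \<omega>) > \<epsilon>} < \<eta>"
        using Limsup_lessD[OF lim] by simp
      then show ?thesis
        unfolding A_def by (rule eventually_compose_filterlim[OF _ filterlim_Suc])
    qed
    ultimately show "\<exists>r a b A. (\<forall>n. A n \<in> sets M) \<and>
        (\<forall>n. \<forall>\<omega>\<in>space M - A n. dist (B (Suc n) \<omega>) (proj r a b (B (Suc n) \<omega>)) \<le> \<epsilon>) \<and>
        (\<forall>\<^sub>F n in sequentially. measure M (A n) < \<eta>)"
      by blast
  qed (rule B_meas Z0(1) char_conv)+
  obtain Z' where Z': "Z' \<in> borel_measurable N" "AE \<omega> in N. Z0 \<omega> = Z' \<omega>"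
    and tight: "\<And>\<epsilon>. \<epsilon> > 0 \<Longrightarrow> \<exists>K. compact K \<and> measure (distr N borel Z') K > 1 - \<epsilon>"
    and conv: "\<And>f :: cadlag0 \<Rightarrow> real. continuous_on UNIV f \<Longrightarrow> bounded (range f) \<Longrightarrow>
      (\<lambda>n. outer_expectation M (\<lambda>\<omega>. f (B (Suc n) \<omega>))) \<longlonglongrightarrow> (LINT \<omega>|N. f (Z' \<omega>))"
    by (rule convergence_and_tightness) blast
  have "AE \<omega> in N. GF \<omega> = Z' \<omega>"
    using Z0(2) Z'(2) by eventually_elim simp
  then have version: "measurable_version N GF Z'"
    using Z'(1) by (simp add: measurable_version_def)
  \<comment> \<open>The value at \<open>n = 0\<close> does not influence the limit, so the shift is
    undone.\<close>
  have conv': "(\<lambda>n. outer_expectation M (\<lambda>\<omega>. f (B n \<omega>))) \<longlonglongrightarrow> (LINT \<omega>|N. f (Z' \<omega>))"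
    if "continuous_on UNIV f" "bounded (range f)" for f :: "cadlag0 \<Rightarrow> real"
    by (rule LIMSEQ_imp_Suc) (rule conv[OF that])
  show ?thesis
    unfolding converges_in_distribution_def tight_random_element_def
    by (intro conjI exI[of _ Z'] version allI impI conv' tight)
qed

end
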